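(* Let $(N^4,I,J,K)$ be a compact $4$-dimensional hyperkähler manifold with Kähler forms $\omega_I,\omega_J,\omega_K$. Then on the $6$-dimensional manifold $M^6=N^4\times\mathbb{T}^2$ there exist solutions to the SUSY equations IIA and IIB. More precisely, let $\beta^1,\beta^2$ be a basis of closed $1$-forms on the torus $\mathbb{T}^2$, and let $k_{||},k_\perp\in(0,1)$ be constants with $k_{||}^2+k_\perp^2=1$. Then $(\alpha,Re(\Omega)_{||},Re(\Omega)_\perp,Im(\Omega))$ given by $$Re(\alpha)=\beta^1,\quad Im(\alpha)=\frac1{k_{||}}\beta^2,\quad Re(\Omega)_{||}=-k_{||}\,\omega_J,\quad Re(\Omega)_\perp=k_\perp\,\omega_K,\quad Im(\Omega)=\omega_I$$ solves the SUSY equations IIA, and $(\alpha,Re(\Omega)_{||},Re(\Omega)_\perp,Im(\Omega))$ given by $$Re(\alpha)=\frac1{k_{||}}\beta^1,\quad Im(\alpha)=\beta^2,\quad Re(\Omega)_{||}=k_\perp\,\omega_K,\quad Re(\Omega)_\perp=k_{||}\,\omega_I,\quad Im(\Omega)=\omega_J$$ solves the SUSY equations IIB.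
   Context: A Riemannian manifold $(N,h)$ is hyperkähler if there are three complex structures $I,J,K$ on $N$ satisfying the quaternion relations $I^2=J^2=K^2=-1$, $IJ=K=-JI$, and such that $I,J,K$ are parallel; $\omega_I,\omega_J,\omega_K$ are the corresponding Kähler forms, $\omega_I(X,Y)=h(IX,Y)$, etc. Forms on the factors are pulled back to $M^6$. An $SU(2)$ structure $(J,g,\alpha,\omega,\Omega)$ on a $6$-manifold $M^6$ consists of an almost Hermitian structure $(J,g)$, a $(1,0)$-form $\alpha$ with $\|\alpha\|^2=i_{\overline\alpha}\alpha=2$, a real $2$-form $\omega$ and a $(2,0)$-form $\Omega$ with $\omega^2=\frac12\Omega\wedge\overline\Omega\neq0$, $\omega\wedge\Omega=0$, $\Omega\wedge\Omega=0$, $i_\alpha\Omega=0$, $i_\alpha\omega=0$, where $i_\alpha$ denotes contraction by the vector field dual to $\alpha$; the fundamental $2$-form $F(X,Y)=g(JX,Y)$ of $(J,g)$ is $F=\omega+\frac i2\alpha\wedge\overline\alpha$. The pair $(J,g)$ is determined by $(\alpha,\omega,\Omega)$. Projection forms: given an $SU(2)$ structure and the constants $k_{||},k_\perp$, put $$Re(\Omega)_{||}=\tfrac12\big((1-\cos2\phi)Re(\Omega)+\sin(2\phi)\,\omega\big),\quad Re(\Omega)_\perp=\tfrac12\big((1+\cos2\phi)Re(\Omega)-\sin(2\phi)\,\omega\big),$$ where for type IIA $\phi\in(-\frac\pi2,0)$ is defined by $k_{||}=-\sin\phi$, $k_\perp=\cos\phi$, and for type IIB $\phi\in(0,\frac\pi2)$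 is defined by $k_{||}=\cos\phi$, $k_\perp=\sin\phi$. Forms $(\alpha,Re(\Omega)_{||},Re(\Omega)_\perp,Im(\Omega))$ arising in this way from an $SU(2)$ structure solve the SUSY equations IIA, resp. IIB, if the following hold for the $3$-form $H$ determined by $k_{||}H=k_\perp d(Im(\Omega))$. SUSY equations IIA: $$d(Re(\alpha))=0,\qquad k_{||}H=k_\perp d(Im(\Omega)),\qquad d(Re(\Omega)_\perp)=k_{||}k_\perp Re(\alpha)\wedge d(Im(\alpha)),$$ $$H\wedge Re(\alpha)=-\frac{k_\perp}{k_{||}}\,d\big(Im(\alpha)\wedge Re(\Omega)_{||}\big).$$ SUSY equations IIB: $$d(Re(\alpha))=0,\qquad d(Im(\alpha))=0,\qquad k_{||}H=k_\perp d(Im(\Omega)),$$ $$Re(\alpha)\wedge H=-\frac{k_\perp}{k_{||}}Im(\alpha)\wedge d(Re(\Omega)_\perp),\qquad Im(\alpha)\wedge H=\frac{k_\perp}{k_{||}}Re(\alpha)\wedge d(Re(\Omega)_\perp),$$ $$Re(\alpha)\wedge Im(\alpha)\wedge d(Re(\Omega)_{||})=-H\wedge Im(\Omega).$$ *)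

theory Defs
  imports "HOL-Analysis.Analysis"
begin

section \<open>Smooth maps between open subsets of Euclidean spaces\<close>

primrec Ck_on ::
  "nat \<Rightarrow> 'e::real_normed_vector set \<Rightarrow> ('e \<Rightarrow> 'f::real_normed_vector) \<Rightarrow> bool" where
  "Ck_on 0 S f \<longleftrightarrow> continuous_on S f"
| "Ck_on (Suc n) S f \<longleftrightarrow> (\<forall>x\<in>S. f differentiable at x) \<and>
     (\<forall>v. Ck_on n S (\<lambda>x. frechet_derivative f (at x) v))"

definition smooth_on ::
  "'e::real_normed_vector set \<Rightarrow> ('e \<Rightarrow> 'f::real_normed_vector) \<Rightarrow> bool" where
  "smooth_on S f \<longleftrightarrow> (\<forall>n. Ck_on n S f)"


section \<open>Manifolds with an indexed atlas\<close>

text \<open>The point set is the \<^const>\<open>topspace\<close> of \<open>mtop\<close>; chart \<open>i\<close> is the map \<open>cmap i\<close> restricted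
  to its domain \<open>cdom i\<close>. The atlas need not be maximal.\<close>

record ('a, 'i, 'e) mfd =
  mtop :: "'a topology"
  charts :: "'i set"
  cdom :: "'i \<Rightarrow> 'a set"
  cmap :: "'i \<Rightarrow> 'a \<Rightarrow> 'e"

definition cimage :: "('a, 'i, 'e) mfd \<Rightarrow> 'i \<Rightarrow> 'e set" where
  "cimage M i = cmap M i ` cdom M i"

definition cinv :: "('a, 'i, 'e) mfd \<Rightarrow> 'i \<Rightarrow> 'e \<Rightarrow> 'a" where
  "cinv M i = inv_into (cdom M i) (cmap M i)"

definition overlap :: "('a, 'i, 'e) mfd \<Rightarrow> 'i \<Rightarrow> 'i \<Rightarrow> 'e set" where
  "overlap M i j = cmap M i ` (cdom M i \<inter> cdom M j)"

definition transition :: "('a, 'i, 'e) mfd \<Rightarrow> 'i \<Rightarrow> 'i \<Rightarrow> 'e \<Rightarrow> 'e" where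
  "transition M i j = cmap M j \<circ> cinv M i"

definition smooth_manifold :: "('a, 'i, 'e::euclidean_space) mfd \<Rightarrow> bool" where
  "smooth_manifold M \<longleftrightarrow>
     Hausdorff_space (mtop M) \<and> second_countable (mtop M) \<and>
     (\<Union>i\<in>charts M. cdom M i) = topspace (mtop M) \<and>
     (\<forall>i\<in>charts M. openin (mtop M) (cdom M i) \<and> open (cimage M i) \<and>
        homeomorphic_map (subtopology (mtop M) (cdom M i)) (top_of_set (cimage M i)) (cmap M i)) \<and>
     (\<forall>i\<in>charts M. \<forall>j\<in>charts M. smooth_on (overlap M i j) (transition M i j))"

definition prod_mfd ::
  "('a, 'i, 'e) mfd \<Rightarrow> ('b, 'j, 'f) mfd \<Rightarrow> ('a \<times> 'b, 'i \<times> 'j, 'e \<times> 'f) mfd" where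
  "prod_mfd M N = \<lparr> mtop = prod_topology (mtop M) (mtop N),
     charts = charts M \<times> charts N,
     cdom = (\<lambda>(i, j). cdom M i \<times> cdom N j),
     cmap = (\<lambda>(i, j). map_prod (cmap M i) (cmap N j)) \<rparr>"

text \<open>The chart with index \<open>a\<close> is the angle, with values in \<open>(a, a + 2\<pi>)\<close>.\<close>

definition circle :: "(complex, real, real) mfd" where
  "circle = \<lparr> mtop = top_of_set (sphere 0 1),
     charts = UNIV,
     cdom = (\<lambda>a. cis ` {a<..<a + 2 * pi}),
     cmap = (\<lambda>a. the_inv_into {a<..<a + 2 * pi} cis) \<rparr>"

definition torus :: "(complex \<times> complex, real \<times> real, real \<times> real) mfd" where
  "torus = prod_mfd circle circle"


section \<open>Tensor fields through their local representatives\<close>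

text \<open>A tensor field is the family of its local representatives in the charts of the atlas: \<open>\<omega> i x\<close>
  is the value in chart \<open>i\<close> at the point with coordinates \<open>x\<close>, as a tensor on the model space.
  Representatives in different charts are related by the transformation law. Values outside the
  chart images, and values of a \<open>k\<close>-form on lists of length other than \<open>k\<close>, are irrelevant, so that
  equality of forms is \<open>form_eq\<close>. Forms are real-valued or complex-valued.\<close>

type_synonym ('i, 'e, 'v) form = "'i \<Rightarrow> 'e \<Rightarrow> 'e list \<Rightarrow> 'v"

definition multilinear_alternating ::
  "nat \<Rightarrow> ('e::real_vector list \<Rightarrow> 'v::real_vector) \<Rightarrow> bool" where
  "multilinear_alternating k f \<longleftrightarrow>
     (\<forall>vs. length vs = k \<longrightarrow>
        (\<forall>j<k. linear (\<lambda>v. f (vs[j := v]))) \<and>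
        (\<forall>j<k. \<forall>l<k. j \<noteq> l \<and> vs ! j = vs ! l \<longrightarrow> f vs = 0))"

definition diff_form ::
  "('a, 'i, 'e::euclidean_space) mfd \<Rightarrow> nat \<Rightarrow> ('i, 'e, 'v::real_normed_vector) form \<Rightarrow> bool" where
  "diff_form M k \<omega> \<longleftrightarrow>
     (\<forall>i\<in>charts M. (\<forall>x\<in>cimage M i. multilinear_alternating k (\<omega> i x)) \<and>
        (\<forall>vs. length vs = k \<longrightarrow> smooth_on (cimage M i) (\<lambda>x. \<omega> i x vs))) \<and>
     (\<forall>i\<in>charts M. \<forall>j\<in>charts M. \<forall>x\<in>overlap M i j. \<forall>vs. length vs = k \<longrightarrow>
        \<omega> i x vs = \<omega> j (transition M i j x)
          (map (frechet_derivative (transition M i j) (at x)) vs))"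

definition form_eq ::
  "('a, 'i, 'e) mfd \<Rightarrow> nat \<Rightarrow> ('i, 'e, 'v) form \<Rightarrow> ('i, 'e, 'v) form \<Rightarrow> bool" where
  "form_eq M k \<omega> \<eta> \<longleftrightarrow>
     (\<forall>i\<in>charts M. \<forall>x\<in>cimage M i. \<forall>vs. length vs = k \<longrightarrow> \<omega> i x vs = \<eta> i x vs)"

definition zero_form :: "('i, 'e, 'v::zero) form" where
  "zero_form = (\<lambda>i x vs. 0)"

text \<open>Wedge product with first factor of degree \<open>k\<close>, as the sum over shuffles, normalised such that
  \<open>(a \<and> b)(X, Y) = a(X) b(Y) - a(Y) b(X)\<close> for 1-forms. The set \<open>S\<close> holds the positions of the
  arguments of the first factor; the exponent counts the inversions of the shuffle.\<close>

definition wedge ::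
  "nat \<Rightarrow> ('i, 'e, 'v) form \<Rightarrow> ('i, 'e, 'v) form \<Rightarrow> ('i, 'e, 'v::comm_ring_1) form" where
  "wedge k a b = (\<lambda>i x vs. \<Sum>S | S \<subseteq> {..<length vs} \<and> card S = k.
     (- 1) ^ card {(s, t). s \<in> S \<and> t \<in> {..<length vs} - S \<and> t < s} *
     (a i x (nths vs S) * b i x (nths vs (- S))))"

text \<open>In a chart, constant vector fields \<open>v\<^sub>0, \<dots>, v\<^sub>k\<close> commute, hence
  \<open>d\<omega>(v\<^sub>0, \<dots>, v\<^sub>k)\<close> is the alternating sum of the derivatives along \<open>v\<^sub>j\<close> of \<open>\<omega>\<close> evaluated on
  the remaining vectors.\<close>

definition ext_deriv ::
  "('i, 'e, 'v) form \<Rightarrow> ('i, 'e::real_normed_vector, 'v::real_normed_vector) form" where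
  "ext_deriv \<omega> = (\<lambda>i x vs. \<Sum>j<length vs. (- 1) ^ j *\<^sub>R
     frechet_derivative (\<lambda>y. \<omega> i y (take j vs @ drop (Suc j) vs)) (at x) (vs ! j))"

text \<open>Pullback of forms along a map \<open>f\<close> between the underlying point sets. By the transformation law
  it does not depend on the chart \<open>j\<close> chosen around the image point.\<close>

definition pullback ::
  "('a, 'i, 'e::real_normed_vector) mfd \<Rightarrow> ('b, 'j, 'f::real_normed_vector) mfd \<Rightarrow> ('a \<Rightarrow> 'b) \<Rightarrow>
   ('j, 'f, 'v) form \<Rightarrow> ('i, 'e, 'v) form" where
  "pullback M N f \<omega> = (\<lambda>i x vs.
     let j = (SOME j. j \<in> charts N \<and> f (cinv M i x) \<in> cdom N j);
         F = cmap N j \<circ> f \<circ> cinv M i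
     in \<omega> j (F x) (map (frechet_derivative F (at x)) vs))"

definition re_form :: "('i, 'e, complex) form \<Rightarrow> ('i, 'e, real) form" where
  "re_form \<eta> = (\<lambda>i x vs. Re (\<eta> i x vs))"

definition im_form :: "('i, 'e, complex) form \<Rightarrow> ('i, 'e, real) form" where
  "im_form \<eta> = (\<lambda>i x vs. Im (\<eta> i x vs))"

definition cnj_form :: "('i, 'e, complex) form \<Rightarrow> ('i, 'e, complex) form" where
  "cnj_form \<eta> = (\<lambda>i x vs. cnj (\<eta> i x vs))"

definition of_real_form :: "('i, 'e, real) form \<Rightarrow> ('i, 'e, complex) form" where
  "of_real_form \<omega> = (\<lambda>i x vs. complex_of_real (\<omega> i x vs))"

definition complex_form :: "('i, 'e, real) form \<Rightarrow> ('i, 'e, real) form \<Rightarrow> ('i, 'e, complex) form" where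
  "complex_form a b = (\<lambda>i x vs. Complex (a i x vs) (b i x vs))"

definition scale_form :: "real \<Rightarrow> ('i, 'e, 'v::real_vector) form \<Rightarrow> ('i, 'e, 'v) form" where
  "scale_form c \<omega> = (\<lambda>i x vs. c *\<^sub>R \<omega> i x vs)"

text \<open>\<open>b1\<close>, \<open>b2\<close> are closed 1-forms whose values form a basis of each cotangent space.\<close>

definition closed_coframe2 ::
  "('a, 'i, 'e::euclidean_space) mfd \<Rightarrow> ('i, 'e, real) form \<Rightarrow> ('i, 'e, real) form \<Rightarrow> bool" where
  "closed_coframe2 M b1 b2 \<longleftrightarrow>
     diff_form M 1 b1 \<and> diff_form M 1 b2 \<and>
     form_eq M 2 (ext_deriv b1) zero_form \<and> form_eq M 2 (ext_deriv b2) zero_form \<and>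
     (\<forall>i\<in>charts M. \<forall>x\<in>cimage M i. \<forall>l. linear l \<longrightarrow>
        (\<exists>!c::real \<times> real. \<forall>v. l v = fst c * b1 i x [v] + snd c * b2 i x [v]))"


section \<open>Metrics, connections and complex structures\<close>

type_synonym ('i, 'e) metric_field = "'i \<Rightarrow> 'e \<Rightarrow> 'e \<Rightarrow> 'e \<Rightarrow> real"
type_synonym ('i, 'e) endo_field = "'i \<Rightarrow> 'e \<Rightarrow> 'e \<Rightarrow> 'e"
type_synonym ('i, 'e) christoffel = "'i \<Rightarrow> 'e \<Rightarrow> 'e \<Rightarrow> 'e \<Rightarrow> 'e"

definition riemannian_metric ::
  "('a, 'i, 'e::euclidean_space) mfd \<Rightarrow> ('i, 'e) metric_field \<Rightarrow> bool" where
  "riemannian_metric M g \<longleftrightarrow>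
     (\<forall>i\<in>charts M. (\<forall>x\<in>cimage M i. bilinear (g i x) \<and> (\<forall>v w. g i x v w = g i x w v) \<and>
                      (\<forall>v. v \<noteq> 0 \<longrightarrow> 0 < g i x v v)) \<and>
        (\<forall>v w. smooth_on (cimage M i) (\<lambda>x. g i x v w))) \<and>
     (\<forall>i\<in>charts M. \<forall>j\<in>charts M. \<forall>x\<in>overlap M i j. \<forall>v w.
        g i x v w = g j (transition M i j x)
          (frechet_derivative (transition M i j) (at x) v)
          (frechet_derivative (transition M i j) (at x) w))"

definition endomorphism_field ::
  "('a, 'i, 'e::euclidean_space) mfd \<Rightarrow> ('i, 'e) endo_field \<Rightarrow> bool" where
  "endomorphism_field M A \<longleftrightarrow>
     (\<forall>i\<in>charts M. (\<forall>x\<in>cimage M i. linear (A i x)) \<and>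
        (\<forall>v. smooth_on (cimage M i) (\<lambda>x. A i x v))) \<and>
     (\<forall>i\<in>charts M. \<forall>j\<in>charts M. \<forall>x\<in>overlap M i j. \<forall>v.
        frechet_derivative (transition M i j) (at x) (A i x v) =
        A j (transition M i j x) (frechet_derivative (transition M i j) (at x) v))"

definition almost_complex_structure ::
  "('a, 'i, 'e::euclidean_space) mfd \<Rightarrow> ('i, 'e) endo_field \<Rightarrow> bool" where
  "almost_complex_structure M A \<longleftrightarrow> endomorphism_field M A \<and>
     (\<forall>i\<in>charts M. \<forall>x\<in>cimage M i. \<forall>v. A i x (A i x v) = - v)"

definition lie_bracket :: "('e \<Rightarrow> 'e) \<Rightarrow> ('e \<Rightarrow> 'e) \<Rightarrow> 'e \<Rightarrow> 'e::real_normed_vector" where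
  "lie_bracket X Y = (\<lambda>x. frechet_derivative Y (at x) (X x) - frechet_derivative X (at x) (Y x))"

text \<open>Integrability is the vanishing of the Nijenhuis tensor
  \<open>[AX, AY] - A[AX, Y] - A[X, AY] - [X, Y]\<close>; since this is tensorial in \<open>X\<close> and \<open>Y\<close>, it suffices
  to test it on constant vector fields in each chart.\<close>

definition complex_structure ::
  "('a, 'i, 'e::euclidean_space) mfd \<Rightarrow> ('i, 'e) endo_field \<Rightarrow> bool" where
  "complex_structure M A \<longleftrightarrow> almost_complex_structure M A \<and>
     (\<forall>i\<in>charts M. \<forall>x\<in>cimage M i. \<forall>v w.
        lie_bracket (\<lambda>y. A i y v) (\<lambda>y. A i y w) x
        - A i x (lie_bracket (\<lambda>y. A i y v) (\<lambda>y. w) x)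
        - A i x (lie_bracket (\<lambda>y. v) (\<lambda>y. A i y w) x)
        - lie_bracket (\<lambda>y. v) (\<lambda>y. w) x = 0)"

definition hermitian ::
  "('a, 'i, 'e) mfd \<Rightarrow> ('i, 'e) metric_field \<Rightarrow> ('i, 'e) endo_field \<Rightarrow> bool" where
  "hermitian M g A \<longleftrightarrow>
     (\<forall>i\<in>charts M. \<forall>x\<in>cimage M i. \<forall>v w. g i x (A i x v) (A i x w) = g i x v w)"

definition fundamental_form ::
  "('i, 'e) metric_field \<Rightarrow> ('i, 'e) endo_field \<Rightarrow> ('i, 'e, real) form" where
  "fundamental_form g A = (\<lambda>i x vs. g i x (A i x (vs ! 0)) (vs ! 1))"

text \<open>An affine connection, given in chart \<open>i\<close> by \<open>\<nabla>\<^sub>v Y = DY(v) + \<Gamma> i x v Y\<close>.\<close>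

definition affine_connection ::
  "('a, 'i, 'e::euclidean_space) mfd \<Rightarrow> ('i, 'e) christoffel \<Rightarrow> bool" where
  "affine_connection M \<Gamma> \<longleftrightarrow>
     (\<forall>i\<in>charts M. (\<forall>x\<in>cimage M i. bilinear (\<Gamma> i x)) \<and>
        (\<forall>v w. smooth_on (cimage M i) (\<lambda>x. \<Gamma> i x v w))) \<and>
     (\<forall>i\<in>charts M. \<forall>j\<in>charts M. \<forall>x\<in>overlap M i j. \<forall>v w.
        frechet_derivative (transition M i j) (at x) (\<Gamma> i x v w) =
        frechet_derivative (\<lambda>y. frechet_derivative (transition M i j) (at y) w) (at x) v +
        \<Gamma> j (transition M i j x)
          (frechet_derivative (transition M i j) (at x) v)
          (frechet_derivative (transition M i j) (at x) w))"

text \<open>Torsion-free, and \<open>\<nabla>g = 0\<close>.\<close>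

definition levi_civita ::
  "('a, 'i, 'e::euclidean_space) mfd \<Rightarrow> ('i, 'e) metric_field \<Rightarrow> ('i, 'e) christoffel \<Rightarrow> bool" where
  "levi_civita M g \<Gamma> \<longleftrightarrow> affine_connection M \<Gamma> \<and>
     (\<forall>i\<in>charts M. \<forall>x\<in>cimage M i.
        (\<forall>v w. \<Gamma> i x v w = \<Gamma> i x w v) \<and>
        (\<forall>u v w. frechet_derivative (\<lambda>y. g i y v w) (at x) u =
           g i x (\<Gamma> i x u v) w + g i x v (\<Gamma> i x u w)))"

text \<open>\<open>(\<nabla>\<^sub>v A)(w) = \<nabla>\<^sub>v (A w) - A (\<nabla>\<^sub>v w) = 0\<close>.\<close>

definition parallel ::
  "('a, 'i, 'e::euclidean_space) mfd \<Rightarrow> ('i, 'e) christoffel \<Rightarrow> ('i, 'e) endo_field \<Rightarrow> bool" where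
  "parallel M \<Gamma> A \<longleftrightarrow> (\<forall>i\<in>charts M. \<forall>x\<in>cimage M i. \<forall>v w.
     frechet_derivative (\<lambda>y. A i y w) (at x) v + \<Gamma> i x v (A i x w) - A i x (\<Gamma> i x v w) = 0)"

definition hyperkaehler ::
  "('a, 'i, 'e::euclidean_space) mfd \<Rightarrow> ('i, 'e) metric_field \<Rightarrow>
   ('i, 'e) endo_field \<Rightarrow> ('i, 'e) endo_field \<Rightarrow> ('i, 'e) endo_field \<Rightarrow> bool" where
  "hyperkaehler N h I J K \<longleftrightarrow>
     smooth_manifold N \<and> riemannian_metric N h \<and>
     complex_structure N I \<and> complex_structure N J \<and> complex_structure N K \<and>
     (\<forall>i\<in>charts N. \<forall>x\<in>cimage N i. \<forall>v.
        I i x (J i x v) = K i x v \<and> J i x (I i x v) = - K i x v) \<and>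
     hermitian N h I \<and> hermitian N h J \<and> hermitian N h K \<and>
     (\<exists>\<Gamma>. levi_civita N h \<Gamma> \<and> parallel N \<Gamma> I \<and> parallel N \<Gamma> J \<and> parallel N \<Gamma> K)"


section \<open>$SU(2)$ structures on 6-manifolds\<close>

text \<open>The vector dual to a real 1-form with respect to \<open>g\<close>.\<close>

definition sharp ::
  "('i, 'e) metric_field \<Rightarrow> ('i, 'e, real) form \<Rightarrow> 'i \<Rightarrow> 'e \<Rightarrow> 'e" where
  "sharp g a i x = (THE u. \<forall>v. g i x u v = a i x [v])"

text \<open>Contraction with the complex vector field dual to the complex 1-form \<open>a\<close>, where duality is
  with respect to the complex bilinear extension of \<open>g\<close>.\<close>

definition contract ::
  "('i, 'e) metric_field \<Rightarrow> ('i, 'e, complex) form \<Rightarrow> ('i, 'e, complex) form \<Rightarrow>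
   ('i, 'e, complex) form" where
  "contract g a \<eta> = (\<lambda>i x vs.
     \<eta> i x (sharp g (re_form a) i x # vs) + \<i> * \<eta> i x (sharp g (im_form a) i x # vs))"

definition type_p0 ::
  "('a, 'i, 'e) mfd \<Rightarrow> ('i, 'e) endo_field \<Rightarrow> nat \<Rightarrow> ('i, 'e, complex) form \<Rightarrow> bool" where
  "type_p0 M A p \<eta> \<longleftrightarrow>
     (\<forall>i\<in>charts M. \<forall>x\<in>cimage M i. \<forall>vs. length vs = p \<longrightarrow>
        (\<forall>j<p. \<eta> i x (vs[j := A i x (vs ! j)]) = \<i> * \<eta> i x vs))"

definition su2_structure ::
  "('a, 'i, 'e::euclidean_space) mfd \<Rightarrow> ('i, 'e) endo_field \<Rightarrow> ('i, 'e) metric_field \<Rightarrow>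
   ('i, 'e, complex) form \<Rightarrow> ('i, 'e, real) form \<Rightarrow> ('i, 'e, complex) form \<Rightarrow> bool" where
  "su2_structure M J g \<alpha> \<omega> \<Omega> \<longleftrightarrow>
     smooth_manifold M \<and> DIM('e) = 6 \<and>
     almost_complex_structure M J \<and> riemannian_metric M g \<and> hermitian M g J \<and>
     diff_form M 1 \<alpha> \<and> type_p0 M J 1 \<alpha> \<and>
     form_eq M 0 (contract g (cnj_form \<alpha>) \<alpha>) (\<lambda>i x vs. 2) \<and>
     diff_form M 2 \<omega> \<and> diff_form M 2 \<Omega> \<and> type_p0 M J 2 \<Omega> \<and>
     form_eq M 4 (of_real_form (wedge 2 \<omega> \<omega>)) (scale_form (1 / 2) (wedge 2 \<Omega> (cnj_form \<Omega>))) \<and>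
     (\<forall>i\<in>charts M. \<forall>x\<in>cimage M i. \<exists>vs. length vs = 4 \<and> wedge 2 \<omega> \<omega> i x vs \<noteq> 0) \<and>
     form_eq M 4 (wedge 2 (of_real_form \<omega>) \<Omega>) zero_form \<and>
     form_eq M 4 (wedge 2 \<Omega> \<Omega>) zero_form \<and>
     form_eq M 1 (contract g \<alpha> \<Omega>) zero_form \<and>
     form_eq M 1 (contract g \<alpha> (of_real_form \<omega>)) zero_form \<and>
     form_eq M 2 (of_real_form (fundamental_form g J))
       (\<lambda>i x vs. of_real_form \<omega> i x vs + \<i> / 2 * wedge 1 \<alpha> (cnj_form \<alpha>) i x vs)"


section \<open>The SUSY equations\<close>

text \<open>The projection forms \<open>Re(\<Omega>)\<^sub>|\<^sub>|\<close> and \<open>Re(\<Omega>)\<^sub>\<bottom>\<close>.\<close>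

definition re_par :: "real \<Rightarrow> ('i, 'e, real) form \<Rightarrow> ('i, 'e, complex) form \<Rightarrow> ('i, 'e, real) form" where
  "re_par \<phi> \<omega> \<Omega> = (\<lambda>i x vs.
     1 / 2 * ((1 - cos (2 * \<phi>)) * re_form \<Omega> i x vs + sin (2 * \<phi>) * \<omega> i x vs))"

definition re_perp :: "real \<Rightarrow> ('i, 'e, real) form \<Rightarrow> ('i, 'e, complex) form \<Rightarrow> ('i, 'e, real) form" where
  "re_perp \<phi> \<omega> \<Omega> = (\<lambda>i x vs.
     1 / 2 * ((1 + cos (2 * \<phi>)) * re_form \<Omega> i x vs - sin (2 * \<phi>) * \<omega> i x vs))"

text \<open>The forms \<open>(\<alpha>, R_par, R_perp, Im_Omega)\<close> arise from some $SU(2)$ structure with angle \<open>\<phi>\<close>.\<close>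

definition arises_from_su2 ::
  "('a, 'i, 'e::euclidean_space) mfd \<Rightarrow> real \<Rightarrow> ('i, 'e, complex) form \<Rightarrow>
   ('i, 'e, real) form \<Rightarrow> ('i, 'e, real) form \<Rightarrow> ('i, 'e, real) form \<Rightarrow> bool" where
  "arises_from_su2 M \<phi> \<alpha> R_par R_perp Im_Omega \<longleftrightarrow>
     (\<exists>J g \<omega> \<Omega>. su2_structure M J g \<alpha> \<omega> \<Omega> \<and>
        form_eq M 2 R_par (re_par \<phi> \<omega> \<Omega>) \<and>
        form_eq M 2 R_perp (re_perp \<phi> \<omega> \<Omega>) \<and>
        form_eq M 2 Im_Omega (im_form \<Omega>))"

definition susy_IIA ::
  "('a, 'i, 'e::euclidean_space) mfd \<Rightarrow> real \<Rightarrow> real \<Rightarrow> ('i, 'e, complex) form \<Rightarrow>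
   ('i, 'e, real) form \<Rightarrow> ('i, 'e, real) form \<Rightarrow> ('i, 'e, real) form \<Rightarrow> bool" where
  "susy_IIA M k_par k_perp \<alpha> R_par R_perp Im_Omega \<longleftrightarrow>
     (\<exists>\<phi>. - pi / 2 < \<phi> \<and> \<phi> < 0 \<and> k_par = - sin \<phi> \<and> k_perp = cos \<phi> \<and>
        arises_from_su2 M \<phi> \<alpha> R_par R_perp Im_Omega) \<and>
     (\<exists>H. diff_form M 3 H \<and>
        form_eq M 2 (ext_deriv (re_form \<alpha>)) zero_form \<and>
        form_eq M 3 (scale_form k_par H) (scale_form k_perp (ext_deriv Im_Omega)) \<and>
        form_eq M 3 (ext_deriv R_perp)
          (scale_form (k_par * k_perp) (wedge 1 (re_form \<alpha>) (ext_deriv (im_form \<alpha>)))) \<and>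
        form_eq M 4 (wedge 3 H (re_form \<alpha>))
          (scale_form (- (k_perp / k_par)) (ext_deriv (wedge 1 (im_form \<alpha>) R_par))))"

definition susy_IIB ::
  "('a, 'i, 'e::euclidean_space) mfd \<Rightarrow> real \<Rightarrow> real \<Rightarrow> ('i, 'e, complex) form \<Rightarrow>
   ('i, 'e, real) form \<Rightarrow> ('i, 'e, real) form \<Rightarrow> ('i, 'e, real) form \<Rightarrow> bool" where
  "susy_IIB M k_par k_perp \<alpha> R_par R_perp Im_Omega \<longleftrightarrow>
     (\<exists>\<phi>. 0 < \<phi> \<and> \<phi> < pi / 2 \<and> k_par = cos \<phi> \<and> k_perp = sin \<phi> \<and>
        arises_from_su2 M \<phi> \<alpha> R_par R_perp Im_Omega) \<and>
     (\<exists>H. diff_form M 3 H \<and>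
        form_eq M 2 (ext_deriv (re_form \<alpha>)) zero_form \<and>
        form_eq M 2 (ext_deriv (im_form \<alpha>)) zero_form \<and>
        form_eq M 3 (scale_form k_par H) (scale_form k_perp (ext_deriv Im_Omega)) \<and>
        form_eq M 4 (wedge 1 (re_form \<alpha>) H)
          (scale_form (- (k_perp / k_par)) (wedge 1 (im_form \<alpha>) (ext_deriv R_perp))) \<and>
        form_eq M 4 (wedge 1 (im_form \<alpha>) H)
          (scale_form (k_perp / k_par) (wedge 1 (re_form \<alpha>) (ext_deriv R_perp))) \<and>
        form_eq M 5 (wedge 2 (wedge 1 (re_form \<alpha>) (im_form \<alpha>)) (ext_deriv R_par))
          (scale_form (- 1) (wedge 3 H Im_Omega)))"

end

theory Submission
  imports Defs
begin

text \<open>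
  The geometric idea is this: on a hyperkaehler \<open>4\<close>-manifold the unit sphere of complex
  structures consists of parallel ones, and a rotation of the triple \<open>(I, J, K)\<close> gives another
  triple with the same quaternion relations. If \<open>(A, B, C)\<close> is such a triple, then in dimension
  four \<open>\<omega>\<^sub>A\<close>, \<open>\<omega>\<^sub>B\<close>, \<open>\<omega>\<^sub>C\<close> are self-dual, of equal length and mutually orthogonal, which says
  that \<open>\<omega> = \<omega>\<^sub>A\<close> and \<open>\<Omega> = \<omega>\<^sub>B + i \<omega>\<^sub>C\<close> satisfy the algebraic relations of an $SU(2)$ structure
  (\<open>quaternionic_wedge22\<close>). A coframe \<open>a, b\<close> of the torus gives \<open>\<alpha> = a + i b\<close>. The metric of the
  product is \<open>h + a\<^sup>2 + b\<^sup>2\<close>, and its almost complex structure is \<open>A\<close> on the first factor and the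
  rotation with \<open>a \<circ> R = - b\<close>, \<open>b \<circ> R = a\<close> on the second (\<open>su2_structure_product\<close>).

  Up to the factors \<open>sin \<phi>\<close> and \<open>cos \<phi>\<close>, the projections \<open>Re \<Omega>\<^sub>|\<^sub>|\<close> and \<open>Re \<Omega>\<^sub>\<bottom>\<close> arise from \<open>\<omega>\<close>
  and \<open>Re \<Omega>\<close> by the rotation with angle \<open>\<phi>\<close> in their plane. If the triple is first rotated by the
  angle \<open>-\<phi>\<close> in the plane of \<open>A\<close> and \<open>B\<close>, the projections return \<open>sin \<phi> \<omega>\<^sub>A\<close> and \<open>cos \<phi> \<omega>\<^sub>B\<close>
  (\<open>arises_from_su2_product\<close>). Type IIA is the triple \<open>(J, K, I)\<close> with \<open>\<phi> = - arcsin k\<^sub>|\<^sub>|\<close>, and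
  type IIB is \<open>(K, I, J)\<close> with \<open>\<phi> = arcsin k\<^sub>\<bottom>\<close>.

  The differential equations hold because every form that is differentiated in them is closed:
  the Kaehler forms since \<open>I, J, K\<close> are parallel for the torsion-free connection
  (\<open>closed_fundamental_form\<close>), the coframe by assumption, and \<open>Im \<alpha> \<and> Re \<Omega>\<^sub>|\<^sub>|\<close> by the Leibniz
  rule. So \<open>H = 0\<close>, and both sides of each equation vanish (\<open>susy_product\<close>).

  The remaining work transports these facts through charts. The projections of a product of
  manifolds are linear in the product charts, so a pullback along them agrees with the
  substitution of a linear map into the coefficients (\<open>pullback_eq_chart_pullback\<close>), and this
  substitution preserves smoothness, the transformation law and closedness. The circle is covered
  by angle charts whose transition maps are local translations. Hence the angles provide a closed
  coframe of the torus, and the two existence claims are instances of the explicit solutions.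
\<close>

section \<open>Calculus of iterated differentiability\<close>

lemma frechet_derivative_unique:
  "(f has_derivative f') (at x) \<Longrightarrow> frechet_derivative f (at x) = f'"
  using frechet_derivative_at by metis

lemma frechet_derivative_cong_open:
  assumes "open S" "x \<in> S" "\<And>y. y \<in> S \<Longrightarrow> f y = g y"
  shows "frechet_derivative f (at x) = frechet_derivative g (at x)"
proof -
  have "(f has_derivative D) (at x) \<longleftrightarrow> (g has_derivative D) (at x)" for D
    using has_derivative_transform_within_open[OF _ assms(1,2)] assms(3) by metis
  then show ?thesis
    by (simp add: frechet_derivative_def)
qed

lemma differentiable_cong_open:
  assumes "open S" "x \<in> S" "\<And>y. y \<in> S \<Longrightarrow> f y = g y" "f differentiable at x"
  shows "g differentiable at x"
  using assms has_derivative_transform_within_open unfolding differentiable_def by metis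

lemma Ck_on_cong:
  assumes "open S" "\<And>x. x \<in> S \<Longrightarrow> f x = g x" "Ck_on n S f"
  shows "Ck_on n S g"
  using assms(2,3)
proof (induction n arbitrary: f g)
  case 0
  then show ?case by (simp cong: continuous_on_cong)
next
  case (Suc n)
  have "frechet_derivative f (at x) v = frechet_derivative g (at x) v" if "x \<in> S" for x v
    using frechet_derivative_cong_open[OF assms(1) that Suc.prems(1)] by simp
  moreover have "g differentiable at x" if "x \<in> S" for x
    using differentiable_cong_open[OF assms(1) that Suc.prems(1)] Suc.prems(2) that by auto
  ultimately show ?case
    using Suc.IH Suc.prems(2) by (metis (no_types, lifting) Ck_on.simps(2))
qed

lemma Ck_on_lower: "Ck_on (Suc n) S f \<Longrightarrow> Ck_on n S f"
proof (induction n arbitrary: f)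
  case 0
  then show ?case
    by (auto intro!: continuous_at_imp_continuous_on differentiable_imp_continuous_within)
next
  case (Suc n)
  then show ?case by (metis Ck_on.simps(2))
qed

lemma Ck_on_const: "Ck_on n S (\<lambda>x. c)"
  by (induction n arbitrary: c) auto

text \<open>The derivative in \<^const>\<open>Ck_on\<close> comes from a choice operator. On an open set any family of derivatives
  may take its place, which is how the closure properties below go through their inductions.\<close>

lemma Ck_on_SucI:
  assumes "open S" "\<And>x. x \<in> S \<Longrightarrow> (f has_derivative D x) (at x)"
    and "\<And>v. Ck_on n S (\<lambda>x. D x v)"
  shows "Ck_on (Suc n) S f"
proof -
  have "Ck_on n S (\<lambda>x. frechet_derivative f (at x) v)" for v
    by (rule Ck_on_cong[OF assms(1) _ assms(3)]) (simp add: frechet_derivative_unique[OF assms(2)])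
  then show ?thesis
    using assms(2) by (auto simp: differentiable_def)
qed

lemma Ck_on_SucD:
  assumes "Ck_on (Suc n) S f"
  shows "x \<in> S \<Longrightarrow> (f has_derivative frechet_derivative f (at x)) (at x)"
    and "Ck_on n S (\<lambda>x. frechet_derivative f (at x) v)"
  using assms frechet_derivative_works by auto

lemma Ck_on_linear_image:
  assumes "open S" "bounded_linear L" "Ck_on n S f"
  shows "Ck_on n S (\<lambda>x. L (f x))"
  using assms(3)
proof (induction n arbitrary: f)
  case 0
  then show ?case
    using assms(2) by (simp add: bounded_linear.continuous_on)
next
  case (Suc n)
  show ?case
    by (rule Ck_on_SucI[OF assms(1)
          bounded_linear.has_derivative[OF assms(2) Ck_on_SucD(1)[OF Suc.prems]]])
      (use Suc.IH[OF Ck_on_SucD(2)[OF Suc.prems]] in simp_all)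
qed

lemma Ck_on_linear_substitution:
  assumes "open S" "open T" "bounded_linear L" "\<And>x. x \<in> T \<Longrightarrow> L x \<in> S" "Ck_on n S f"
  shows "Ck_on n T (\<lambda>x. f (L x))"
  using assms(5)
proof (induction n arbitrary: f)
  case 0
  then show ?case
    using continuous_on_compose2[OF _ linear_continuous_on[OF assms(3)], of S f T] assms(4)
    by (simp add: image_subset_iff)
next
  case (Suc n)
  have "((\<lambda>x. f (L x)) has_derivative (\<lambda>v. frechet_derivative f (at (L x)) (L v))) (at x)"
    if "x \<in> T" for x
    using has_derivative_compose[OF bounded_linear_imp_has_derivative[OF assms(3)]
        Ck_on_SucD(1)[OF Suc.prems assms(4)[OF that]]] .
  then show ?case
    by (rule Ck_on_SucI[OF assms(2)]) (use Suc.IH[OF Ck_on_SucD(2)[OF Suc.prems]] in simp_all)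
qed

lemma Ck_on_add:
  assumes "open S" "Ck_on n S f" "Ck_on n S g"
  shows "Ck_on n S (\<lambda>x. f x + g x)"
  using assms(2,3)
proof (induction n arbitrary: f g)
  case 0
  then show ?case by (simp add: continuous_on_add)
next
  case (Suc n)
  show ?case
    by (rule Ck_on_SucI[OF assms(1)
          has_derivative_add[OF Ck_on_SucD(1)[OF Suc.prems(1)] Ck_on_SucD(1)[OF Suc.prems(2)]]])
      (use Suc.IH[OF Ck_on_SucD(2)[OF Suc.prems(1)] Ck_on_SucD(2)[OF Suc.prems(2)]] in simp_all)
qed

lemma Ck_on_bilinear:
  assumes "open S" "bounded_bilinear b" "Ck_on n S f" "Ck_on n S g"
  shows "Ck_on n S (\<lambda>x. b (f x) (g x))"
  using assms(3,4)
proof (induction n arbitrary: f g)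
  case 0
  then show ?case using assms(2) by (simp add: bounded_bilinear.continuous_on)
next
  case (Suc n)
  show ?case
  proof (rule Ck_on_SucI[OF assms(1)
        bounded_bilinear.FDERIV[OF assms(2)
          Ck_on_SucD(1)[OF Suc.prems(1)] Ck_on_SucD(1)[OF Suc.prems(2)]]])
    show "Ck_on n S (\<lambda>x. b (f x) (frechet_derivative g (at x) v)
        + b (frechet_derivative f (at x) v) (g x))" for v
      by (intro Ck_on_add assms(1) Suc.IH Ck_on_lower[OF Suc.prems(1)] Ck_on_lower[OF Suc.prems(2)]
          Ck_on_SucD(2)[OF Suc.prems(1)] Ck_on_SucD(2)[OF Suc.prems(2)])
  qed
qed

lemma Ck_on_inverse:
  fixes f :: "'e::real_normed_vector \<Rightarrow> real"
  assumes "open S" "Ck_on n S f" "\<And>x. x \<in> S \<Longrightarrow> f x \<noteq> 0"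
  shows "Ck_on n S (\<lambda>x. inverse (f x))"
  using assms(2)
proof (induction n)
  case 0
  then show ?case using assms(3) by (auto intro: continuous_on_inverse)
next
  case (Suc n)
  note mult = Ck_on_bilinear[OF assms(1) bounded_bilinear_mult]
  show ?case
  proof (rule Ck_on_SucI[OF assms(1)])
    show "((\<lambda>x. inverse (f x)) has_derivative
        (\<lambda>v. - (inverse (f x) * frechet_derivative f (at x) v * inverse (f x)))) (at x)"
      if "x \<in> S" for x
      using Deriv.has_derivative_inverse[OF assms(3)[OF that] Ck_on_SucD(1)[OF Suc.prems that]] .
    show "Ck_on n S (\<lambda>x. - (inverse (f x) * frechet_derivative f (at x) v * inverse (f x)))" for v
      by (intro Ck_on_linear_image[OF assms(1) bounded_linear_minus[OF bounded_linear_ident]]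
          mult Suc.IH Ck_on_SucD(2)[OF Suc.prems] Ck_on_lower[OF Suc.prems])
  qed
qed

lemma smooth_on_cong:
  "open S \<Longrightarrow> (\<And>x. x \<in> S \<Longrightarrow> f x = g x) \<Longrightarrow> smooth_on S f \<Longrightarrow> smooth_on S g"
  using Ck_on_cong unfolding smooth_on_def by metis

lemma smooth_on_const [simp]: "smooth_on S (\<lambda>x. c)"
  by (simp add: smooth_on_def Ck_on_const)

lemma smooth_on_linear_image:
  "open S \<Longrightarrow> bounded_linear L \<Longrightarrow> smooth_on S f \<Longrightarrow> smooth_on S (\<lambda>x. L (f x))"
  by (simp add: smooth_on_def Ck_on_linear_image)

lemma smooth_on_linear_substitution:
  "\<lbrakk>open S; open T; bounded_linear L; \<And>x. x \<in> T \<Longrightarrow> L x \<in> S; smooth_on S f\<rbrakk>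
    \<Longrightarrow> smooth_on T (\<lambda>x. f (L x))"
  by (simp add: smooth_on_def Ck_on_linear_substitution)

lemma smooth_on_add: "\<lbrakk>open S; smooth_on S f; smooth_on S g\<rbrakk> \<Longrightarrow> smooth_on S (\<lambda>x. f x + g x)"
  by (simp add: smooth_on_def Ck_on_add)

lemma smooth_on_scaleR:
  "\<lbrakk>open S; smooth_on S f; smooth_on S g\<rbrakk> \<Longrightarrow> smooth_on S (\<lambda>x. f x *\<^sub>R g x)"
  by (simp add: smooth_on_def Ck_on_bilinear[OF _ bounded_bilinear_scaleR])

lemma smooth_on_mult:
  fixes f g :: "'e::real_normed_vector \<Rightarrow> real"
  shows "\<lbrakk>open S; smooth_on S f; smooth_on S g\<rbrakk> \<Longrightarrow> smooth_on S (\<lambda>x. f x * g x)"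
  by (simp add: smooth_on_def Ck_on_bilinear[OF _ bounded_bilinear_mult])

lemma smooth_on_scaleR_const:
  "open S \<Longrightarrow> smooth_on S f \<Longrightarrow> smooth_on S (\<lambda>x. c *\<^sub>R f x)"
  by (intro smooth_on_scaleR smooth_on_const)

lemma smooth_on_sum:
  "\<lbrakk>open S; \<And>a. a \<in> A \<Longrightarrow> smooth_on S (f a)\<rbrakk> \<Longrightarrow> smooth_on S (\<lambda>x. \<Sum>a\<in>A. f a x)"
  by (induction A rule: infinite_finite_induct) (simp_all add: smooth_on_add)

lemma smooth_on_inverse:
  fixes f :: "'e::real_normed_vector \<Rightarrow> real"
  shows "\<lbrakk>open S; smooth_on S f; \<And>x. x \<in> S \<Longrightarrow> f x \<noteq> 0\<rbrakk> \<Longrightarrow> smooth_on S (\<lambda>x. inverse (f x))"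
  by (simp add: smooth_on_def Ck_on_inverse)

lemma smooth_on_Pair:
  assumes "open S" "smooth_on S f" "smooth_on S g"
  shows "smooth_on S (\<lambda>x. (f x, g x))"
proof -
  have "bounded_linear (\<lambda>a::'b. (a, 0::'c))" "bounded_linear (\<lambda>b::'c. (0::'b, b))"
    by (auto intro!: bounded_linear_Pair bounded_linear_ident bounded_linear_zero)
  from smooth_on_add[OF assms(1) smooth_on_linear_image[OF assms(1) this(1) assms(2)]
      smooth_on_linear_image[OF assms(1) this(2) assms(3)]]
  show ?thesis by simp
qed

lemma smooth_on_has_derivative:
  assumes "smooth_on S f" "x \<in> S"
  shows "(f has_derivative frechet_derivative f (at x)) (at x)"
  using assms Ck_on_SucD(1)[of 0] unfolding smooth_on_def by blast


section \<open>Products of smooth manifolds\<close>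

lemma second_countable_prod_topology:
  assumes "second_countable X" "second_countable Y"
  shows "second_countable (prod_topology X Y)"
proof -
  obtain B where B: "countable B" "\<And>V. V \<in> B \<Longrightarrow> openin X V"
    "\<And>U x. openin X U \<Longrightarrow> x \<in> U \<Longrightarrow> \<exists>V\<in>B. x \<in> V \<and> V \<subseteq> U"
    using assms(1) unfolding second_countable_def by metis
  obtain C where C: "countable C" "\<And>V. V \<in> C \<Longrightarrow> openin Y V"
    "\<And>U x. openin Y U \<Longrightarrow> x \<in> U \<Longrightarrow> \<exists>V\<in>C. x \<in> V \<and> V \<subseteq> U"
    using assms(2) unfolding second_countable_def by metis
  show ?thesis
    unfolding second_countable_def
  proof (intro exI conjI ballI allI impI)
    show "countable ((\<lambda>(V, W). V \<times> W) ` (B \<times> C))"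
      using B(1) C(1) by auto
    show "openin (prod_topology X Y) V" if "V \<in> (\<lambda>(V, W). V \<times> W) ` (B \<times> C)" for V
      using that B(2) C(2) by (auto simp: openin_prod_Times_iff)
    fix U z assume "openin (prod_topology X Y) U \<and> z \<in> U"
    then obtain V W where VW: "openin X V" "openin Y W" "fst z \<in> V" "snd z \<in> W" "V \<times> W \<subseteq> U"
      unfolding openin_prod_topology_alt by (metis prod.collapse)
    obtain V' W' where "V' \<in> B" "fst z \<in> V'" "V' \<subseteq> V" "W' \<in> C" "snd z \<in> W'" "W' \<subseteq> W"
      using B(3)[OF VW(1,3)] C(3)[OF VW(2,4)] by blast
    with VW(5) show "\<exists>V\<in>(\<lambda>(V, W). V \<times> W) ` (B \<times> C). z \<in> V \<and> V \<subseteq> U"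
      by (intro bexI[of _ "V' \<times> W'"]) (auto simp: mem_Times_iff)
  qed
qed

lemma homeomorphic_map_map_prod:
  assumes "homeomorphic_map X X' f" "homeomorphic_map Y Y' g"
  shows "homeomorphic_map (prod_topology X Y) (prod_topology X' Y') (map_prod f g)"
proof -
  obtain f' g' where "homeomorphic_maps X X' f f'" "homeomorphic_maps Y Y' g g'"
    using assms by (auto simp: homeomorphic_map_maps)
  then have "homeomorphic_maps (prod_topology X Y) (prod_topology X' Y')
      (\<lambda>(x, y). (f x, g y)) (\<lambda>(x, y). (f' x, g' y))"
    by (simp add: homeomorphic_maps_prod)
  then show ?thesis
    by (auto simp: homeomorphic_map_maps map_prod_def)
qed

lemma smooth_manifoldD:
  assumes "smooth_manifold M"
  shows "Hausdorff_space (mtop M)" "second_countable (mtop M)"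
    and "(\<Union>i\<in>charts M. cdom M i) = topspace (mtop M)"
    and "i \<in> charts M \<Longrightarrow> openin (mtop M) (cdom M i)"
    and "i \<in> charts M \<Longrightarrow> open (cimage M i)"
    and "i \<in> charts M \<Longrightarrow> homeomorphic_map (subtopology (mtop M) (cdom M i))
      (top_of_set (cimage M i)) (cmap M i)"
    and "i \<in> charts M \<Longrightarrow> j \<in> charts M \<Longrightarrow> smooth_on (overlap M i j) (transition M i j)"
  using assms by (simp_all add: smooth_manifold_def)

lemma inj_on_cmap:
  assumes "smooth_manifold M" "i \<in> charts M"
  shows "inj_on (cmap M i) (cdom M i)"
proof -
  have "topspace (subtopology (mtop M) (cdom M i)) = cdom M i"
    using openin_subset[OF smooth_manifoldD(4)[OF assms]] by auto
  then show ?thesis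
    using homeomorphic_imp_injective_map[OF smooth_manifoldD(6)[OF assms]] by simp
qed

lemma cinv_cmap:
  assumes "smooth_manifold M" "i \<in> charts M" "p \<in> cdom M i"
  shows "cinv M i (cmap M i p) = p"
  using inj_on_cmap[OF assms(1,2)] assms(3) by (simp add: cinv_def)

lemma cinv_in_cdom: "x \<in> cimage M i \<Longrightarrow> cinv M i x \<in> cdom M i"
  by (simp add: cinv_def cimage_def inv_into_into)

lemma cmap_cinv: "x \<in> cimage M i \<Longrightarrow> cmap M i (cinv M i x) = x"
  by (simp add: cinv_def cimage_def f_inv_into_f)

lemma overlap_subset_cimage: "overlap M i j \<subseteq> cimage M i"
  by (auto simp: overlap_def cimage_def)

lemma mem_overlap_iff:
  assumes "smooth_manifold M" "i \<in> charts M"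
  shows "x \<in> overlap M i j \<longleftrightarrow> x \<in> cimage M i \<and> cinv M i x \<in> cdom M j"
  using cinv_cmap[OF assms] cinv_in_cdom cmap_cinv
  by (fastforce simp: overlap_def cimage_def)

lemma transition_in_cimage:
  assumes "smooth_manifold M" "i \<in> charts M" "x \<in> overlap M i j"
  shows "transition M i j x \<in> cimage M j"
  using assms mem_overlap_iff[OF assms(1,2)] by (auto simp: transition_def cimage_def)

lemma open_overlap:
  assumes "smooth_manifold M" "i \<in> charts M" "j \<in> charts M"
  shows "open (overlap M i j)"
proof -
  have "openin (subtopology (mtop M) (cdom M i)) (cdom M i \<inter> cdom M j)"
    using smooth_manifoldD(4)[OF assms(1,3)] by (simp add: openin_subtopology_Int2)
  then have "openin (top_of_set (cimage M i)) (overlap M i j)"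
    unfolding overlap_def
    using homeomorphic_map_openness smooth_manifoldD(6)[OF assms(1,2)] openin_subset
    by metis
  then show ?thesis
    using smooth_manifoldD(5)[OF assms(1,2)] openin_open_trans by blast
qed

lemma transition_has_derivative:
  assumes "smooth_manifold M" "i \<in> charts M" "j \<in> charts M" "x \<in> overlap M i j"
  shows "(transition M i j has_derivative frechet_derivative (transition M i j) (at x)) (at x)"
  using smooth_on_has_derivative[OF smooth_manifoldD(7)[OF assms(1-3)] assms(4)] .

lemma prod_mfd_sel [simp]:
  "mtop (prod_mfd M N) = prod_topology (mtop M) (mtop N)"
  "charts (prod_mfd M N) = charts M \<times> charts N"
  "cdom (prod_mfd M N) (i, j) = cdom M i \<times> cdom N j"
  "cmap (prod_mfd M N) (i, j) = map_prod (cmap M i) (cmap N j)"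
  by (simp_all add: prod_mfd_def)

lemma cimage_prod_mfd: "cimage (prod_mfd M N) (i, j) = cimage M i \<times> cimage N j"
  by (simp add: cimage_def map_prod_surj_on)

lemma overlap_prod_mfd:
  "overlap (prod_mfd M N) (i, j) (i', j') = overlap M i i' \<times> overlap N j j'"
  by (simp add: overlap_def Times_Int_Times map_prod_surj_on)

lemma cinv_prod_mfd:
  assumes "smooth_manifold M" "smooth_manifold N" "i \<in> charts M" "j \<in> charts N"
    and "x \<in> cimage (prod_mfd M N) (i, j)"
  shows "cinv (prod_mfd M N) (i, j) x = (cinv M i (fst x), cinv N j (snd x))"
proof -
  obtain p q where pq: "p \<in> cdom M i" "q \<in> cdom N j" "x = (cmap M i p, cmap N j q)"
    using assms(5) by (auto simp: cimage_def)
  have "inj_on (map_prod (cmap M i) (cmap N j)) (cdom M i \<times> cdom N j)"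
    using inj_on_cmap[OF assms(1,3)] inj_on_cmap[OF assms(2,4)] by (rule map_prod_inj_on)
  then have "cinv (prod_mfd M N) (i, j) (map_prod (cmap M i) (cmap N j) (p, q)) = (p, q)"
    unfolding cinv_def prod_mfd_sel by (rule inv_into_f_f) (simp add: pq)
  then show ?thesis
    using cinv_cmap[OF assms(1,3) pq(1)] cinv_cmap[OF assms(2,4) pq(2)] pq(3) by simp
qed

lemma transition_prod_mfd:
  assumes "smooth_manifold M" "smooth_manifold N" "i \<in> charts M" "j \<in> charts N"
    and "x \<in> cimage (prod_mfd M N) (i, j)"
  shows "transition (prod_mfd M N) (i, j) (i', j') x =
    (transition M i i' (fst x), transition N j j' (snd x))"
  using cinv_prod_mfd[OF assms] by (simp add: transition_def)

lemma smooth_on_transition_prod_mfd: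
  assumes "smooth_manifold M" "smooth_manifold N" "i \<in> charts M" "j \<in> charts N"
    "i' \<in> charts M" "j' \<in> charts N"
  shows "smooth_on (overlap (prod_mfd M N) (i, j) (i', j'))
    (transition (prod_mfd M N) (i, j) (i', j'))"
proof -
  let ?U = "overlap M i i'" and ?V = "overlap N j j'"
  have op: "open ?U" "open ?V" "open (?U \<times> ?V)"
    using assms by (auto intro!: open_Times open_overlap)
  have *: "smooth_on (?U \<times> ?V) (\<lambda>x. (transition M i i' (fst x), transition N j j' (snd x)))"
    by (intro smooth_on_Pair op(3)
        smooth_on_linear_substitution[OF op(1,3) bounded_linear_fst]
        smooth_on_linear_substitution[OF op(2,3) bounded_linear_snd]
        smooth_manifoldD(7) assms) auto
  have "(transition M i i' (fst x), transition N j j' (snd x)) =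
      transition (prod_mfd M N) (i, j) (i', j') x" if "x \<in> ?U \<times> ?V" for x
  proof -
    have "x \<in> cimage (prod_mfd M N) (i, j)"
      using that overlap_subset_cimage[of M i i'] overlap_subset_cimage[of N j j']
      unfolding cimage_prod_mfd by blast
    then show ?thesis
      using transition_prod_mfd[OF assms(1-4)] by simp
  qed
  from smooth_on_cong[OF op(3) this *] show ?thesis
    by (simp add: overlap_prod_mfd)
qed

lemma smooth_manifold_prod_mfd:
  assumes M: "smooth_manifold M" and N: "smooth_manifold N"
  shows "smooth_manifold (prod_mfd M N)"
proof -
  have "(\<Union>i\<in>charts M \<times> charts N. cdom (prod_mfd M N) i) =
      (\<Union>i\<in>charts M. cdom M i) \<times> (\<Union>j\<in>charts N. cdom N j)"
    by fastforce
  moreover have "homeomorphic_map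
      (subtopology (prod_topology (mtop M) (mtop N)) (cdom M i \<times> cdom N j))
      (top_of_set (cimage M i \<times> cimage N j)) (map_prod (cmap M i) (cmap N j))"
    if "i \<in> charts M" "j \<in> charts N" for i j
    using homeomorphic_map_map_prod[OF smooth_manifoldD(6)[OF M that(1)]
        smooth_manifoldD(6)[OF N that(2)]]
    by (simp add: subtopology_Times flip: euclidean_product_topology)
  ultimately show ?thesis
    using smooth_manifoldD(1-5)[OF M] smooth_manifoldD(1-5)[OF N]
      smooth_on_transition_prod_mfd[OF M N]
    by (auto simp: smooth_manifold_def Hausdorff_space_prod_topology cimage_prod_mfd
        second_countable_prod_topology openin_prod_Times_iff open_Times)
qed


section \<open>The circle and the torus\<close>

lemma circle_sel [simp]:
  "mtop circle = top_of_set (sphere 0 1)" "charts circle = UNIV"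
  by (simp_all add: circle_def)

lemma cdom_circle: "cdom circle a = cis ` {a<..<a + 2 * pi}"
  by (simp add: circle_def)

lemma cis_eq_iff: "cis s = cis t \<longleftrightarrow> (\<exists>n::int. s = t + 2 * pi * n)"
proof -
  have "cis s = cis t \<longleftrightarrow> exp (\<i> * of_real s) = exp (\<i> * of_real t)"
    by (simp add: cis_conv_exp)
  also have "\<dots> \<longleftrightarrow> (\<exists>n::int. \<i> * of_real s = \<i> * of_real t + (of_int (2 * n) * pi) * \<i>)"
    by (rule exp_eq)
  also have "\<dots> \<longleftrightarrow> (\<exists>n::int. s = t + 2 * pi * n)"
    by (simp add: complex_eq_iff algebra_simps)
  finally show ?thesis .
qed

lemma multiple_of_2pi_small:
  assumes "\<bar>2 * pi * real_of_int n\<bar> < 2 * pi"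
  shows "n = 0"
proof -
  have "2 * pi * \<bar>real_of_int n\<bar> < 2 * pi * 1"
    using assms by (simp add: abs_mult)
  then have "\<bar>real_of_int n\<bar> < 1"
    by (rule mult_left_less_imp_less) simp
  then show ?thesis by linarith
qed

lemma inj_on_cis: "inj_on cis {a<..<a + 2 * pi}"
proof (rule inj_onI)
  fix s t assume "s \<in> {a<..<a + 2 * pi}" "t \<in> {a<..<a + 2 * pi}" "cis s = cis t"
  moreover then obtain n :: int where n: "s = t + 2 * pi * n"
    using cis_eq_iff by auto
  ultimately have "n = 0"
    by (intro multiple_of_2pi_small) auto
  with n show "s = t" by simp
qed

text \<open>On the circle without the point \<open>cis a\<close>, the angle in \<open>(a, a + 2\<pi>)\<close> is the principal argument
  taken after rotating the middle of the interval to \<open>0\<close>; its continuity is that of \<^const>\<open>Arg\<close>.\<close>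

lemma circle_chart_eq_Arg:
  assumes "t \<in> {a<..<a + 2 * pi}"
  shows "a + pi + Arg (cis t * cis (- a - pi)) = t"
    and "cis t * cis (- a - pi) \<notin> \<real>\<^sub>\<le>\<^sub>0"
proof -
  have *: "cis t * cis (- a - pi) = cis (t - (a + pi))"
    by (simp add: cis_mult algebra_simps)
  have r: "t - (a + pi) \<in> {-pi<..<pi}"
    using assms by auto
  then have A: "Arg (cis (t - (a + pi))) = t - (a + pi)"
    by (intro Arg_cis) auto
  then show "a + pi + Arg (cis t * cis (- a - pi)) = t"
    unfolding * by simp
  show "cis t * cis (- a - pi) \<notin> \<real>\<^sub>\<le>\<^sub>0"
  proof
    assume "cis t * cis (- a - pi) \<in> \<real>\<^sub>\<le>\<^sub>0"
    then have "Arg (cis (t - (a + pi))) = pi"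
      unfolding * using Arg_eq_pi complex_nonpos_Reals_iff
      by (smt (verit) cis.simps complex_is_Real_iff cis_neq_zero complex_eq_iff zero_complex.sel)
    with A r show False by auto
  qed
qed

lemma cdom_circle_eq: "cdom circle a = sphere 0 1 - {cis a}"
  unfolding cdom_circle
proof (intro equalityI subsetI)
  fix z assume "z \<in> cis ` {a<..<a + 2 * pi}"
  then obtain t where t: "t \<in> {a<..<a + 2 * pi}" "z = cis t" by auto
  have "cis t \<noteq> cis a"
  proof
    assume "cis t = cis a"
    then obtain n :: int where "t = a + 2 * pi * n" using cis_eq_iff by auto
    with t have "0 < 2 * pi * real_of_int n" "2 * pi * real_of_int n < 2 * pi"
      by auto
    then show False
      using multiple_of_2pi_small[of n] by simp
  qed
  with t show "z \<in> sphere 0 1 - {cis a}" by simp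
next
  fix z assume z: "z \<in> sphere 0 1 - {cis a}"
  define s where "s = Arg (z * cis (- a - pi))"
  have "cis s = z * cis (- a - pi)"
    using z unfolding s_def by (subst cis_Arg) (auto simp: sgn_div_norm norm_mult)
  then have "cis s * cis (a + pi) = z * (cis (- a - pi) * cis (a + pi))"
    by (simp only: mult.assoc)
  then have "z = cis (s + (a + pi))"
    unfolding cis_mult by simp
  moreover have "- pi < s" "s \<le> pi"
    using Arg_bounded s_def by auto
  moreover have "s \<noteq> pi"
  proof
    assume "s = pi"
    then have "z = cis a" using calculation(1) cis_eq_iff[of "pi + (a + pi)" a]
      by (metis add.commute add.left_commute mult.right_neutral mult_2 of_int_1)
    with z show False by simp
  qed
  ultimately show "z \<in> cis ` {a<..<a + 2 * pi}"
    by (intro image_eqI[of _ _ "s + (a + pi)"]) auto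
qed

lemma cmap_circle_cis: "t \<in> {a<..<a + 2 * pi} \<Longrightarrow> cmap circle a (cis t) = t"
  using inj_on_cis by (simp add: circle_def the_inv_into_f_f)

lemma inj_on_cmap_circle: "inj_on (cmap circle a) (cdom circle a)"
  using inj_on_the_inv_into[OF inj_on_cis] by (simp add: circle_def)

lemma cimage_circle: "cimage circle a = {a<..<a + 2 * pi}"
  by (simp add: cimage_def cdom_circle image_image cmap_circle_cis)

lemma continuous_on_cmap_circle: "continuous_on (cdom circle a) (cmap circle a)"
proof -
  have "continuous_on (cdom circle a) (\<lambda>z. a + pi + Arg (z * cis (- a - pi)))"
    using circle_chart_eq_Arg(2) by (auto simp: cdom_circle intro!: continuous_intros)
  then show ?thesis
    by (rule continuous_on_eq)
      (auto simp: circle_chart_eq_Arg(1) cmap_circle_cis cdom_circle)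
qed

lemma homeomorphic_map_cmap_circle:
  "homeomorphic_map (subtopology (mtop circle) (cdom circle a)) (top_of_set (cimage circle a))
    (cmap circle a)"
proof -
  have sub: "subtopology (mtop circle) (cdom circle a) = top_of_set (cdom circle a)"
    using cdom_circle_eq by (simp add: subtopology_subtopology Int_absorb1)
  have "homeomorphic_maps (top_of_set (cdom circle a)) (top_of_set (cimage circle a))
      (cmap circle a) cis"
    unfolding homeomorphic_maps_def
    using continuous_on_cmap_circle[of a]
    by (auto simp: cimage_circle cdom_circle cmap_circle_cis continuous_map_in_subtopology
        intro!: continuous_on_cis continuous_intros)
  then show ?thesis
    unfolding sub homeomorphic_map_maps by blast
qed

lemma cinv_circle: "t \<in> {a<..<a + 2 * pi} \<Longrightarrow> cinv circle a t = cis t"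
  using cmap_circle_cis[of t a] inv_into_f_f[OF inj_on_cmap_circle, of "cis t" a]
  by (simp add: cinv_def cdom_circle)

lemma overlap_circle: "overlap circle a b = {t \<in> {a<..<a + 2 * pi}. cis t \<in> cdom circle b}"
proof -
  have "cdom circle a \<inter> cdom circle b = cis ` {t \<in> {a<..<a + 2 * pi}. cis t \<in> cdom circle b}"
    unfolding cdom_circle[of a] by auto
  then show ?thesis
    unfolding overlap_def by (simp add: image_image cmap_circle_cis)
qed

lemma open_overlap_circle: "open (overlap circle a b)"
proof -
  have "overlap circle a b = {a<..<a + 2 * pi} \<inter> (cis -` (- {cis b}))"
    by (auto simp: overlap_circle cdom_circle_eq)
  moreover have "open (cis -` (- {cis b}))"
    using continuous_on_cis[OF continuous_on_id, of UNIV] by (rule open_vimage[rotated]) auto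
  ultimately show ?thesis by (simp only: open_Int open_greaterThanLessThan)
qed

text \<open>Two angles of the same point differ by a multiple of \<open>2\<pi>\<close>, and by continuity of the charts that
  multiple is locally constant. So the transition maps are local translations.\<close>

lemma transition_circle_has_derivative:
  assumes "t \<in> overlap circle a b"
  shows "(transition circle a b has_derivative (\<lambda>v. v)) (at t)"
proof -
  let ?U = "overlap circle a b" and ?f = "transition circle a b"
  have f_eq: "?f s = cmap circle b (cis s)" if "s \<in> ?U" for s
    using that by (simp add: transition_def overlap_circle cinv_circle)
  have cis_f: "cis (?f s) = cis s" if "s \<in> ?U" for s
    using that f_eq[OF that] by (auto simp: overlap_circle cdom_circle cmap_circle_cis)
  have "continuous_on ?U (\<lambda>s. cmap circle b (cis s))"
    by (rule continuous_on_compose2[OF continuous_on_cmap_circle])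
      (auto simp: overlap_circle intro!: continuous_intros)
  then have "continuous_on ?U ?f"
    by (rule continuous_on_eq) (simp add: f_eq)
  then have "isCont (\<lambda>s. ?f s - s) t"
    using open_overlap_circle assms continuous_on_eq_continuous_at
    by (intro continuous_intros) blast
  then have "\<forall>\<^sub>F s in nhds t. dist (?f s - s) (?f t - t) < 2 * pi"
    using tendstoD[of "\<lambda>s. ?f s - s" "?f t - t" "at t" "2 * pi"]
    by (auto simp: isCont_def eventually_at_filter elim!: eventually_mono)
  moreover have "\<forall>\<^sub>F s in nhds t. s \<in> ?U"
    using open_overlap_circle assms eventually_nhds by blast
  ultimately have "\<forall>\<^sub>F s in nhds t. ?f s = s + (?f t - t)"
  proof eventually_elim
    case (elim s)
    obtain m n :: int where mn: "?f s = s + 2 * pi * m" "?f t = t + 2 * pi * n"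
      using cis_f[OF elim(2)] cis_f[OF assms] cis_eq_iff by metis
    with elim(1) have "\<bar>2 * pi * real_of_int (m - n)\<bar> < 2 * pi"
      by (simp add: dist_real_def algebra_simps)
    then have "m = n"
      using multiple_of_2pi_small by fastforce
    with mn show ?case by simp
  qed
  then obtain V where V: "open V" "t \<in> V" "\<And>s. s \<in> V \<Longrightarrow> s + (?f t - t) = ?f s"
    unfolding eventually_nhds by metis
  have "((\<lambda>s. s + (?f t - t)) has_derivative (\<lambda>v. v)) (at t)"
    by (auto intro!: derivative_eq_intros)
  then show ?thesis
    by (rule has_derivative_transform_within_open[OF _ V(1,2)]) (use V(3) in simp)
qed

lemma smooth_on_unit_derivative:
  assumes "open S" "\<And>x. x \<in> S \<Longrightarrow> (f has_derivative (\<lambda>v. v)) (at x)"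
  shows "smooth_on S f"
proof -
  have "Ck_on n S f" for n
  proof (cases n)
    case 0
    then show ?thesis
      using assms by (auto intro!: continuous_at_imp_continuous_on has_derivative_continuous)
  next
    case (Suc m)
    show ?thesis
      unfolding Suc by (rule Ck_on_SucI[OF assms]) (simp_all add: Ck_on_const)
  qed
  then show ?thesis by (simp add: smooth_on_def)
qed

lemma smooth_manifold_circle: "smooth_manifold circle"
proof -
  have "(\<Union>a. cdom circle a) = topspace (mtop circle)"
  proof -
    \<comment> \<open>Each angle chart misses one point, so two charts with different missing points cover the circle.\<close>
    have "cis 0 \<noteq> cis (- pi)"
      by (simp add: complex_eq_iff)
    then have "z \<in> cdom circle 0 \<union> cdom circle (- pi)" if "norm z = 1" for z
      using that by (auto simp: cdom_circle_eq)
    moreover have "cdom circle a \<subseteq> sphere 0 1" for a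
      by (auto simp: cdom_circle_eq)
    ultimately show ?thesis by fastforce
  qed
  moreover have "openin (mtop circle) (cdom circle a)" for a
    by (auto simp: cdom_circle_eq intro: openin_delete)
  moreover have "second_countable (euclidean :: complex topology)"
  proof -
    obtain B :: "complex set set" where B: "countable B" "topological_basis B"
      using ex_countable_basis by blast
    then show ?thesis
      unfolding second_countable_def
      by (intro exI[of _ B]) (metis open_openin topological_basis_open topological_basisE)
  qed
  ultimately show ?thesis
    unfolding smooth_manifold_def
    using homeomorphic_map_cmap_circle
      smooth_on_unit_derivative[OF open_overlap_circle transition_circle_has_derivative]
    by (simp add: cimage_circle Hausdorff_space_subtopology second_countable_subtopology)
qed

lemma smooth_manifold_torus: "smooth_manifold torus"
  by (simp add: torus_def smooth_manifold_prod_mfd smooth_manifold_circle)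

lemma has_derivative_transition_prod_mfd:
  assumes M: "smooth_manifold M" and N: "smooth_manifold N"
    and "i \<in> charts M" "i' \<in> charts M" "j \<in> charts N" "j' \<in> charts N"
    and x: "x \<in> overlap (prod_mfd M N) (i, j) (i', j')"
  shows "(transition (prod_mfd M N) (i, j) (i', j') has_derivative
    (\<lambda>v. (frechet_derivative (transition M i i') (at (fst x)) (fst v),
          frechet_derivative (transition N j j') (at (snd x)) (snd v)))) (at x)"
proof -
  have op: "open (overlap (prod_mfd M N) (i, j) (i', j'))"
    using open_overlap[OF smooth_manifold_prod_mfd[OF M N]] assms by simp
  have "fst x \<in> overlap M i i'" "snd x \<in> overlap N j j'"
    using x by (auto simp: overlap_prod_mfd)
  then have "((\<lambda>y. (transition M i i' (fst y), transition N j j' (snd y))) has_derivative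
    (\<lambda>v. (frechet_derivative (transition M i i') (at (fst x)) (fst v),
          frechet_derivative (transition N j j') (at (snd x)) (snd v)))) (at x)"
    using assms
    by (intro has_derivative_Pair has_derivative_compose[OF has_derivative_fst[OF has_derivative_ident]]
        has_derivative_compose[OF has_derivative_snd[OF has_derivative_ident]]
        transition_has_derivative) auto
  then show ?thesis
    by (rule has_derivative_transform_within_open[OF _ op x])
      (use transition_prod_mfd[OF M N assms(3,5)] overlap_subset_cimage in fastforce)
qed

lemma frechet_derivative_transition_torus:
  assumes "x \<in> overlap torus i j"
  shows "frechet_derivative (transition torus i j) (at x) = (\<lambda>v. v)"
proof -
  obtain a b c d where ij: "i = (a, b)" "j = (c, d)" by (metis surj_pair)
  have x: "x \<in> overlap (prod_mfd circle circle) (a, b) (c, d)"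
    using assms ij by (simp add: torus_def)
  then have "fst x \<in> overlap circle a c" "snd x \<in> overlap circle b d"
    by (auto simp: overlap_prod_mfd)
  then show ?thesis
    unfolding torus_def ij
    using has_derivative_transition_prod_mfd[OF smooth_manifold_circle smooth_manifold_circle _ _ _ _ x]
      frechet_derivative_unique[OF transition_circle_has_derivative]
    by (intro frechet_derivative_unique) simp
qed


section \<open>Forms in charts\<close>

lemma form_eqI:
  "(\<And>i x vs. i \<in> charts M \<Longrightarrow> x \<in> cimage M i \<Longrightarrow> length vs = k \<Longrightarrow> a i x vs = b i x vs)
    \<Longrightarrow> form_eq M k a b"
  by (simp add: form_eq_def)

lemma form_eqD:
  "form_eq M k a b \<Longrightarrow> i \<in> charts M \<Longrightarrow> x \<in> cimage M i \<Longrightarrow> length vs = k \<Longrightarrow> a i x vs = b i x vs"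
  by (simp add: form_eq_def)

lemma form_eq_sym: "form_eq M k a b \<Longrightarrow> form_eq M k b a"
  by (simp add: form_eq_def)

lemma form_eq_trans [trans]: "form_eq M k a b \<Longrightarrow> form_eq M k b c \<Longrightarrow> form_eq M k a c"
  by (simp add: form_eq_def)

lemma form_eq_zero_scale: "form_eq M k a zero_form \<Longrightarrow> form_eq M k (scale_form c a) zero_form"
  by (simp add: form_eq_def scale_form_def zero_form_def)

lemma diff_formD:
  assumes "diff_form M k \<omega>" "i \<in> charts M"
  shows "x \<in> cimage M i \<Longrightarrow> multilinear_alternating k (\<omega> i x)"
    and "length vs = k \<Longrightarrow> smooth_on (cimage M i) (\<lambda>x. \<omega> i x vs)"
    and "\<lbrakk>j \<in> charts M; x \<in> overlap M i j; length vs = k\<rbrakk> \<Longrightarrow> \<omega> i x vs =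
      \<omega> j (transition M i j x) (map (frechet_derivative (transition M i j) (at x)) vs)"
  using assms by (simp_all add: diff_form_def)

lemma multilinear_alternating_cong:
  assumes "multilinear_alternating k f" "\<And>vs. length vs = k \<Longrightarrow> f vs = g vs"
  shows "multilinear_alternating k g"
  unfolding multilinear_alternating_def
proof (intro allI impI conjI)
  fix vs :: "'a list" and j assume vs: "length vs = k" "j < k"
  have "(\<lambda>v. g (vs[j := v])) = (\<lambda>v. f (vs[j := v]))"
    using assms(2) vs by simp
  then show "linear (\<lambda>v. g (vs[j := v]))"
    using assms(1) vs by (simp add: multilinear_alternating_def)
  fix l assume "l < k" "j \<noteq> l \<and> vs ! j = vs ! l"
  then show "g vs = 0"
    using assms vs unfolding multilinear_alternating_def by metis
qed

lemma multilinear_alternating_lincomb: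
  assumes "multilinear_alternating k f" "multilinear_alternating k g" "linear p" "linear q"
  shows "multilinear_alternating k (\<lambda>vs. p (f vs) + q (g vs))"
  unfolding multilinear_alternating_def
proof (intro allI impI conjI)
  fix vs :: "'a list" and j assume vs: "length vs = k" "j < k"
  have "linear (\<lambda>v. f (vs[j := v]))" "linear (\<lambda>v. g (vs[j := v]))"
    using assms(1,2) vs by (auto simp: multilinear_alternating_def)
  then show "linear (\<lambda>v. p (f (vs[j := v])) + q (g (vs[j := v])))"
    using linear_compose_add[OF linear_compose[OF _ assms(3)] linear_compose[OF _ assms(4)]]
    by (simp add: o_def)
  fix l assume "l < k" "j \<noteq> l \<and> vs ! j = vs ! l"
  then have "f vs = 0" "g vs = 0"
    using assms vs unfolding multilinear_alternating_def by metis+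
  then show "p (f vs) + q (g vs) = 0"
    using assms(3,4) by (simp add: linear_0)
qed

lemma diff_form_cong:
  assumes M: "smooth_manifold M" and eq: "form_eq M k a b" and a: "diff_form M k a"
  shows "diff_form M k b"
  unfolding diff_form_def
proof (intro conjI ballI allI impI)
  fix i assume i: "i \<in> charts M"
  show "multilinear_alternating k (b i x)" if "x \<in> cimage M i" for x
    using multilinear_alternating_cong[OF diff_formD(1)[OF a i that]] form_eqD[OF eq i that] .
  show "smooth_on (cimage M i) (\<lambda>x. b i x vs)" if "length vs = k" for vs
    by (rule smooth_on_cong[OF smooth_manifoldD(5)[OF M i] _ diff_formD(2)[OF a i that]])
      (rule form_eqD[OF eq i _ that])
  fix j x and vs :: "'c list" assume j: "j \<in> charts M" "x \<in> overlap M i j" "length vs = k"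
  have x: "x \<in> cimage M i" "transition M i j x \<in> cimage M j"
    using transition_in_cimage[OF M i j(2)] j(2) overlap_subset_cimage[of M i j] by auto
  show "b i x vs =
      b j (transition M i j x) (map (frechet_derivative (transition M i j) (at x)) vs)"
    using diff_formD(3)[OF a i j] form_eqD[OF eq i x(1) j(3)]
      form_eqD[OF eq j(1) x(2), of "map (frechet_derivative (transition M i j) (at x)) vs"] j(3)
    by simp
qed

lemma diff_form_lincomb:
  assumes "smooth_manifold M" "diff_form M k a" "diff_form M k b" "bounded_linear p" "bounded_linear q"
  shows "diff_form M k (\<lambda>i x vs. p (a i x vs) + q (b i x vs))"
  unfolding diff_form_def
proof (intro conjI ballI allI impI)
  fix i assume i: "i \<in> charts M"
  show "multilinear_alternating k (\<lambda>vs. p (a i x vs) + q (b i x vs))" if "x \<in> cimage M i" for x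
    using multilinear_alternating_lincomb[OF diff_formD(1)[OF assms(2) i that]
        diff_formD(1)[OF assms(3) i that] bounded_linear.linear[OF assms(4)]
        bounded_linear.linear[OF assms(5)]] .
  show "smooth_on (cimage M i) (\<lambda>x. p (a i x vs) + q (b i x vs))" if "length vs = k" for vs
    by (rule smooth_on_add[OF smooth_manifoldD(5)[OF assms(1) i]
          smooth_on_linear_image[OF smooth_manifoldD(5)[OF assms(1) i] assms(4)
            diff_formD(2)[OF assms(2) i that]]
          smooth_on_linear_image[OF smooth_manifoldD(5)[OF assms(1) i] assms(5)
            diff_formD(2)[OF assms(3) i that]]])
  fix j x and vs :: "'c list" assume "j \<in> charts M" "x \<in> overlap M i j" "length vs = k"
  then show "p (a i x vs) + q (b i x vs) =
      p (a j (transition M i j x) (map (frechet_derivative (transition M i j) (at x)) vs)) +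
      q (b j (transition M i j x) (map (frechet_derivative (transition M i j) (at x)) vs))"
    using diff_formD(3)[OF assms(2) i] diff_formD(3)[OF assms(3) i] by metis
qed

lemma diff_form_complex_form:
  assumes "smooth_manifold M" "diff_form M k a" "diff_form M k b"
  shows "diff_form M k (complex_form a b)"
proof -
  have "bounded_linear complex_of_real" "bounded_linear (\<lambda>r. \<i> * complex_of_real r)"
    by (auto intro: bounded_linear_of_real bounded_linear_mult_right
        bounded_linear_compose[OF bounded_linear_mult_right, unfolded o_def])
  from diff_form_lincomb[OF assms this] show ?thesis
    by (simp add: complex_form_def Complex_eq)
qed

lemma diff_form_scale_form:
  assumes "smooth_manifold M" "diff_form M k a"
  shows "diff_form M k (scale_form c a)"
  using diff_form_lincomb[OF assms(1,2,2) bounded_linear_scaleR_right[of c] bounded_linear_zero]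
  by (simp add: scale_form_def)

lemma ext_deriv_cong:
  fixes a b :: "('i, 'e::euclidean_space, 'v::real_normed_vector) form"
  assumes M: "smooth_manifold M" and eq: "form_eq M k a b"
  shows "form_eq M (Suc k) (ext_deriv a) (ext_deriv b)"
proof (rule form_eqI)
  fix i x and vs :: "'e list"
  assume i: "i \<in> charts M" and x: "x \<in> cimage M i" and vs: "length vs = Suc k"
  have "frechet_derivative (\<lambda>y. a i y (take j vs @ drop (Suc j) vs)) (at x) =
      frechet_derivative (\<lambda>y. b i y (take j vs @ drop (Suc j) vs)) (at x)" if "j < Suc k" for j
    by (rule frechet_derivative_cong_open[OF smooth_manifoldD(5)[OF M i] x])
      (use form_eqD[OF eq i] vs that in simp)
  then show "ext_deriv a i x vs = ext_deriv b i x vs"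
    using vs by (simp add: ext_deriv_def)
qed

lemma ext_deriv_scale_form:
  fixes a :: "('i, 'e::euclidean_space, 'v::real_normed_vector) form"
  assumes "diff_form M k a"
  shows "form_eq M (Suc k) (ext_deriv (scale_form c a)) (scale_form c (ext_deriv a))"
proof (rule form_eqI)
  fix i x and vs :: "'e list"
  assume i: "i \<in> charts M" and x: "x \<in> cimage M i" and vs: "length vs = Suc k"
  have "frechet_derivative (\<lambda>y. c *\<^sub>R a i y (take j vs @ drop (Suc j) vs)) (at x) =
      (\<lambda>v. c *\<^sub>R frechet_derivative (\<lambda>y. a i y (take j vs @ drop (Suc j) vs)) (at x) v)"
    if "j < Suc k" for j
    by (intro frechet_derivative_unique has_derivative_scaleR_right
        smooth_on_has_derivative[OF _ x] diff_formD(2)[OF assms i]) (use vs that in simp)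
  then show "ext_deriv (scale_form c a) i x vs = scale_form c (ext_deriv a) i x vs"
    using vs by (simp add: ext_deriv_def scale_form_def scaleR_sum_right mult.commute)
qed

lemma ext_deriv_2:
  "ext_deriv a i x [u, v] =
    frechet_derivative (\<lambda>y. a i y [v]) (at x) u - frechet_derivative (\<lambda>y. a i y [u]) (at x) v"
  by (simp add: ext_deriv_def lessThan_Suc)

lemma ext_deriv_3:
  "ext_deriv a i x [u, v, w] =
    frechet_derivative (\<lambda>y. a i y [v, w]) (at x) u - frechet_derivative (\<lambda>y. a i y [u, w]) (at x) v
    + frechet_derivative (\<lambda>y. a i y [u, v]) (at x) w"
  by (simp add: ext_deriv_def lessThan_Suc)

lemma ext_deriv_4:
  "ext_deriv a i x [t, u, v, w] =
    frechet_derivative (\<lambda>y. a i y [u, v, w]) (at x) t - frechet_derivative (\<lambda>y. a i y [t, v, w]) (at x) u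
    + frechet_derivative (\<lambda>y. a i y [t, u, w]) (at x) v - frechet_derivative (\<lambda>y. a i y [t, u, v]) (at x) w"
  by (simp add: ext_deriv_def lessThan_Suc)


section \<open>Wedge products on few vectors\<close>

lemma length_4E:
  assumes "length vs = 4"
  obtains t u v w where "vs = [t, u, v, w]"
  using assms by (auto simp: numeral_eq_Suc length_Suc_conv)

text \<open>Once the shuffles are listed explicitly in \<open>F\<close>, the right-hand side contains only finite sums, which
  evaluate by rewriting.\<close>

lemma wedge_eq_sum:
  assumes "length vs = n" "{S. S \<subseteq> {..<n} \<and> card S = k} = F"
  shows "wedge k a b i x vs = (\<Sum>S\<in>F. (- 1) ^ (\<Sum>s\<in>S. \<Sum>t<n. if t \<notin> S \<and> t < s then 1 else 0) *
    (a i x (nths vs S) * b i x (nths vs (- S))))"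
proof -
  have "card {(s, t). s \<in> S \<and> t \<in> {..<n} - S \<and> t < s} =
      (\<Sum>s\<in>S. \<Sum>t<n. if t \<notin> S \<and> t < s then 1 else 0)" if "S \<in> F" for S
  proof -
    have "{(s, t). s \<in> S \<and> t \<in> {..<n} - S \<and> t < s} = (SIGMA s:S. {t \<in> {..<n}. t \<notin> S \<and> t < s})"
      by auto
    moreover have "finite S"
      using that assms(2) finite_subset[of S "{..<n}"] by auto
    moreover have "card {t \<in> {..<n}. t \<notin> S \<and> t < s} = (\<Sum>t<n. if t \<notin> S \<and> t < s then 1 else 0)" for s
      by (simp only: card_eq_sum sum.inter_filter[OF finite_lessThan])
    ultimately show ?thesis
      by simp
  qed
  then show ?thesis
    unfolding wedge_def assms by simp
qed

lemma wedge_1_2: "wedge 1 a b i x [u, v] = a i x [u] * b i x [v] - a i x [v] * b i x [u]"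
proof -
  have S: "{S. S \<subseteq> {..<2::nat} \<and> card S = 1} = {{0}, {1}}"
    by (auto simp: card_1_singleton_iff less_Suc_eq numeral_2_eq_2)
  show ?thesis
    by (subst wedge_eq_sum[OF _ S]) (simp_all add: nths_Cons lessThan_Suc numeral_2_eq_2)
qed

lemma wedge_1_3:
  "wedge 1 a b i x [u, v, w] =
    a i x [u] * b i x [v, w] - a i x [v] * b i x [u, w] + a i x [w] * b i x [u, v]"
proof -
  have S: "{S. S \<subseteq> {..<3::nat} \<and> card S = 1} = {{0}, {1}, {2}}"
    by (auto simp: card_1_singleton_iff less_Suc_eq numeral_eq_Suc)
  show ?thesis
    by (subst wedge_eq_sum[OF _ S]) (simp_all add: nths_Cons lessThan_Suc numeral_eq_Suc)
qed

lemma wedge_2_4: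
  "wedge 2 a b i x [t, u, v, w] =
    a i x [t, u] * b i x [v, w] - a i x [t, v] * b i x [u, w] + a i x [t, w] * b i x [u, v]
    + a i x [u, v] * b i x [t, w] - a i x [u, w] * b i x [t, v] + a i x [v, w] * b i x [t, u]"
proof -
  have "S \<in> {{0,1}, {0,2}, {0,3}, {1,2}, {1,3}, {2,3}}" if S: "S \<subseteq> {..<4}" "card S = 2"
    for S :: "nat set"
  proof -
    obtain p q where pq: "S = {p, q}" "p \<noteq> q"
      using S(2) unfolding card_2_iff by blast
    have "p = 0 \<or> p = 1 \<or> p = 2 \<or> p = 3" "q = 0 \<or> q = 1 \<or> q = 2 \<or> q = 3"
      using S(1) pq(1) by auto
    then show ?thesis
      using pq by (elim disjE) (simp_all add: insert_commute)
  qed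
  then have S: "{S. S \<subseteq> {..<4::nat} \<and> card S = 2} = {{0,1}, {0,2}, {0,3}, {1,2}, {1,3}, {2,3}}"
    by (intro equalityI subsetI CollectI) (simp_all, auto)
  show ?thesis
    by (subst wedge_eq_sum[OF _ S])
      (simp_all add: nths_Cons lessThan_Suc numeral_eq_Suc doubleton_eq_iff)
qed

lemma length_nths_split:
  assumes "S \<subseteq> {..<length vs}"
  shows "length (nths vs S) = card S" "length (nths vs (- S)) = length vs - card S"
proof -
  have "{i. i < length vs \<and> i \<in> S} = S" "{i. i < length vs \<and> i \<in> - S} = {..<length vs} - S"
    using assms by auto
  then show "length (nths vs S) = card S" "length (nths vs (- S)) = length vs - card S"
    using assms by (simp_all add: length_nths card_Diff_subset finite_subset[OF assms])
qed

lemma wedge_zero_left: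
  "form_eq M k a zero_form \<Longrightarrow> form_eq M n (wedge k a b) zero_form"
  unfolding form_eq_def wedge_def zero_form_def
  by (auto intro!: sum.neutral simp: length_nths_split(1))

lemma wedge_zero_right:
  "form_eq M m b zero_form \<Longrightarrow> form_eq M (k + m) (wedge k a b) zero_form"
  unfolding form_eq_def wedge_def zero_form_def
  by (auto intro!: sum.neutral simp: length_nths_split(2))

text \<open>The graded Leibniz rule in the only degrees where it is needed below: for a closed \<open>1\<close>-form \<open>b\<close>
  the twelve derivatives of \<open>b\<close> cancel in pairs, and those of \<open>a\<close> form four copies of \<open>da\<close>.\<close>

lemma closed_wedge_1_2:
  fixes a b :: "('i, 'e::euclidean_space, real) form"
  assumes b: "diff_form M 1 b" "form_eq M 2 (ext_deriv b) zero_form"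
    and a: "diff_form M 2 a" "form_eq M 3 (ext_deriv a) zero_form"
  shows "form_eq M 4 (ext_deriv (wedge 1 b a)) zero_form"
proof (rule form_eqI)
  fix i x and vs :: "'e list"
  assume i: "i \<in> charts M" and x: "x \<in> cimage M i" and "length vs = 4"
  then obtain p q r s where vs: "vs = [p, q, r, s]"
    by (auto simp: numeral_eq_Suc length_Suc_conv)
  define B where "B u v = frechet_derivative (\<lambda>y. b i y [v]) (at x) u" for u v
  define A where "A u v w = frechet_derivative (\<lambda>y. a i y [v, w]) (at x) u" for u v w
  have db: "((\<lambda>y. b i y [v]) has_derivative (\<lambda>u. B u v)) (at x)" for v
    unfolding B_def by (rule smooth_on_has_derivative[OF diff_formD(2)[OF b(1) i] x]) simp
  have da: "((\<lambda>y. a i y [v, w]) has_derivative (\<lambda>u. A u v w)) (at x)" for v w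
    unfolding A_def by (rule smooth_on_has_derivative[OF diff_formD(2)[OF a(1) i] x]) simp
  have D: "frechet_derivative (\<lambda>y. wedge 1 b a i y [u, v, w]) (at x) t =
      (b i x [u] * A t v w + B t u * a i x [v, w]) - (b i x [v] * A t u w + B t v * a i x [u, w])
      + (b i x [w] * A t u v + B t w * a i x [u, v])" for t u v w
    unfolding wedge_1_3
    by (subst frechet_derivative_unique[OF has_derivative_add[OF has_derivative_diff[OF
              has_derivative_mult[OF db da] has_derivative_mult[OF db da]]
            has_derivative_mult[OF db da]]]) simp
  have B: "B u v = B v u" for u v
    using form_eqD[OF b(2) i x, of "[u, v]"] by (simp add: ext_deriv_2 zero_form_def B_def)
  have A: "A u v w = A v u w - A w u v" for u v w
    using form_eqD[OF a(2) i x, of "[u, v, w]"] by (simp add: ext_deriv_3 zero_form_def A_def)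
  \<comment> \<open>The instances of \<open>B\<close> and \<open>A\<close> orient each relation, so that all derivatives are expressed by
    independent ones.\<close>
  show "ext_deriv (wedge 1 b a) i x vs = zero_form i x vs"
    unfolding vs ext_deriv_4 D zero_form_def
      B[of q p] B[of r p] B[of s p] B[of r q] B[of s q] B[of s r]
      A[of p q r] A[of p q s] A[of p r s] A[of q r s]
    by (simp add: algebra_simps)
qed


section \<open>Pulling back along maps that are linear in the charts\<close>

text \<open>The projections of a product of manifolds are linear in the product charts: \<open>\<rho>\<close> is the map of chart
  indices and \<open>\<pi>\<close> is the linear map that represents \<open>f\<close>.\<close>

definition linear_in_charts ::
  "('a, 'i, 'e::euclidean_space) mfd \<Rightarrow> ('b, 'j, 'f::euclidean_space) mfd \<Rightarrow> ('a \<Rightarrow> 'b) \<Rightarrow>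
   ('i \<Rightarrow> 'j) \<Rightarrow> ('e \<Rightarrow> 'f) \<Rightarrow> bool" where
  "linear_in_charts M N f \<rho> \<pi> \<longleftrightarrow> smooth_manifold M \<and> smooth_manifold N \<and> bounded_linear \<pi> \<and>
     (\<forall>i\<in>charts M. \<rho> i \<in> charts N \<and>
        (\<forall>x\<in>cimage M i. \<pi> x \<in> cimage N (\<rho> i) \<and> f (cinv M i x) = cinv N (\<rho> i) (\<pi> x)))"

text \<open>In contrast to \<^const>\<open>pullback\<close> this involves no choice of a chart around the image point.\<close>

definition chart_pullback :: "('i \<Rightarrow> 'j) \<Rightarrow> ('e \<Rightarrow> 'f) \<Rightarrow> ('j, 'f, 'v) form \<Rightarrow> ('i, 'e, 'v) form" where
  "chart_pullback \<rho> \<pi> \<omega> = (\<lambda>i x vs. \<omega> (\<rho> i) (\<pi> x) (map \<pi> vs))"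

lemma linear_in_charts_fst:
  assumes "smooth_manifold M" "smooth_manifold N"
  shows "linear_in_charts (prod_mfd M N) M fst fst fst"
  using assms cinv_prod_mfd[OF assms]
  by (auto simp: linear_in_charts_def smooth_manifold_prod_mfd bounded_linear_fst cimage_prod_mfd)

lemma linear_in_charts_snd:
  assumes "smooth_manifold M" "smooth_manifold N"
  shows "linear_in_charts (prod_mfd M N) N snd snd snd"
  using assms cinv_prod_mfd[OF assms]
  by (auto simp: linear_in_charts_def smooth_manifold_prod_mfd bounded_linear_snd cimage_prod_mfd)

context
  fixes M :: "('a, 'i, 'e::euclidean_space) mfd" and N :: "('b, 'j, 'f::euclidean_space) mfd"
    and f \<rho> \<pi>
  assumes lin: "linear_in_charts M N f \<rho> \<pi>"
begin

lemma linear_in_chartsD: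
  shows "smooth_manifold M" "smooth_manifold N" "bounded_linear \<pi>"
    and "i \<in> charts M \<Longrightarrow> \<rho> i \<in> charts N"
    and "i \<in> charts M \<Longrightarrow> x \<in> cimage M i \<Longrightarrow> \<pi> x \<in> cimage N (\<rho> i)"
    and "i \<in> charts M \<Longrightarrow> x \<in> cimage M i \<Longrightarrow> f (cinv M i x) = cinv N (\<rho> i) (\<pi> x)"
  using lin by (auto simp: linear_in_charts_def)

text \<open>The first claim is what makes the transformation laws of \<open>N\<close> applicable at \<open>\<pi> x\<close>; both come from the
  fact that \<open>x\<close> and its image under the transition map are coordinates of one point of \<open>M\<close>.\<close>

lemma linear_in_charts_transition:
  assumes i: "i \<in> charts M" and j: "j \<in> charts M" and x: "x \<in> overlap M i j"
  shows "\<pi> x \<in> overlap N (\<rho> i) (\<rho> j)"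
    and "\<pi> (transition M i j x) = transition N (\<rho> i) (\<rho> j) (\<pi> x)"
proof -
  have xi: "x \<in> cimage M i" and "cinv M i x \<in> cdom M j"
    using x mem_overlap_iff[OF linear_in_chartsD(1) i] by auto
  then have "cinv M j (transition M i j x) = cinv M i x"
    using cinv_cmap[OF linear_in_chartsD(1) j] by (simp add: transition_def)
  then have *: "cinv N (\<rho> i) (\<pi> x) = cinv N (\<rho> j) (\<pi> (transition M i j x))"
    and y: "\<pi> (transition M i j x) \<in> cimage N (\<rho> j)"
    using linear_in_chartsD(6)[OF i xi] linear_in_chartsD(5,6)[OF j, of "transition M i j x"]
      transition_in_cimage[OF linear_in_chartsD(1) i x] by simp_all
  show "\<pi> x \<in> overlap N (\<rho> i) (\<rho> j)"
    using * cinv_in_cdom[OF y] linear_in_chartsD(5)[OF i xi]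
      mem_overlap_iff[OF linear_in_chartsD(2) linear_in_chartsD(4)[OF i]] by simp
  show "\<pi> (transition M i j x) = transition N (\<rho> i) (\<rho> j) (\<pi> x)"
    using * cmap_cinv[OF y] by (simp add: transition_def)
qed

lemma linear_in_charts_derivative:
  assumes i: "i \<in> charts M" and j: "j \<in> charts M" and x: "x \<in> overlap M i j"
  shows "\<pi> (frechet_derivative (transition M i j) (at x) v) =
    frechet_derivative (transition N (\<rho> i) (\<rho> j)) (at (\<pi> x)) (\<pi> v)"
proof -
  note M = linear_in_chartsD(1) and N = linear_in_chartsD(2)
  have "((\<lambda>y. \<pi> (transition M i j y)) has_derivative
      (\<lambda>v. \<pi> (frechet_derivative (transition M i j) (at x) v))) (at x)"
    by (rule bounded_linear.has_derivative[OF linear_in_chartsD(3)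
          transition_has_derivative[OF M i j x]])
  then have 1: "((\<lambda>y. transition N (\<rho> i) (\<rho> j) (\<pi> y)) has_derivative
      (\<lambda>v. \<pi> (frechet_derivative (transition M i j) (at x) v))) (at x)"
    by (rule has_derivative_transform_within_open[OF _ open_overlap[OF M i j] x])
      (rule linear_in_charts_transition(2)[OF i j])
  have 2: "((\<lambda>y. transition N (\<rho> i) (\<rho> j) (\<pi> y)) has_derivative
      (\<lambda>v. frechet_derivative (transition N (\<rho> i) (\<rho> j)) (at (\<pi> x)) (\<pi> v))) (at x)"
    by (rule has_derivative_compose[OF bounded_linear_imp_has_derivative[OF linear_in_chartsD(3)]
          transition_has_derivative[OF N linear_in_chartsD(4)[OF i] linear_in_chartsD(4)[OF j]
            linear_in_charts_transition(1)[OF i j x]]])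
  from has_derivative_unique[OF 1 2] show ?thesis by metis
qed

text \<open>The chart of \<open>N\<close> that \<^const>\<open>pullback\<close> picks may differ from \<open>\<rho> i\<close>. In that chart \<open>f\<close> is \<open>\<pi>\<close> followed by a
  transition map of \<open>N\<close>, and the transformation law of \<open>\<omega>\<close> removes the transition map.\<close>

lemma pullback_eq_chart_pullback:
  assumes \<omega>: "diff_form N k \<omega>"
  shows "form_eq M k (pullback M N f \<omega>) (chart_pullback \<rho> \<pi> \<omega>)"
proof (rule form_eqI)
  fix i x and vs :: "'e list"
  assume i: "i \<in> charts M" and x: "x \<in> cimage M i" and vs: "length vs = k"
  note N = linear_in_chartsD(2) and \<rho>i = linear_in_chartsD(4)[OF i]
  define j where "j = (SOME j. j \<in> charts N \<and> f (cinv M i x) \<in> cdom N j)"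
  have "\<exists>j. j \<in> charts N \<and> f (cinv M i x) \<in> cdom N j"
    using \<rho>i linear_in_chartsD(5,6)[OF i x] cinv_in_cdom by metis
  then have j: "j \<in> charts N" "f (cinv M i x) \<in> cdom N j"
    unfolding j_def using someI_ex by (metis (mono_tags, lifting))+
  have ov: "\<pi> x \<in> overlap N (\<rho> i) j"
    using j linear_in_chartsD(5,6)[OF i x] mem_overlap_iff[OF N \<rho>i] by simp
  define F where "F = cmap N j \<circ> f \<circ> cinv M i"
  have F: "F y = transition N (\<rho> i) j (\<pi> y)" if "y \<in> cimage M i" for y
    using linear_in_chartsD(6)[OF i that] by (simp add: F_def transition_def)
  have "((\<lambda>y. transition N (\<rho> i) j (\<pi> y)) has_derivative
      (\<lambda>v. frechet_derivative (transition N (\<rho> i) j) (at (\<pi> x)) (\<pi> v))) (at x)"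
    by (rule has_derivative_compose[OF bounded_linear_imp_has_derivative[OF linear_in_chartsD(3)]
          transition_has_derivative[OF N \<rho>i j(1) ov]])
  then have "(F has_derivative
      (\<lambda>v. frechet_derivative (transition N (\<rho> i) j) (at (\<pi> x)) (\<pi> v))) (at x)"
    by (rule has_derivative_transform_within_open[OF _ smooth_manifoldD(5)[OF linear_in_chartsD(1) i] x])
      (simp add: F)
  then have "pullback M N f \<omega> i x vs = \<omega> j (transition N (\<rho> i) j (\<pi> x))
      (map (frechet_derivative (transition N (\<rho> i) j) (at (\<pi> x))) (map \<pi> vs))"
    unfolding pullback_def Let_def j_def[symmetric] F_def[symmetric]
    using F[OF x] by (simp add: frechet_derivative_unique o_def)
  also have "\<dots> = \<omega> (\<rho> i) (\<pi> x) (map \<pi> vs)"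
    using diff_formD(3)[OF \<omega> \<rho>i j(1) ov, of "map \<pi> vs"] vs by simp
  finally show "pullback M N f \<omega> i x vs = chart_pullback \<rho> \<pi> \<omega> i x vs"
    by (simp add: chart_pullback_def)
qed

lemma diff_form_chart_pullback:
  assumes \<omega>: "diff_form N k \<omega>"
  shows "diff_form M k (chart_pullback \<rho> \<pi> \<omega>)"
  unfolding diff_form_def chart_pullback_def
proof (intro conjI ballI allI impI)
  fix i assume i: "i \<in> charts M"
  note \<rho>i = linear_in_chartsD(4)[OF i]
  show "multilinear_alternating k (\<lambda>vs. \<omega> (\<rho> i) (\<pi> x) (map \<pi> vs))" if "x \<in> cimage M i" for x
  proof -
    have ml: "multilinear_alternating k (\<omega> (\<rho> i) (\<pi> x))"
      using diff_formD(1)[OF \<omega> \<rho>i] linear_in_chartsD(5)[OF i that] by simp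
    show ?thesis
      unfolding multilinear_alternating_def
    proof (intro allI impI conjI)
      fix vs :: "'e list" and l assume vs: "length vs = k" "l < k"
      have "linear (\<lambda>v. \<omega> (\<rho> i) (\<pi> x) ((map \<pi> vs)[l := v]))"
        using ml vs by (auto simp: multilinear_alternating_def)
      from linear_compose[OF bounded_linear.linear[OF linear_in_chartsD(3)] this]
      show "linear (\<lambda>v. \<omega> (\<rho> i) (\<pi> x) (map \<pi> (vs[l := v])))"
        by (simp add: o_def map_update)
      fix m assume "m < k" "l \<noteq> m \<and> vs ! l = vs ! m"
      then show "\<omega> (\<rho> i) (\<pi> x) (map \<pi> vs) = 0"
        using ml vs unfolding multilinear_alternating_def by (metis length_map nth_map)
    qed
  qed
  show "smooth_on (cimage M i) (\<lambda>x. \<omega> (\<rho> i) (\<pi> x) (map \<pi> vs))" if "length vs = k" for vs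
    by (rule smooth_on_linear_substitution[OF smooth_manifoldD(5)[OF linear_in_chartsD(2) \<rho>i]
          smooth_manifoldD(5)[OF linear_in_chartsD(1) i] linear_in_chartsD(3)
          linear_in_chartsD(5)[OF i] diff_formD(2)[OF \<omega> \<rho>i]]) (simp_all add: that)
  fix j x and vs :: "'e list"
  assume j: "j \<in> charts M" and x: "x \<in> overlap M i j" and vs: "length vs = k"
  show "\<omega> (\<rho> i) (\<pi> x) (map \<pi> vs) = \<omega> (\<rho> j) (\<pi> (transition M i j x))
      (map \<pi> (map (frechet_derivative (transition M i j) (at x)) vs))"
    using diff_formD(3)[OF \<omega> \<rho>i linear_in_chartsD(4)[OF j]
        linear_in_charts_transition(1)[OF i j x], of "map \<pi> vs"] vs
    by (simp add: o_def linear_in_charts_derivative[OF i j x] linear_in_charts_transition(2)[OF i j x])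
qed

lemma closed_chart_pullback:
  assumes \<omega>: "diff_form N k \<omega>" and closed: "form_eq N (Suc k) (ext_deriv \<omega>) zero_form"
  shows "form_eq M (Suc k) (ext_deriv (chart_pullback \<rho> \<pi> \<omega>)) zero_form"
proof (rule form_eqI)
  fix i x and vs :: "'e list"
  assume i: "i \<in> charts M" and x: "x \<in> cimage M i" and vs: "length vs = Suc k"
  let ?vs = "\<lambda>j. take j vs @ drop (Suc j) vs"
  note \<rho>i = linear_in_chartsD(4)[OF i] and \<pi>x = linear_in_chartsD(5)[OF i x]
  have "frechet_derivative (\<lambda>y. \<omega> (\<rho> i) (\<pi> y) (map \<pi> (?vs j))) (at x) (vs ! j) =
      frechet_derivative (\<lambda>y. \<omega> (\<rho> i) y (map \<pi> (?vs j))) (at (\<pi> x)) (\<pi> (vs ! j))"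
    if "j < Suc k" for j
    by (subst frechet_derivative_unique[OF has_derivative_compose[OF
            bounded_linear_imp_has_derivative[OF linear_in_chartsD(3)]
            smooth_on_has_derivative[OF diff_formD(2)[OF \<omega> \<rho>i] \<pi>x]]]) (use vs that in simp_all)
  then have "ext_deriv (chart_pullback \<rho> \<pi> \<omega>) i x vs = ext_deriv \<omega> (\<rho> i) (\<pi> x) (map \<pi> vs)"
    using vs by (simp add: ext_deriv_def chart_pullback_def take_map drop_map)
  then show "ext_deriv (chart_pullback \<rho> \<pi> \<omega>) i x vs = zero_form i x vs"
    using form_eqD[OF closed \<rho>i \<pi>x] vs by (simp add: zero_form_def)
qed

corollary diff_form_pullback: "diff_form N k \<omega> \<Longrightarrow> diff_form M k (pullback M N f \<omega>)"
  using diff_form_cong[OF linear_in_chartsD(1) form_eq_sym[OF pullback_eq_chart_pullback]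
      diff_form_chart_pullback] .

corollary closed_pullback:
  "diff_form N k \<omega> \<Longrightarrow> form_eq N (Suc k) (ext_deriv \<omega>) zero_form \<Longrightarrow>
    form_eq M (Suc k) (ext_deriv (pullback M N f \<omega>)) zero_form"
  using form_eq_trans[OF ext_deriv_cong[OF linear_in_chartsD(1) pullback_eq_chart_pullback]
      closed_chart_pullback] .

end


section \<open>Quaternionic Hermitian linear algebra\<close>

definition quaternionic_hermitian ::
  "('e::euclidean_space \<Rightarrow> 'e \<Rightarrow> real) \<Rightarrow> ('e \<Rightarrow> 'e) \<Rightarrow> ('e \<Rightarrow> 'e) \<Rightarrow> ('e \<Rightarrow> 'e) \<Rightarrow> bool" where
  "quaternionic_hermitian g A B C \<longleftrightarrow>
     bilinear g \<and> (\<forall>v w. g v w = g w v) \<and> (\<forall>v. v \<noteq> 0 \<longrightarrow> 0 < g v v) \<and>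
     linear A \<and> linear B \<and> linear C \<and>
     (\<forall>v. A (A v) = - v) \<and> (\<forall>v. B (B v) = - v) \<and> (\<forall>v. C (C v) = - v) \<and>
     (\<forall>v. A (B v) = C v) \<and> (\<forall>v. B (A v) = - C v) \<and>
     (\<forall>v w. g (A v) (A w) = g v w) \<and> (\<forall>v w. g (B v) (B w) = g v w) \<and> (\<forall>v w. g (C v) (C w) = g v w)"

context
  fixes g :: "'e::euclidean_space \<Rightarrow> 'e \<Rightarrow> real" and A B C
  assumes Q: "quaternionic_hermitian g A B C"
begin

lemma quaternionic_bilinear: "bilinear g"
  using Q by (simp add: quaternionic_hermitian_def)

lemma quaternionic_linear: "linear A" "linear B" "linear C"
  using Q by (simp_all add: quaternionic_hermitian_def)

lemma quaternionic_metric: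
  "g v w = g w v" "v \<noteq> 0 \<Longrightarrow> 0 < g v v"
  "g (A v) (A w) = g v w" "g (B v) (B w) = g v w" "g (C v) (C w) = g v w"
  using Q by (simp_all add: quaternionic_hermitian_def)

lemma quaternionic_relations:
  "A (A v) = - v" "B (B v) = - v" "C (C v) = - v" "A (B v) = C v" "B (A v) = - C v"
  "B (C v) = A v" "C (B v) = - A v" "C (A v) = B v" "A (C v) = - B v"
proof -
  have r: "A (A v) = - v" "B (B v) = - v" "C (C v) = - v" "A (B v) = C v" "B (A v) = - C v" for v
    using Q by (simp_all add: quaternionic_hermitian_def)
  note n = quaternionic_linear[THEN linear_neg]
  show "A (A v) = - v" "B (B v) = - v" "C (C v) = - v" "A (B v) = C v" "B (A v) = - C v"
    by (fact r)+
  show CB: "C (B v) = - A v" using r(4)[of "B v"] by (simp add: r n)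
  show "A (C v) = - B v" using r(1)[of "B v"] by (simp add: r)
  show "B (C v) = A v" using r(5)[of "B v"] CB by (simp add: r)
  show "C (A v) = B v" using r(5)[of "A v"] by (simp add: r n)
qed

lemma quaternionic_bilinear_simps:
  "g (u + v) w = g u w + g v w" "g w (u + v) = g w u + g w v"
  "g (c *\<^sub>R v) w = c * g v w" "g w (c *\<^sub>R v) = c * g w v"
  "g (- v) w = - g v w" "g w (- v) = - g w v"
  using quaternionic_bilinear
  by (simp_all add: bilinear_ladd bilinear_radd bilinear_lmul bilinear_rmul bilinear_lneg bilinear_rneg)

text \<open>An isometry with square \<open>-1\<close> is skew.\<close>

lemma quaternionic_skew: "g (A v) w = - g v (A w)" "g (B v) w = - g v (B w)" "g (C v) w = - g v (C w)"
  using quaternionic_metric(3)[of "A v" w] quaternionic_metric(4)[of "B v" w]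
    quaternionic_metric(5)[of "C v" w]
  by (simp_all add: quaternionic_relations quaternionic_bilinear_simps)

lemma quaternionic_orthogonal: "g v (A v) = 0" "g v (B v) = 0" "g v (C v) = 0"
  using quaternionic_skew[of v v] quaternionic_metric(1)[of v] by (simp_all)

lemma quaternionic_cyclic: "quaternionic_hermitian g B C A"
  using Q quaternionic_relations by (simp add: quaternionic_hermitian_def)

text \<open>The three complex structures play the role of the imaginary quaternion units, on whose span \<open>SO(3)\<close> acts;
  these are the rotations about the axis \<open>C\<close>.\<close>

lemma quaternionic_rotate:
  assumes cs: "c\<^sup>2 + s\<^sup>2 = 1"
  shows "quaternionic_hermitian g (\<lambda>v. c *\<^sub>R A v + s *\<^sub>R B v) (\<lambda>v. (- s) *\<^sub>R A v + c *\<^sub>R B v) C"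
proof -
  have lin: "linear (\<lambda>v. a *\<^sub>R A v + b *\<^sub>R B v)" for a b
    using linear_compose_add[OF linear_compose_scale_right linear_compose_scale_right]
      quaternionic_linear by blast
  have prod: "a *\<^sub>R A (p *\<^sub>R A v + q *\<^sub>R B v) + b *\<^sub>R B (p *\<^sub>R A v + q *\<^sub>R B v) =
      - ((a * p + b * q) *\<^sub>R v) + (a * q - b * p) *\<^sub>R C v" for a b p q v
    using quaternionic_linear(1,2)
    by (simp add: linear_add linear_scale quaternionic_relations algebra_simps)
  have herm: "g (a *\<^sub>R A v + b *\<^sub>R B v) (a *\<^sub>R A w + b *\<^sub>R B w) = (a\<^sup>2 + b\<^sup>2) * g v w" for a b v w
  proof -
    have "g w (C v) = - g v (C w)"
      using quaternionic_skew(3)[of v w] quaternionic_metric(1)[of w "C v"] by simp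
    then show ?thesis
      by (simp add: quaternionic_bilinear_simps quaternionic_metric(3,4) quaternionic_skew(1,2)
          quaternionic_relations power2_eq_square algebra_simps)
  qed
  have *: "c * c + s * s = 1" "s * s + c * c = 1" "- (s * s) - c * c = - 1" "s\<^sup>2 + c\<^sup>2 = 1"
    using cs by (simp_all add: power2_eq_square)
  show ?thesis
    unfolding quaternionic_hermitian_def
  proof (intro conjI allI impI)
    show "g v w = g w v" for v w
      by (rule quaternionic_metric)
    show "0 < g v v" if "v \<noteq> 0" for v
      using that by (rule quaternionic_metric)
  qed (simp_all only: prod herm lin quaternionic_bilinear quaternionic_metric(5)
      quaternionic_linear quaternionic_relations(3), simp_all add: cs * mult.commute)
qed

end

text \<open>The wedge product of two \<open>2\<close>-forms on a single tangent space, where the quaternionic linear algebra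
  takes place.\<close>

definition wedge22 :: "('e \<Rightarrow> 'e \<Rightarrow> real) \<Rightarrow> ('e \<Rightarrow> 'e \<Rightarrow> real) \<Rightarrow> 'e \<Rightarrow> 'e \<Rightarrow> 'e \<Rightarrow> 'e \<Rightarrow> real" where
  "wedge22 a b t u v w = a t u * b v w - a t v * b u w + a t w * b u v
     + a u v * b t w - a u w * b t v + a v w * b t u"

text \<open>In dimension four a single vector \<open>e\<close> generates the orthogonal basis \<open>e, Ae, Be, Ce\<close>. In its
  coordinates the three fundamental forms are \<open>q = g e e\<close> times the standard self-dual forms.\<close>

lemma quaternionic_frame:
  fixes g :: "real ^ 4 \<Rightarrow> real ^ 4 \<Rightarrow> real"
  assumes Q: "quaternionic_hermitian g A B C"
  obtains q and L :: "real ^ 4 \<Rightarrow> real ^ 4" where "q > 0" "surj L"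
    "\<And>p r. g (A (L p)) (L r) = q * (p$1 * r$2 - p$2 * r$1 + p$3 * r$4 - p$4 * r$3)"
    "\<And>p r. g (B (L p)) (L r) = q * (p$1 * r$3 - p$3 * r$1 + p$4 * r$2 - p$2 * r$4)"
    "\<And>p r. g (C (L p)) (L r) = q * (p$1 * r$4 - p$4 * r$1 + p$2 * r$3 - p$3 * r$2)"
proof -
  define e :: "real ^ 4" where "e = axis 1 1"
  define q where "q = g e e"
  define L where "L p = (p$1) *\<^sub>R e + (p$2) *\<^sub>R A e + (p$3) *\<^sub>R B e + (p$4) *\<^sub>R C e" for p :: "real ^ 4"
  note rel = quaternionic_relations[OF Q] and met = quaternionic_metric[OF Q]
  note lin = quaternionic_linear[OF Q, THEN linear_add] quaternionic_linear[OF Q, THEN linear_scale]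
  have q: "q > 0"
    unfolding q_def by (rule met(2)) (simp add: e_def)
  have orth: "g e (A e) = 0" "g e (B e) = 0" "g e (C e) = 0"
    "g (A e) e = 0" "g (B e) e = 0" "g (C e) e = 0"
    "g (A e) (B e) = 0" "g (B e) (A e) = 0" "g (A e) (C e) = 0" "g (C e) (A e) = 0"
    "g (B e) (C e) = 0" "g (C e) (B e) = 0"
    "g e e = q" "g (A e) (A e) = q" "g (B e) (B e) = q" "g (C e) (C e) = q"
    using quaternionic_orthogonal[OF Q, of e]
    by (simp_all add: quaternionic_skew[OF Q] rel quaternionic_bilinear_simps[OF Q] q_def)
  note bil = quaternionic_bilinear_simps[OF Q]
  have AL: "A (L p) = (p$1) *\<^sub>R A e - (p$2) *\<^sub>R e + (p$3) *\<^sub>R C e - (p$4) *\<^sub>R B e"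
    and BL: "B (L p) = (p$1) *\<^sub>R B e - (p$2) *\<^sub>R C e - (p$3) *\<^sub>R e + (p$4) *\<^sub>R A e"
    and CL: "C (L p) = (p$1) *\<^sub>R C e + (p$2) *\<^sub>R B e - (p$3) *\<^sub>R A e - (p$4) *\<^sub>R e" for p
    by (simp_all add: L_def lin rel)
  have g_frame: "g (a *\<^sub>R e + b *\<^sub>R A e + c *\<^sub>R B e + d *\<^sub>R C e) (L r) =
      q * (a * r$1 + b * r$2 + c * r$3 + d * r$4)" for a b c d r
    by (simp add: L_def bil orth algebra_simps)
  have "linear L"
    by (rule linearI) (simp_all add: L_def algebra_simps)
  moreover have "p = 0" if "L p = 0" for p
  proof -
    have "0 = g (L p) (L p)"
      using that bil(3)[of 0 0] by simp
    also have "\<dots> = q * (p$1 * p$1 + p$2 * p$2 + p$3 * p$3 + p$4 * p$4)"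
      using g_frame[of "p$1" "p$2" "p$3" "p$4" p] by (simp add: L_def)
    finally have "p$1 * p$1 + p$2 * p$2 + p$3 * p$3 + p$4 * p$4 = 0"
      using q by simp
    then have "p$1 = 0 \<and> p$2 = 0 \<and> p$3 = 0 \<and> p$4 = 0"
      by (metis add_nonneg_eq_0_iff add_nonneg_nonneg mult_eq_0_iff zero_le_square)
    then show "p = 0"
      by (simp add: vec_eq_iff forall_4)
  qed
  ultimately have surj: "surj L"
    using linear_injective_imp_surjective linear_injective_0 by blast
  have "g (A (L p)) (L r) = q * (p$1 * r$2 - p$2 * r$1 + p$3 * r$4 - p$4 * r$3)"
    "g (B (L p)) (L r) = q * (p$1 * r$3 - p$3 * r$1 + p$4 * r$2 - p$2 * r$4)"
    "g (C (L p)) (L r) = q * (p$1 * r$4 - p$4 * r$1 + p$2 * r$3 - p$3 * r$2)" for p r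
    using g_frame[of "- p$2" "p$1" "- p$4" "p$3" r] g_frame[of "- p$3" "p$4" "p$1" "- p$2" r]
      g_frame[of "- p$4" "- p$3" "p$2" "p$1" r]
    unfolding AL BL CL by (simp_all add: algebra_simps)
  with q surj show thesis by (rule that)
qed

text \<open>In the coordinates of the quaternionic frame these are polynomial identities.\<close>

lemma quaternionic_wedge22:
  fixes g :: "real ^ 4 \<Rightarrow> real ^ 4 \<Rightarrow> real"
  assumes Q: "quaternionic_hermitian g A B C"
  defines "\<omega>\<^sub>A \<equiv> \<lambda>v w. g (A v) w" and "\<omega>\<^sub>B \<equiv> \<lambda>v w. g (B v) w" and "\<omega>\<^sub>C \<equiv> \<lambda>v w. g (C v) w"
  shows "wedge22 \<omega>\<^sub>A \<omega>\<^sub>B t u v w = 0" "wedge22 \<omega>\<^sub>A \<omega>\<^sub>C t u v w = 0" "wedge22 \<omega>\<^sub>B \<omega>\<^sub>C t u v w = 0"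
    and "wedge22 \<omega>\<^sub>B \<omega>\<^sub>B t u v w = wedge22 \<omega>\<^sub>A \<omega>\<^sub>A t u v w"
    and "wedge22 \<omega>\<^sub>C \<omega>\<^sub>C t u v w = wedge22 \<omega>\<^sub>A \<omega>\<^sub>A t u v w"
    and "\<exists>t u v w. wedge22 \<omega>\<^sub>A \<omega>\<^sub>A t u v w \<noteq> 0"
proof -
  obtain q and L :: "real ^ 4 \<Rightarrow> real ^ 4" where q: "q > 0" and L: "surj L"
    and F: "\<And>p r. \<omega>\<^sub>A (L p) (L r) = q * (p$1 * r$2 - p$2 * r$1 + p$3 * r$4 - p$4 * r$3)"
    "\<And>p r. \<omega>\<^sub>B (L p) (L r) = q * (p$1 * r$3 - p$3 * r$1 + p$4 * r$2 - p$2 * r$4)"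
    "\<And>p r. \<omega>\<^sub>C (L p) (L r) = q * (p$1 * r$4 - p$4 * r$1 + p$2 * r$3 - p$3 * r$2)"
    unfolding \<omega>\<^sub>A_def \<omega>\<^sub>B_def \<omega>\<^sub>C_def by (rule quaternionic_frame[OF Q]) (rule that[unfolded \<omega>\<^sub>A_def \<omega>\<^sub>B_def \<omega>\<^sub>C_def])
  obtain a b c d where abcd: "t = L a" "u = L b" "v = L c" "w = L d"
    using L by (metis surjD)
  show "wedge22 \<omega>\<^sub>A \<omega>\<^sub>B t u v w = 0" "wedge22 \<omega>\<^sub>A \<omega>\<^sub>C t u v w = 0"
    "wedge22 \<omega>\<^sub>B \<omega>\<^sub>C t u v w = 0"
    "wedge22 \<omega>\<^sub>B \<omega>\<^sub>B t u v w = wedge22 \<omega>\<^sub>A \<omega>\<^sub>A t u v w"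
    "wedge22 \<omega>\<^sub>C \<omega>\<^sub>C t u v w = wedge22 \<omega>\<^sub>A \<omega>\<^sub>A t u v w"
    unfolding wedge22_def abcd F by algebra+
  have "wedge22 \<omega>\<^sub>A \<omega>\<^sub>A (L (axis 1 1)) (L (axis 2 1)) (L (axis 3 1)) (L (axis 4 1)) = 2 * q\<^sup>2"
    unfolding wedge22_def F by (simp add: axis_def power2_eq_square)
  then show "\<exists>t u v w. wedge22 \<omega>\<^sub>A \<omega>\<^sub>A t u v w \<noteq> 0"
    using q by (metis mult_eq_0_iff less_irrefl power2_eq_square zero_neq_numeral)
qed


section \<open>Fundamental forms of parallel complex structures\<close>

lemma riemannian_metricD:
  assumes "riemannian_metric N h" "i \<in> charts N"
  shows "x \<in> cimage N i \<Longrightarrow> bilinear (h i x)" "x \<in> cimage N i \<Longrightarrow> h i x v w = h i x w v"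
    and "x \<in> cimage N i \<Longrightarrow> v \<noteq> 0 \<Longrightarrow> 0 < h i x v v"
    and "smooth_on (cimage N i) (\<lambda>x. h i x v w)"
    and "\<lbrakk>j \<in> charts N; x \<in> overlap N i j\<rbrakk> \<Longrightarrow> h i x v w = h j (transition N i j x)
      (frechet_derivative (transition N i j) (at x) v) (frechet_derivative (transition N i j) (at x) w)"
  using assms by (simp_all add: riemannian_metric_def)

lemma endomorphism_fieldD:
  assumes "endomorphism_field N A" "i \<in> charts N"
  shows "x \<in> cimage N i \<Longrightarrow> linear (A i x)" "smooth_on (cimage N i) (\<lambda>x. A i x v)"
    and "\<lbrakk>j \<in> charts N; x \<in> overlap N i j\<rbrakk> \<Longrightarrow>
      frechet_derivative (transition N i j) (at x) (A i x v) =
        A j (transition N i j x) (frechet_derivative (transition N i j) (at x) v)"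
  using assms by (simp_all add: endomorphism_field_def)

lemma linear_basis_expansion:
  fixes f :: "'e::euclidean_space \<Rightarrow> real"
  assumes "linear f"
  shows "f z = (\<Sum>b\<in>Basis. (z \<bullet> b) * f b)"
proof -
  have "f z = f (\<Sum>b\<in>Basis. (z \<bullet> b) *\<^sub>R b)"
    by (simp add: euclidean_representation)
  also have "\<dots> = (\<Sum>b\<in>Basis. (z \<bullet> b) * f b)"
    using assms by (simp add: linear_sum linear_scale)
  finally show ?thesis .
qed

text \<open>This turns the composite of the fields \<open>h\<close> and \<open>A\<close> into a sum of products of their coefficients, to which
  the product rule and the closure properties of smooth functions apply.\<close>

lemma metric_endomorphism_expansion:
  assumes "riemannian_metric N h" "i \<in> charts N" "x \<in> cimage N i"
  shows "(\<Sum>b\<in>Basis. (A i x v \<bullet> b) * h i x b w) = h i x (A i x v) w"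
proof -
  have "linear (\<lambda>z. h i x z w)"
    using riemannian_metricD(1)[OF assms] by (simp add: bilinear_def)
  from linear_basis_expansion[OF this, of "A i x v"] show ?thesis by simp
qed

lemma diff_form_fundamental_form:
  assumes N: "smooth_manifold N" and h: "riemannian_metric N h" and A: "endomorphism_field N A"
    and skew: "\<And>i x v w. i \<in> charts N \<Longrightarrow> x \<in> cimage N i \<Longrightarrow> h i x (A i x v) w = - h i x (A i x w) v"
  shows "diff_form N 2 (fundamental_form h A)"
  unfolding diff_form_def
proof (intro conjI ballI allI impI)
  fix i assume i: "i \<in> charts N"
  show "multilinear_alternating 2 (fundamental_form h A i x)" if x: "x \<in> cimage N i" for x
    unfolding multilinear_alternating_def
  proof (intro allI impI conjI)
    fix vs :: "'c list" and j :: nat assume vs: "length vs = 2" "j < 2"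
    then obtain u w where uw: "vs = [u, w]"
      by (auto simp: numeral_2_eq_2 length_Suc_conv)
    have "linear (\<lambda>v. h i x v w)" "linear (\<lambda>v. h i x (A i x u) v)"
      using riemannian_metricD(1)[OF h i x] by (auto simp: bilinear_def)
    moreover from linear_compose[OF endomorphism_fieldD(1)[OF A i x] this(1)]
    have "linear (\<lambda>v. h i x (A i x v) w)" by (simp add: o_def)
    ultimately show "linear (\<lambda>v. fundamental_form h A i x (vs[j := v]))"
      using vs(2) uw by (auto simp: fundamental_form_def less_2_cases_iff)
    fix l assume "l < 2" "j \<noteq> l \<and> vs ! j = vs ! l"
    then have "u = w"
      using vs(2) uw by (auto simp: less_2_cases_iff)
    then show "fundamental_form h A i x vs = 0"
      using skew[OF i x, of w w] uw by (simp add: fundamental_form_def)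
  qed
  note op = smooth_manifoldD(5)[OF N i]
  show "smooth_on (cimage N i) (\<lambda>x. fundamental_form h A i x vs)" for vs
  proof -
    have "smooth_on (cimage N i) (\<lambda>x. (A i x v \<bullet> b) * h i x b w)" for v b w
      by (rule smooth_on_mult[OF op smooth_on_linear_image[OF op bounded_linear_inner_left
              endomorphism_fieldD(2)[OF A i]] riemannian_metricD(4)[OF h i]])
    then have *: "smooth_on (cimage N i) (\<lambda>x. \<Sum>b\<in>Basis. (A i x v \<bullet> b) * h i x b w)" for v w
      by (rule smooth_on_sum[OF op])
    have "smooth_on (cimage N i) (\<lambda>x. h i x (A i x v) w)" for v w
      by (rule smooth_on_cong[OF op _ *]) (rule metric_endomorphism_expansion[OF h i])
    then show ?thesis
      by (simp add: fundamental_form_def)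
  qed
  fix j x and vs :: "'c list" assume "j \<in> charts N" "x \<in> overlap N i j" "length vs = 2"
  then show "fundamental_form h A i x vs = fundamental_form h A j (transition N i j x)
      (map (frechet_derivative (transition N i j) (at x)) vs)"
    using riemannian_metricD(5)[OF h i] endomorphism_fieldD(3)[OF A i]
    by (simp add: fundamental_form_def)
qed

text \<open>For a parallel \<open>A\<close> the derivative of the coefficients of \<open>\<omega>\<close> consists of Christoffel terms only.
  In \<open>d\<omega>\<close> they cancel, since the connection has no torsion and \<open>\<omega>\<close> is alternating.\<close>

lemma closed_fundamental_form:
  assumes h: "riemannian_metric N h" and A: "endomorphism_field N A"
    and skew: "\<And>i x v w. i \<in> charts N \<Longrightarrow> x \<in> cimage N i \<Longrightarrow> h i x (A i x v) w = - h i x (A i x w) v"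
    and N: "smooth_manifold N" and lc: "levi_civita N h \<Gamma>" and par: "parallel N \<Gamma> A"
  shows "form_eq N 3 (ext_deriv (fundamental_form h A)) zero_form"
proof (rule form_eqI)
  fix i x and vs :: "'c list"
  assume i: "i \<in> charts N" and x: "x \<in> cimage N i" and "length vs = 3"
  then obtain p q r where vs: "vs = [p, q, r]"
    by (auto simp: numeral_eq_Suc length_Suc_conv)
  have lin: "linear (\<lambda>z. h i x z w)" "linear (\<lambda>z. h i x w z)" for w
    using riemannian_metricD(1)[OF h i x] by (auto simp: bilinear_def)
  have \<Gamma>: "\<Gamma> i x u v = \<Gamma> i x v u" "linear (\<lambda>v. \<Gamma> i x u v)" for u v
    using lc i x unfolding levi_civita_def affine_connection_def bilinear_def by auto
  have D: "frechet_derivative (\<lambda>y. h i y (A i y v) w) (at x) u =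
      h i x (A i x (\<Gamma> i x u v)) w + h i x (A i x v) (\<Gamma> i x u w)" for u v w
  proof -
    let ?DA = "\<lambda>u. frechet_derivative (\<lambda>y. A i y v) (at x) u"
      and ?Dh = "\<lambda>b u. frechet_derivative (\<lambda>y. h i y b w) (at x) u"
    have Dh: "?Dh b u = h i x (\<Gamma> i x u b) w + h i x b (\<Gamma> i x u w)" for b
      using lc i x by (simp add: levi_civita_def)
    have "((\<lambda>y. \<Sum>b\<in>Basis. (A i y v \<bullet> b) * h i y b w) has_derivative
        (\<lambda>u. \<Sum>b\<in>Basis. (A i x v \<bullet> b) * ?Dh b u + (?DA u \<bullet> b) * h i x b w)) (at x)"
      by (intro has_derivative_sum has_derivative_mult has_derivative_inner_left
          smooth_on_has_derivative[OF endomorphism_fieldD(2)[OF A i] x]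
          smooth_on_has_derivative[OF riemannian_metricD(4)[OF h i] x])
    then have "((\<lambda>y. h i y (A i y v) w) has_derivative
        (\<lambda>u. \<Sum>b\<in>Basis. (A i x v \<bullet> b) * ?Dh b u + (?DA u \<bullet> b) * h i x b w)) (at x)"
      by (rule has_derivative_transform_within_open[OF _ smooth_manifoldD(5)[OF N i] x])
        (rule metric_endomorphism_expansion[OF h i])
    then have "frechet_derivative (\<lambda>y. h i y (A i y v) w) (at x) u =
        (\<Sum>b\<in>Basis. (A i x v \<bullet> b) * ?Dh b u) + (\<Sum>b\<in>Basis. (?DA u \<bullet> b) * h i x b w)"
      by (simp add: frechet_derivative_unique sum.distrib)
    also have "(\<Sum>b\<in>Basis. (?DA u \<bullet> b) * h i x b w) = h i x (?DA u) w"
      by (rule linear_basis_expansion[OF lin(1), symmetric])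
    also have "(\<Sum>b\<in>Basis. (A i x v \<bullet> b) * ?Dh b u) =
        h i x (\<Gamma> i x u (A i x v)) w + h i x (A i x v) (\<Gamma> i x u w)"
      unfolding Dh
      using linear_basis_expansion[OF linear_compose_add[OF
            linear_compose[OF \<Gamma>(2)[of u] lin(1)[of w]] lin(1)[of "\<Gamma> i x u w"]], of "A i x v"]
      by simp
    also have "?DA u = A i x (\<Gamma> i x u v) - \<Gamma> i x u (A i x v)"
      using par i x unfolding parallel_def by (simp add: algebra_simps)
    also have "h i x (\<Gamma> i x u (A i x v)) w + h i x (A i x v) (\<Gamma> i x u w) +
        h i x (A i x (\<Gamma> i x u v) - \<Gamma> i x u (A i x v)) w =
        h i x (A i x (\<Gamma> i x u v)) w + h i x (A i x v) (\<Gamma> i x u w)"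
      by (simp add: linear_diff[OF lin(1)])
    finally show ?thesis .
  qed
  show "ext_deriv (fundamental_form h A) i x vs = zero_form i x vs"
    unfolding vs ext_deriv_3 zero_form_def
    using skew[OF i x, of q "\<Gamma> i x p r"]
    by (simp add: fundamental_form_def D \<Gamma>(1)[of q p] \<Gamma>(1)[of r p] \<Gamma>(1)[of r q])
qed


section \<open>Hyperkaehler triples\<close>

text \<open>The part of \<^const>\<open>hyperkaehler\<close> that is inherited by rotated complex structures without recourse to the
  connection.\<close>

definition hyperkaehler_triple ::
  "('a, 'i, 'e::euclidean_space) mfd \<Rightarrow> ('i, 'e) metric_field \<Rightarrow>
   ('i, 'e) endo_field \<Rightarrow> ('i, 'e) endo_field \<Rightarrow> ('i, 'e) endo_field \<Rightarrow> bool" where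
  "hyperkaehler_triple N h A B C \<longleftrightarrow> smooth_manifold N \<and> riemannian_metric N h \<and>
     endomorphism_field N A \<and> endomorphism_field N B \<and> endomorphism_field N C \<and>
     (\<forall>i\<in>charts N. \<forall>x\<in>cimage N i. quaternionic_hermitian (h i x) (A i x) (B i x) (C i x))"

lemma hyperkaehler_tripleD:
  assumes "hyperkaehler_triple N h A B C"
  shows "smooth_manifold N" "riemannian_metric N h"
    "endomorphism_field N A" "endomorphism_field N B" "endomorphism_field N C"
    and "i \<in> charts N \<Longrightarrow> x \<in> cimage N i \<Longrightarrow> quaternionic_hermitian (h i x) (A i x) (B i x) (C i x)"
  using assms by (auto simp: hyperkaehler_triple_def)

lemma hyperkaehler_triple_cyclic:
  "hyperkaehler_triple N h A B C \<Longrightarrow> hyperkaehler_triple N h B C A"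
  by (simp add: hyperkaehler_triple_def quaternionic_cyclic)

lemma hyperkaehler_imp_triple:
  assumes "hyperkaehler N h I J K"
  shows "hyperkaehler_triple N h I J K"
  using assms unfolding hyperkaehler_def hyperkaehler_triple_def quaternionic_hermitian_def
    complex_structure_def almost_complex_structure_def riemannian_metric_def endomorphism_field_def
    hermitian_def
  by simp

lemma endomorphism_field_lincomb:
  assumes N: "smooth_manifold N" and A: "endomorphism_field N A" and B: "endomorphism_field N B"
  shows "endomorphism_field N (\<lambda>i x v. c *\<^sub>R A i x v + s *\<^sub>R B i x v)"
  unfolding endomorphism_field_def
proof (intro conjI ballI allI)
  fix i assume i: "i \<in> charts N"
  show "linear (\<lambda>v. c *\<^sub>R A i x v + s *\<^sub>R B i x v)" if "x \<in> cimage N i" for x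
    by (intro linear_compose_add linear_compose_scale_right endomorphism_fieldD(1)[OF A i that]
        endomorphism_fieldD(1)[OF B i that])
  show "smooth_on (cimage N i) (\<lambda>x. c *\<^sub>R A i x v + s *\<^sub>R B i x v)" for v
    by (intro smooth_on_add smooth_on_scaleR_const smooth_manifoldD(5)[OF N i]
        endomorphism_fieldD(2)[OF A i] endomorphism_fieldD(2)[OF B i])
  fix j x v assume j: "j \<in> charts N" "x \<in> overlap N i j"
  have "linear (frechet_derivative (transition N i j) (at x))"
    using transition_has_derivative[OF N i j] has_derivative_linear by blast
  then show "frechet_derivative (transition N i j) (at x) (c *\<^sub>R A i x v + s *\<^sub>R B i x v) =
      c *\<^sub>R A j (transition N i j x) (frechet_derivative (transition N i j) (at x) v) +
      s *\<^sub>R B j (transition N i j x) (frechet_derivative (transition N i j) (at x) v)"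
    by (simp add: linear_add linear_scale endomorphism_fieldD(3)[OF A i j]
        endomorphism_fieldD(3)[OF B i j])
qed

lemma hyperkaehler_triple_rotate:
  assumes "hyperkaehler_triple N h A B C" "c\<^sup>2 + s\<^sup>2 = 1"
  shows "hyperkaehler_triple N h (\<lambda>i x v. c *\<^sub>R A i x v + s *\<^sub>R B i x v)
    (\<lambda>i x v. (- s) *\<^sub>R A i x v + c *\<^sub>R B i x v) C"
proof -
  note D = hyperkaehler_tripleD[OF assms(1)]
  show ?thesis
    unfolding hyperkaehler_triple_def
    by (intro conjI ballI D(1,2,5) endomorphism_field_lincomb[OF D(1,3,4)]
        quaternionic_rotate[OF D(6) assms(2)])
qed

lemma fundamental_form_skew:
  assumes T: "hyperkaehler_triple N h A B C" and i: "i \<in> charts N" "x \<in> cimage N i"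
  shows "h i x (A i x v) w = - h i x (A i x w) v"
  using quaternionic_skew(1)[OF hyperkaehler_tripleD(6)[OF T i], of v w]
    quaternionic_metric(1)[OF hyperkaehler_tripleD(6)[OF T i], of v "A i x w"] by simp

lemma diff_form_triple:
  assumes "hyperkaehler_triple N h A B C"
  shows "diff_form N 2 (fundamental_form h A)"
  using diff_form_fundamental_form hyperkaehler_tripleD[OF assms] fundamental_form_skew[OF assms]
  by blast

lemma hyperkaehler_closed:
  assumes "hyperkaehler N h I J K"
  shows "form_eq N 3 (ext_deriv (fundamental_form h I)) zero_form"
    "form_eq N 3 (ext_deriv (fundamental_form h J)) zero_form"
    "form_eq N 3 (ext_deriv (fundamental_form h K)) zero_form"
proof -
  have IJK: "hyperkaehler_triple N h I J K"
    by (rule hyperkaehler_imp_triple[OF assms])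
  note JKI = hyperkaehler_triple_cyclic[OF IJK]
  note KIJ = hyperkaehler_triple_cyclic[OF JKI]
  note D = hyperkaehler_tripleD[OF IJK]
  obtain \<Gamma> where \<Gamma>: "levi_civita N h \<Gamma>" "parallel N \<Gamma> I" "parallel N \<Gamma> J" "parallel N \<Gamma> K"
    using assms by (auto simp: hyperkaehler_def)
  show "form_eq N 3 (ext_deriv (fundamental_form h I)) zero_form"
    by (rule closed_fundamental_form[OF D(2,3) fundamental_form_skew[OF IJK] D(1) \<Gamma>(1,2)])
  show "form_eq N 3 (ext_deriv (fundamental_form h J)) zero_form"
    by (rule closed_fundamental_form[OF D(2,4) fundamental_form_skew[OF JKI] D(1) \<Gamma>(1,3)])
  show "form_eq N 3 (ext_deriv (fundamental_form h K)) zero_form"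
    by (rule closed_fundamental_form[OF D(2,5) fundamental_form_skew[OF KIJ] D(1) \<Gamma>(1,4)])
qed


section \<open>Coframes on surfaces\<close>

definition coframe2 ::
  "('b, 'j, real \<times> real) mfd \<Rightarrow> ('j, real \<times> real, real) form \<Rightarrow> ('j, real \<times> real, real) form \<Rightarrow> bool"
  where
  "coframe2 S a b \<longleftrightarrow> smooth_manifold S \<and> diff_form S 1 a \<and> diff_form S 1 b \<and>
     (\<forall>i\<in>charts S. \<forall>x\<in>cimage S i. \<forall>v. a i x [v] = 0 \<and> b i x [v] = 0 \<longrightarrow> v = 0)"

text \<open>Subtraction is written as multiplication by \<open>- 1\<close> here and below, so that smoothness is read off from
  sums and products alone.\<close>

definition coframe_det ::
  "('j, real \<times> real, real) form \<Rightarrow> ('j, real \<times> real, real) form \<Rightarrow> 'j \<Rightarrow> real \<times> real \<Rightarrow> real" where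
  "coframe_det a b i x = a i x [(1, 0)] * b i x [(0, 1)] + - 1 * (a i x [(0, 1)] * b i x [(1, 0)])"

text \<open>Cramer's rule for the vector at which \<open>a\<close> and \<open>b\<close> take the values \<open>p\<close> and \<open>q\<close>.\<close>

definition coframe_solve ::
  "('j, real \<times> real, real) form \<Rightarrow> ('j, real \<times> real, real) form \<Rightarrow> 'j \<Rightarrow> real \<times> real \<Rightarrow>
   real \<Rightarrow> real \<Rightarrow> real \<times> real" where
  "coframe_solve a b i x p q = inverse (coframe_det a b i x) *\<^sub>R
     (p *\<^sub>R (b i x [(0, 1)], - 1 * b i x [(1, 0)]) + q *\<^sub>R (- 1 * a i x [(0, 1)], a i x [(1, 0)]))"

text \<open>The rotation for which \<open>a + i b\<close> is of type \<open>(1,0)\<close>.\<close>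

definition coframe_rotation ::
  "('j, real \<times> real, real) form \<Rightarrow> ('j, real \<times> real, real) form \<Rightarrow> ('j, real \<times> real) endo_field" where
  "coframe_rotation a b = (\<lambda>i x v. coframe_solve a b i x (- 1 * b i x [v]) (a i x [v]))"

lemma linear_1_form:
  assumes "diff_form S 1 a" "i \<in> charts S" "x \<in> cimage S i"
  shows "linear (\<lambda>v. a i x [v])"
proof -
  have "\<forall>vs. length vs = 1 \<longrightarrow> linear (\<lambda>v. a i x (vs[0 := v]))"
    using diff_formD(1)[OF assms] by (auto simp: multilinear_alternating_def)
  from this[rule_format, of "[0]"] show ?thesis by simp
qed

context
  fixes S :: "('b, 'j, real \<times> real) mfd" and a b
  assumes co: "coframe2 S a b"
begin

lemma coframe2D:
  shows "smooth_manifold S" "diff_form S 1 a" "diff_form S 1 b"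
    and "i \<in> charts S \<Longrightarrow> x \<in> cimage S i \<Longrightarrow> a i x [v] = 0 \<Longrightarrow> b i x [v] = 0 \<Longrightarrow> v = 0"
  using co unfolding coframe2_def by blast+

lemma coframe2_linear:
  assumes "i \<in> charts S" "x \<in> cimage S i"
  shows "linear (\<lambda>v. a i x [v])" "linear (\<lambda>v. b i x [v])"
  by (rule linear_1_form[OF coframe2D(2) assms], rule linear_1_form[OF coframe2D(3) assms])

lemma coframe2_linear_simps:
  assumes "i \<in> charts S" "x \<in> cimage S i"
  shows "a i x [v + w] = a i x [v] + a i x [w]" "b i x [v + w] = b i x [v] + b i x [w]"
    "a i x [c *\<^sub>R v] = c * a i x [v]" "b i x [c *\<^sub>R v] = c * b i x [v]"
    "a i x [- v] = - a i x [v]" "b i x [- v] = - b i x [v]"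
    "a i x [v - w] = a i x [v] - a i x [w]" "b i x [v - w] = b i x [v] - b i x [w]"
    "a i x [0] = 0" "b i x [0] = 0"
  using linear_add[OF coframe2_linear(1)[OF assms]] linear_add[OF coframe2_linear(2)[OF assms]]
    linear_scale[OF coframe2_linear(1)[OF assms]] linear_scale[OF coframe2_linear(2)[OF assms]]
    linear_neg[OF coframe2_linear(1)[OF assms]] linear_neg[OF coframe2_linear(2)[OF assms]]
    linear_diff[OF coframe2_linear(1)[OF assms]] linear_diff[OF coframe2_linear(2)[OF assms]]
    linear_0[OF coframe2_linear(1)[OF assms]] linear_0[OF coframe2_linear(2)[OF assms]]
  by simp_all

lemma coframe2_coordinates:
  assumes "i \<in> charts S" "x \<in> cimage S i"
  shows "a i x [(p, q)] = p * a i x [(1, 0)] + q * a i x [(0, 1)]"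
    "b i x [(p, q)] = p * b i x [(1, 0)] + q * b i x [(0, 1)]"
proof -
  have "(p, q) = p *\<^sub>R (1, 0) + q *\<^sub>R (0, 1)" by simp
  then show "a i x [(p, q)] = p * a i x [(1, 0)] + q * a i x [(0, 1)]"
    "b i x [(p, q)] = p * b i x [(1, 0)] + q * b i x [(0, 1)]"
    using coframe2_linear_simps(1-4)[OF assms] by metis+
qed

lemma coframe2_eqI:
  assumes "i \<in> charts S" "x \<in> cimage S i" "a i x [v] = a i x [w]" "b i x [v] = b i x [w]"
  shows "v = w"
  using coframe2D(4)[OF assms(1,2), of "v - w"] coframe2_linear_simps(7,8)[OF assms(1,2)] assms(3,4)
  by simp

lemma coframe_det_nonzero:
  assumes "i \<in> charts S" "x \<in> cimage S i"
  shows "coframe_det a b i x \<noteq> 0"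
proof
  assume D: "coframe_det a b i x = 0"
  note c = coframe2_coordinates[OF assms]
  have "(a i x [(0, 1)], - a i x [(1, 0)]) = (0, 0)"
    using coframe2D(4)[OF assms, of "(a i x [(0, 1)], - a i x [(1, 0)])"] D
      c[of "a i x [(0, 1)]" "- a i x [(1, 0)]"]
    by (simp add: coframe_det_def zero_prod_def algebra_simps)
  moreover have "(b i x [(0, 1)], - b i x [(1, 0)]) = (0, 0)"
    using coframe2D(4)[OF assms, of "(b i x [(0, 1)], - b i x [(1, 0)])"] D
      c[of "b i x [(0, 1)]" "- b i x [(1, 0)]"]
    by (simp add: coframe_det_def zero_prod_def algebra_simps)
  ultimately have "(1, 0) = (0 :: real \<times> real)"
    by (intro coframe2D(4)[OF assms]) simp_all
  then show False by (simp add: zero_prod_def)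
qed

lemma coframe_solve:
  assumes "i \<in> charts S" "x \<in> cimage S i"
  shows "a i x [coframe_solve a b i x p q] = p" "b i x [coframe_solve a b i x p q] = q"
proof -
  define s where "s = p * b i x [(0, 1)] - q * a i x [(0, 1)]"
  define t where "t = q * a i x [(1, 0)] - p * b i x [(1, 0)]"
  have "coframe_solve a b i x p q = inverse (coframe_det a b i x) *\<^sub>R (s, t)"
    by (simp add: coframe_solve_def s_def t_def)
  then have "a i x [coframe_solve a b i x p q] = inverse (coframe_det a b i x) * a i x [(s, t)]"
    "b i x [coframe_solve a b i x p q] = inverse (coframe_det a b i x) * b i x [(s, t)]"
    using coframe2_linear_simps(3,4)[OF assms] by metis+
  moreover have "a i x [(s, t)] = p * coframe_det a b i x" "b i x [(s, t)] = q * coframe_det a b i x"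
    unfolding coframe2_coordinates[OF assms, of s t] unfolding coframe_det_def s_def t_def
    by (simp_all add: algebra_simps)
  ultimately show "a i x [coframe_solve a b i x p q] = p" "b i x [coframe_solve a b i x p q] = q"
    using coframe_det_nonzero[OF assms] by simp_all
qed

lemma coframe_rotation:
  assumes "i \<in> charts S" "x \<in> cimage S i"
  shows "a i x [coframe_rotation a b i x v] = - b i x [v]" "b i x [coframe_rotation a b i x v] = a i x [v]"
  using coframe_solve[OF assms] by (simp_all add: coframe_rotation_def)

lemma coframe_rotation_square:
  assumes "i \<in> charts S" "x \<in> cimage S i"
  shows "coframe_rotation a b i x (coframe_rotation a b i x v) = - v"
  by (rule coframe2_eqI[OF assms]) (simp_all add: coframe_rotation[OF assms] coframe2_linear_simps[OF assms])

text \<open>Smoothness is visible in Cramer's rule. The transformation law is not, but it follows from that of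
  \<open>a\<close> and \<open>b\<close>, since the values of \<open>a\<close> and \<open>b\<close> determine a vector.\<close>

lemma endomorphism_field_coframe_rotation: "endomorphism_field S (coframe_rotation a b)"
  unfolding endomorphism_field_def
proof (intro conjI ballI allI)
  fix i assume i: "i \<in> charts S"
  show "linear (coframe_rotation a b i x)" if x: "x \<in> cimage S i" for x
    by (rule linearI; rule coframe2_eqI[OF i x])
      (simp_all add: coframe_rotation[OF i x] coframe2_linear_simps[OF i x])
  note op = smooth_manifoldD(5)[OF coframe2D(1) i]
  have a: "smooth_on (cimage S i) (\<lambda>x. a i x [v])" and b: "smooth_on (cimage S i) (\<lambda>x. b i x [v])" for v
    using diff_formD(2)[OF coframe2D(2) i] diff_formD(2)[OF coframe2D(3) i] by simp_all
  have "smooth_on (cimage S i) (coframe_det a b i)"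
    unfolding coframe_det_def by (intro smooth_on_add smooth_on_mult smooth_on_const op a b)
  then have "smooth_on (cimage S i) (\<lambda>x. inverse (coframe_det a b i x))"
    by (rule smooth_on_inverse[OF op]) (rule coframe_det_nonzero[OF i])
  then show "smooth_on (cimage S i) (\<lambda>x. coframe_rotation a b i x v)" for v
    unfolding coframe_rotation_def coframe_solve_def
    by (intro smooth_on_scaleR smooth_on_add smooth_on_Pair smooth_on_mult smooth_on_const op a b)
  fix j x v assume j: "j \<in> charts S" "x \<in> overlap S i j"
  have x: "x \<in> cimage S i" and y: "transition S i j x \<in> cimage S j"
    using transition_in_cimage[OF coframe2D(1) i j(2)] overlap_subset_cimage[of S i j] j(2) by auto
  have tr: "a j (transition S i j x) [frechet_derivative (transition S i j) (at x) u] = a i x [u]"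
    "b j (transition S i j x) [frechet_derivative (transition S i j) (at x) u] = b i x [u]" for u
    using diff_formD(3)[OF coframe2D(2) i j, of "[u]"] diff_formD(3)[OF coframe2D(3) i j, of "[u]"]
    by simp_all
  show "frechet_derivative (transition S i j) (at x) (coframe_rotation a b i x v) =
      coframe_rotation a b j (transition S i j x) (frechet_derivative (transition S i j) (at x) v)"
    by (rule coframe2_eqI[OF j(1) y]) (simp_all add: tr coframe_rotation[OF i x] coframe_rotation[OF j(1) y])
qed

end

lemma coframe2_scale:
  assumes "coframe2 S a b" "c \<noteq> 0" "d \<noteq> 0"
  shows "coframe2 S (scale_form c a) (scale_form d b)"
  using assms(1) diff_form_scale_form assms(2,3)
  unfolding coframe2_def by (metis mult_eq_0_iff real_scaleR_def scale_form_def)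

lemma closed_coframe2D:
  assumes "closed_coframe2 S a b" "smooth_manifold S"
  shows "coframe2 S a b" "form_eq S 2 (ext_deriv a) zero_form" "form_eq S 2 (ext_deriv b) zero_form"
proof -
  have "v = 0" if "i \<in> charts S" "x \<in> cimage S i" "a i x [v] = 0" "b i x [v] = 0" for i x v
  proof -
    have "l v = 0" if "linear l" for l :: "real \<times> real \<Rightarrow> real"
    proof -
      obtain c where "\<forall>v. l v = fst c * a i x [v] + snd c * b i x [v]"
        using assms(1) \<open>linear l\<close> \<open>i \<in> charts S\<close> \<open>x \<in> cimage S i\<close>
        unfolding closed_coframe2_def by blast
      with \<open>a i x [v] = 0\<close> \<open>b i x [v] = 0\<close> show ?thesis by (simp del: split_paired_All)
    qed
    from this[OF linear_fst] this[OF linear_snd] show ?thesis by (simp add: prod_eq_iff)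
  qed
  then show "coframe2 S a b" "form_eq S 2 (ext_deriv a) zero_form"
    "form_eq S 2 (ext_deriv b) zero_form"
    using assms by (auto simp: coframe2_def closed_coframe2_def)
qed

text \<open>The angle forms of the two circles: the transition maps of the torus are local translations, so
  the coordinate differentials of the charts fit together.\<close>

lemma closed_coframe2_torus:
  "closed_coframe2 torus (\<lambda>i x vs. fst (vs ! 0)) (\<lambda>i x vs. snd (vs ! 0))"
proof -
  have form: "diff_form torus 1 (\<lambda>i x vs. L (vs ! 0))" if "linear L" for L :: "real \<times> real \<Rightarrow> real"
    unfolding diff_form_def multilinear_alternating_def
    using that by (auto simp: frechet_derivative_transition_torus)
  have "\<exists>!c. \<forall>v. l v = fst c * fst v + snd c * snd v" if "linear l" for l :: "real \<times> real \<Rightarrow> real"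
  proof (rule ex1I[of _ "(l (1, 0), l (0, 1))"])
    have "l v = l (1, 0) * fst v + l (0, 1) * snd v" for v
      using linear_add[OF that, of "fst v *\<^sub>R (1, 0)" "snd v *\<^sub>R (0, 1)"]
        linear_scale[OF that, of "fst v" "(1, 0)"] linear_scale[OF that, of "snd v" "(0, 1)"]
      by simp
    then show "\<forall>v. l v = fst (l (1, 0), l (0, 1)) * fst v + snd (l (1, 0), l (0, 1)) * snd v"
      unfolding fst_conv snd_conv by blast
    show "c = (l (1, 0), l (0, 1))" if "\<forall>v. l v = fst c * fst v + snd c * snd v" for c
      using that by (simp add: prod_eq_iff)
  qed
  then show ?thesis
    unfolding closed_coframe2_def
    using form[OF linear_fst] form[OF linear_snd]
    by (simp add: form_eq_def ext_deriv_def zero_form_def)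
qed


section \<open>The $SU(2)$ structure on the product\<close>

text \<open>The metric that makes \<open>a, b\<close> an orthonormal coframe of the second factor.\<close>

definition product_metric ::
  "('i, 'e) metric_field \<Rightarrow> ('j, 'f, real) form \<Rightarrow> ('j, 'f, real) form \<Rightarrow> ('i \<times> 'j, 'e \<times> 'f) metric_field"
  where
  "product_metric h a b = (\<lambda>i x v w. h (fst i) (fst x) (fst v) (fst w)
     + (a (snd i) (snd x) [snd v] * a (snd i) (snd x) [snd w]
        + b (snd i) (snd x) [snd v] * b (snd i) (snd x) [snd w]))"

definition product_endo ::
  "('i, 'e) endo_field \<Rightarrow> ('j, 'f) endo_field \<Rightarrow> ('i \<times> 'j, 'e \<times> 'f) endo_field" where
  "product_endo A R = (\<lambda>i x v. (A (fst i) (fst x) (fst v), R (snd i) (snd x) (snd v)))"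

lemma endomorphism_field_product:
  assumes N: "smooth_manifold N" and S: "smooth_manifold S"
    and A: "endomorphism_field N A" and R: "endomorphism_field S R"
  shows "endomorphism_field (prod_mfd N S) (product_endo A R)"
  unfolding endomorphism_field_def
proof (intro conjI ballI allI)
  note M = smooth_manifold_prod_mfd[OF N S]
  fix ij assume ij: "ij \<in> charts (prod_mfd N S)"
  obtain i j where i: "i \<in> charts N" and j: "j \<in> charts S" and eq: "ij = (i, j)"
    using ij by auto
  show "linear (product_endo A R ij x)" if "x \<in> cimage (prod_mfd N S) ij" for x
  proof -
    have "linear (A i (fst x))" "linear (R j (snd x))"
      using that endomorphism_fieldD(1)[OF A i] endomorphism_fieldD(1)[OF R j]
      by (auto simp: eq cimage_prod_mfd)
    then show ?thesis
      by (intro linearI) (simp_all add: product_endo_def eq linear_add linear_scale)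
  qed
  note op = smooth_manifoldD(5)[OF M ij]
  show "smooth_on (cimage (prod_mfd N S) ij) (\<lambda>x. product_endo A R ij x v)" for v
    unfolding product_endo_def
  proof (rule smooth_on_Pair[OF op])
    show "smooth_on (cimage (prod_mfd N S) ij) (\<lambda>x. A (fst ij) (fst x) (fst v))"
      by (rule smooth_on_linear_substitution[OF smooth_manifoldD(5)[OF N i] op bounded_linear_fst])
        (auto simp: eq cimage_prod_mfd endomorphism_fieldD(2)[OF A i])
    show "smooth_on (cimage (prod_mfd N S) ij) (\<lambda>x. R (snd ij) (snd x) (snd v))"
      by (rule smooth_on_linear_substitution[OF smooth_manifoldD(5)[OF S j] op bounded_linear_snd])
        (auto simp: eq cimage_prod_mfd endomorphism_fieldD(2)[OF R j])
  qed
  fix kl x v assume kl: "kl \<in> charts (prod_mfd N S)" and x: "x \<in> overlap (prod_mfd N S) ij kl"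
  obtain k l where k: "k \<in> charts N" and l: "l \<in> charts S" and eq': "kl = (k, l)"
    using kl by auto
  have ov: "fst x \<in> overlap N i k" "snd x \<in> overlap S j l"
    using x by (auto simp: eq eq' overlap_prod_mfd)
  have x': "x \<in> cimage (prod_mfd N S) (i, j)"
    using x overlap_subset_cimage[of "prod_mfd N S" ij kl] eq by auto
  show "frechet_derivative (transition (prod_mfd N S) ij kl) (at x) (product_endo A R ij x v) =
      product_endo A R kl (transition (prod_mfd N S) ij kl x)
        (frechet_derivative (transition (prod_mfd N S) ij kl) (at x) v)"
    using frechet_derivative_unique[OF has_derivative_transition_prod_mfd[OF N S i k j l]] x
    by (simp add: eq eq' transition_prod_mfd[OF N S i j x'] product_endo_def
        endomorphism_fieldD(3)[OF A i k ov(1)] endomorphism_fieldD(3)[OF R j l ov(2)])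
qed

lemma riemannian_metric_product:
  fixes N :: "('a, 'i, 'e::euclidean_space) mfd" and S :: "('b, 'j, real \<times> real) mfd"
  assumes N: "smooth_manifold N" and h: "riemannian_metric N h" and co: "coframe2 S a b"
  shows "riemannian_metric (prod_mfd N S) (product_metric h a b)"
  unfolding riemannian_metric_def
proof (intro conjI ballI allI impI)
  note S = coframe2D(1)[OF co]
  note M = smooth_manifold_prod_mfd[OF N S]
  fix ij assume ij: "ij \<in> charts (prod_mfd N S)"
  obtain i j where i: "i \<in> charts N" and j: "j \<in> charts S" and eq: "ij = (i, j)"
    using ij by auto
  fix v w
  show "bilinear (product_metric h a b ij x)"
    "product_metric h a b ij x v w = product_metric h a b ij x w v"
    "v \<noteq> 0 \<Longrightarrow> 0 < product_metric h a b ij x v v" if "x \<in> cimage (prod_mfd N S) ij" for x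
  proof -
    have x: "fst x \<in> cimage N i" "snd x \<in> cimage S j"
      using that by (auto simp: eq cimage_prod_mfd)
    note h' = riemannian_metricD(1-3)[OF h i x(1)]
    note lin = coframe2_linear_simps[OF co j x(2)]
    show "bilinear (product_metric h a b ij x)"
      unfolding bilinear_def
      by (intro allI conjI linearI)
        (simp_all add: eq product_metric_def lin bilinear_ladd[OF h'(1)] bilinear_radd[OF h'(1)]
          bilinear_lmul[OF h'(1)] bilinear_rmul[OF h'(1)] algebra_simps)
    show "product_metric h a b ij x v w = product_metric h a b ij x w v"
      using h'(2)[of "fst v" "fst w"] by (simp add: eq product_metric_def mult.commute)
    assume "v \<noteq> 0"
    show "0 < product_metric h a b ij x v v"
    proof (cases "fst v = 0")
      case True
      then have "snd v \<noteq> 0"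
        using \<open>v \<noteq> 0\<close> by (simp add: prod_eq_iff)
      then have "a j (snd x) [snd v] \<noteq> 0 \<or> b j (snd x) [snd v] \<noteq> 0"
        using coframe2D(4)[OF co j x(2)] by blast
      then have "0 < a j (snd x) [snd v] * a j (snd x) [snd v] + b j (snd x) [snd v] * b j (snd x) [snd v]"
        by (simp add: sum_squares_gt_zero_iff)
      then show ?thesis
        using True bilinear_lzero[OF h'(1)] by (simp add: eq product_metric_def)
    next
      case False
      then show ?thesis
        using h'(3) by (simp add: eq product_metric_def add_pos_nonneg)
    qed
  qed
  note op = smooth_manifoldD(5)[OF M ij]
  have "smooth_on (cimage (prod_mfd N S) ij) (\<lambda>x. h (fst ij) (fst x) (fst v) (fst w))"
    by (rule smooth_on_linear_substitution[OF smooth_manifoldD(5)[OF N i] op bounded_linear_fst])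
      (auto simp: eq cimage_prod_mfd riemannian_metricD(4)[OF h i])
  moreover have "smooth_on (cimage (prod_mfd N S) ij) (\<lambda>x. c (snd ij) (snd x) [snd u])"
    if "diff_form S 1 c" for c :: "('j, real \<times> real, real) form" and u :: "'e \<times> real \<times> real"
    by (rule smooth_on_linear_substitution[OF smooth_manifoldD(5)[OF S j] op bounded_linear_snd])
      (auto simp: eq cimage_prod_mfd intro: diff_formD(2)[OF that j])
  ultimately show "smooth_on (cimage (prod_mfd N S) ij) (\<lambda>x. product_metric h a b ij x v w)"
    unfolding product_metric_def
    by (intro smooth_on_add smooth_on_mult op) (use coframe2D(2,3)[OF co] in blast)+
  fix kl x assume kl: "kl \<in> charts (prod_mfd N S)" and x: "x \<in> overlap (prod_mfd N S) ij kl"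
  obtain k l where k: "k \<in> charts N" and l: "l \<in> charts S" and eq': "kl = (k, l)"
    using kl by auto
  have ov: "fst x \<in> overlap N i k" "snd x \<in> overlap S j l"
    using x by (auto simp: eq eq' overlap_prod_mfd)
  have x': "x \<in> cimage (prod_mfd N S) (i, j)"
    using x overlap_subset_cimage[of "prod_mfd N S" ij kl] eq by auto
  have ab: "a j (snd x) [u] = a l (transition S j l (snd x)) [frechet_derivative (transition S j l) (at (snd x)) u]"
    "b j (snd x) [u] = b l (transition S j l (snd x)) [frechet_derivative (transition S j l) (at (snd x)) u]"
    for u
    using diff_formD(3)[OF coframe2D(2)[OF co] j l ov(2), of "[u]"]
      diff_formD(3)[OF coframe2D(3)[OF co] j l ov(2), of "[u]"] by simp_all
  show "product_metric h a b ij x v w = product_metric h a b kl (transition (prod_mfd N S) ij kl x)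
      (frechet_derivative (transition (prod_mfd N S) ij kl) (at x) v)
      (frechet_derivative (transition (prod_mfd N S) ij kl) (at x) w)"
    using frechet_derivative_unique[OF has_derivative_transition_prod_mfd[OF N S i k j l]] x
    by (simp add: eq eq' transition_prod_mfd[OF N S i j x'] product_metric_def
        riemannian_metricD(5)[OF h i k ov(1)] ab)
qed

text \<open>A definite form is nondegenerate, so the dual vector is determined by its defining property.\<close>

lemma sharp_eqI:
  assumes "bilinear (g i x)" "\<And>v. v \<noteq> 0 \<Longrightarrow> 0 < g i x v v" "\<And>v. g i x u v = a i x [v]"
  shows "sharp g a i x = u"
  unfolding sharp_def
proof (rule the_equality)
  show "\<forall>v. g i x u v = a i x [v]" using assms(3) by simp
  fix u' assume "\<forall>v. g i x u' v = a i x [v]"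
  then have "g i x (u' - u) (u' - u) = 0"
    using assms(3) bilinear_lsub[OF assms(1)] by simp
  then have "\<not> 0 < g i x (u' - u) (u' - u)" by simp
  with assms(2)[of "u' - u"] show "u' = u" by auto
qed

text \<open>The conditions on \<open>\<omega>\<close> and \<open>\<Omega>\<close> live on the first factor and those on \<open>\<alpha>\<close> on the second. The two meet only
  in the contractions, which vanish because the dual vectors of \<open>\<alpha>\<close> are tangent to the second factor, and
  in the fundamental form, where \<open>i/2 \<alpha> \<and> cnj \<alpha> = a \<and> b\<close>.\<close>

lemma su2_structure_product:
  fixes N :: "('a, 'i, real ^ 4) mfd" and S :: "('b, 'j, real \<times> real) mfd"
  assumes T: "hyperkaehler_triple N h A B C" and co: "coframe2 S a b"
    and \<alpha>: "diff_form (prod_mfd N S) 1 \<alpha>"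
    and \<alpha>_eq: "\<And>i x v. i \<in> charts (prod_mfd N S) \<Longrightarrow> x \<in> cimage (prod_mfd N S) i \<Longrightarrow>
      \<alpha> i x [v] = Complex (a (snd i) (snd x) [snd v]) (b (snd i) (snd x) [snd v])"
  defines "\<omega> \<equiv> \<lambda>X. chart_pullback fst fst (fundamental_form h X)"
  shows "su2_structure (prod_mfd N S) (product_endo A (coframe_rotation a b)) (product_metric h a b)
    \<alpha> (\<omega> A) (complex_form (\<omega> B) (\<omega> C))"
proof -
  let ?M = "prod_mfd N S" and ?J = "product_endo A (coframe_rotation a b)"
    and ?g = "product_metric h a b" and ?\<Omega> = "complex_form (\<omega> B) (\<omega> C)"
  note D = hyperkaehler_tripleD[OF T] and S = coframe2D(1)[OF co]
  note M = smooth_manifold_prod_mfd[OF D(1) S]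
  note metric = riemannian_metric_product[OF D(1,2) co]
  note BCA = hyperkaehler_triple_cyclic[OF T]
  note CAB = hyperkaehler_triple_cyclic[OF BCA]
  note lin = linear_in_charts_fst[OF D(1) S]
  have \<omega>: "diff_form ?M 2 (\<omega> A)" "diff_form ?M 2 (\<omega> B)" "diff_form ?M 2 (\<omega> C)"
    unfolding \<omega>_def
    by (rule diff_form_chart_pullback[OF lin diff_form_triple[OF T]]
        diff_form_chart_pullback[OF lin diff_form_triple[OF BCA]]
        diff_form_chart_pullback[OF lin diff_form_triple[OF CAB]])+
  have \<omega>_eq: "\<omega> X i x [v, w] = h (fst i) (fst x) (X (fst i) (fst x) (fst v)) (fst w)" for X i x v w
    by (simp add: \<omega>_def chart_pullback_def fundamental_form_def)
  have pt: "fst i \<in> charts N" "snd i \<in> charts S" "fst x \<in> cimage N (fst i)" "snd x \<in> cimage S (snd i)"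
    if "i \<in> charts ?M" "x \<in> cimage ?M i" for i x
    using that by (cases i; auto simp: cimage_prod_mfd)+
  have Q: "quaternionic_hermitian (h (fst i) (fst x)) (A (fst i) (fst x)) (B (fst i) (fst x)) (C (fst i) (fst x))"
    if "i \<in> charts ?M" "x \<in> cimage ?M i" for i x
    using D(6) pt[OF that] by blast
  have rot: "a (snd i) (snd x) [coframe_rotation a b (snd i) (snd x) v] = - b (snd i) (snd x) [v]"
    "b (snd i) (snd x) [coframe_rotation a b (snd i) (snd x) v] = a (snd i) (snd x) [v]"
    "coframe_rotation a b (snd i) (snd x) (coframe_rotation a b (snd i) (snd x) v) = - v"
    if "i \<in> charts ?M" "x \<in> cimage ?M i" for i x v
    using coframe_rotation[OF co pt(2,4)[OF that]] coframe_rotation_square[OF co pt(2,4)[OF that]] by auto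
  have acs: "almost_complex_structure ?M ?J"
    unfolding almost_complex_structure_def
    using endomorphism_field_product[OF D(1) S D(3) endomorphism_field_coframe_rotation[OF co]]
    by (simp add: product_endo_def rot quaternionic_relations(1)[OF Q] prod_eq_iff
        del: prod_mfd_sel split_paired_All)
  have herm: "hermitian ?M ?g ?J"
    unfolding hermitian_def
    by (simp add: product_endo_def product_metric_def rot quaternionic_metric(3)[OF Q]
        del: prod_mfd_sel split_paired_All)
  have type\<alpha>: "type_p0 ?M ?J 1 \<alpha>"
    unfolding type_p0_def
  proof (intro ballI allI impI)
    fix i x and vs :: "((real ^ 4) \<times> real \<times> real) list" and j :: nat
    assume ix: "i \<in> charts ?M" "x \<in> cimage ?M i" and "length vs = 1" and j: "j < 1"
    then obtain v where vs: "vs = [v]"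
      by (auto simp: length_Suc_conv)
    show "\<alpha> i x (vs[j := ?J i x (vs ! j)]) = \<i> * \<alpha> i x vs"
      using j by (simp add: vs \<alpha>_eq[OF ix] rot[OF ix] product_endo_def complex_eq_iff)
  qed
  \<comment> \<open>The metric makes \<open>a, b\<close> orthonormal, so the vectors dual to them form the dual frame. The sign \<open>s\<close>
    covers \<open>\<alpha>\<close> and its conjugate.\<close>
  define ea where "ea i x = (0 :: real ^ 4, coframe_solve a b (snd i) (snd x) 1 0)"
    for i :: "'i \<times> 'j" and x :: "(real ^ 4) \<times> real \<times> real"
  define eb where "eb s i x = (0 :: real ^ 4, coframe_solve a b (snd i) (snd x) 0 s)"
    for s and i :: "'i \<times> 'j" and x :: "(real ^ 4) \<times> real \<times> real"
  have sharp: "sharp ?g (re_form \<alpha>) i x = ea i x" "sharp ?g (im_form \<alpha>) i x = eb 1 i x"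
    "sharp ?g (re_form (cnj_form \<alpha>)) i x = ea i x" "sharp ?g (im_form (cnj_form \<alpha>)) i x = eb (- 1) i x"
    if ix: "i \<in> charts ?M" "x \<in> cimage ?M i" for i x
    by (rule sharp_eqI[where g = ?g, OF riemannian_metricD(1,3)[OF metric ix]], assumption,
        simp add: product_metric_def ea_def eb_def re_form_def im_form_def cnj_form_def \<alpha>_eq[OF ix]
          bilinear_lzero[OF riemannian_metricD(1)[OF D(2) pt(1,3)[OF ix]]]
          coframe_solve[OF co pt(2,4)[OF ix]])+
  have norm: "form_eq ?M 0 (contract ?g (cnj_form \<alpha>) \<alpha>) (\<lambda>i x vs. 2)"
  proof (rule form_eqI)
    fix i x and vs :: "((real ^ 4) \<times> real \<times> real) list"
    assume ix: "i \<in> charts ?M" "x \<in> cimage ?M i" and "length vs = 0"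
    then show "contract ?g (cnj_form \<alpha>) \<alpha> i x vs = 2"
      using coframe_solve[OF co pt(2,4)[OF ix]]
      by (simp add: contract_def sharp[OF ix] \<alpha>_eq[OF ix] ea_def eb_def complex_eq_iff)
  qed
  have type\<Omega>: "type_p0 ?M ?J 2 ?\<Omega>"
    unfolding type_p0_def
  proof (intro ballI allI impI)
    fix i x and vs :: "((real ^ 4) \<times> real \<times> real) list" and j :: nat
    assume ix: "i \<in> charts ?M" "x \<in> cimage ?M i" and "length vs = 2" and j: "j < 2"
    then obtain v w where vs: "vs = [v, w]"
      by (auto simp: numeral_2_eq_2 length_Suc_conv)
    show "?\<Omega> i x (vs[j := ?J i x (vs ! j)]) = \<i> * ?\<Omega> i x vs"
      using j quaternionic_skew[OF Q[OF ix]]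
      by (auto simp: less_2_cases_iff vs complex_form_def \<omega>_eq product_endo_def complex_eq_iff
          quaternionic_relations[OF Q[OF ix]] quaternionic_bilinear_simps[OF Q[OF ix]])
  qed
  have W: "wedge 2 (\<omega> X) (\<omega> Y) i x [t, u, v, w] =
      wedge22 (\<lambda>v w. h (fst i) (fst x) (X (fst i) (fst x) v) w)
        (\<lambda>v w. h (fst i) (fst x) (Y (fst i) (fst x) v) w) (fst t) (fst u) (fst v) (fst w)"
    for X Y i x t u v w
    by (simp add: wedge_2_4 wedge22_def \<omega>_eq)
  have \<omega>2: "wedge 2 (\<omega> A) (\<omega> B) i x vs = 0" "wedge 2 (\<omega> A) (\<omega> C) i x vs = 0"
    "wedge 2 (\<omega> B) (\<omega> C) i x vs = 0"
    "wedge 2 (\<omega> B) (\<omega> B) i x vs = wedge 2 (\<omega> A) (\<omega> A) i x vs"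
    "wedge 2 (\<omega> C) (\<omega> C) i x vs = wedge 2 (\<omega> A) (\<omega> A) i x vs"
    if ix: "i \<in> charts ?M" "x \<in> cimage ?M i" and "length vs = 4" for i x vs
  proof -
    obtain t u v w where vs: "vs = [t, u, v, w]"
      using \<open>length vs = 4\<close> by (rule length_4E)
    show "wedge 2 (\<omega> A) (\<omega> B) i x vs = 0" "wedge 2 (\<omega> A) (\<omega> C) i x vs = 0"
      "wedge 2 (\<omega> B) (\<omega> C) i x vs = 0"
      "wedge 2 (\<omega> B) (\<omega> B) i x vs = wedge 2 (\<omega> A) (\<omega> A) i x vs"
      "wedge 2 (\<omega> C) (\<omega> C) i x vs = wedge 2 (\<omega> A) (\<omega> A) i x vs"
      unfolding vs W by (rule quaternionic_wedge22[OF Q[OF ix]])+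
  qed
  have \<Omega>2: "wedge 2 ?\<Omega> (cnj_form ?\<Omega>) i x vs = complex_of_real
        (wedge 2 (\<omega> B) (\<omega> B) i x vs + wedge 2 (\<omega> C) (\<omega> C) i x vs)"
    "wedge 2 ?\<Omega> ?\<Omega> i x vs = Complex
        (wedge 2 (\<omega> B) (\<omega> B) i x vs - wedge 2 (\<omega> C) (\<omega> C) i x vs) (2 * wedge 2 (\<omega> B) (\<omega> C) i x vs)"
    "wedge 2 (of_real_form (\<omega> A)) ?\<Omega> i x vs = Complex
        (wedge 2 (\<omega> A) (\<omega> B) i x vs) (wedge 2 (\<omega> A) (\<omega> C) i x vs)"
    if "length vs = 4" for i x vs
  proof -
    obtain t u v w where vs: "vs = [t, u, v, w]"
      using \<open>length vs = 4\<close> by (rule length_4E)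
    show "wedge 2 ?\<Omega> (cnj_form ?\<Omega>) i x vs = complex_of_real
        (wedge 2 (\<omega> B) (\<omega> B) i x vs + wedge 2 (\<omega> C) (\<omega> C) i x vs)"
      "wedge 2 ?\<Omega> ?\<Omega> i x vs = Complex
        (wedge 2 (\<omega> B) (\<omega> B) i x vs - wedge 2 (\<omega> C) (\<omega> C) i x vs) (2 * wedge 2 (\<omega> B) (\<omega> C) i x vs)"
      "wedge 2 (of_real_form (\<omega> A)) ?\<Omega> i x vs = Complex
        (wedge 2 (\<omega> A) (\<omega> B) i x vs) (wedge 2 (\<omega> A) (\<omega> C) i x vs)"
      unfolding vs wedge_2_4 complex_form_def cnj_form_def of_real_form_def
      by (simp_all add: complex_eq_iff algebra_simps)
  qed
  have nondeg: "\<exists>vs. length vs = 4 \<and> wedge 2 (\<omega> A) (\<omega> A) i x vs \<noteq> 0"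
    if ix: "i \<in> charts ?M" "x \<in> cimage ?M i" for i x
  proof -
    obtain t u v w where "wedge22 (\<lambda>v w. h (fst i) (fst x) (A (fst i) (fst x) v) w)
        (\<lambda>v w. h (fst i) (fst x) (A (fst i) (fst x) v) w) t u v w \<noteq> 0"
      using quaternionic_wedge22(6)[OF Q[OF ix]] by blast
    then show ?thesis
      using W[of A A i x "(t, 0)" "(u, 0)" "(v, 0)" "(w, 0)"]
      by (intro exI[of _ "[(t, 0), (u, 0), (v, 0), (w, 0)]"]) simp
  qed
  have contract: "\<eta> i x (ea i x # vs) = 0 \<and> \<eta> i x (eb 1 i x # vs) = 0"
    if ix: "i \<in> charts ?M" "x \<in> cimage ?M i" and "length vs = 1"
      and \<eta>: "\<eta> = ?\<Omega> \<or> \<eta> = of_real_form (\<omega> A)" for \<eta> i x vs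
  proof -
    obtain v where vs: "vs = [v]"
      using \<open>length vs = 1\<close> by (auto simp: length_Suc_conv)
    have "\<omega> A i x [(0, s), v] = 0" "\<omega> B i x [(0, s), v] = 0" "\<omega> C i x [(0, s), v] = 0" for s
      using quaternionic_linear[OF Q[OF ix], THEN linear_0]
        bilinear_lzero[OF riemannian_metricD(1)[OF D(2) pt(1,3)[OF ix]]]
      by (simp_all add: \<omega>_eq)
    note zero = this
    show ?thesis
      using \<eta> by (elim disjE)
        (simp_all add: vs ea_def eb_def complex_form_def of_real_form_def complex_eq_iff zero)
  qed
  have F: "form_eq ?M 2 (of_real_form (fundamental_form ?g ?J))
      (\<lambda>i x vs. of_real_form (\<omega> A) i x vs + \<i> / 2 * wedge 1 \<alpha> (cnj_form \<alpha>) i x vs)"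
  proof (rule form_eqI)
    fix i x and vs :: "((real ^ 4) \<times> real \<times> real) list"
    assume ix: "i \<in> charts ?M" "x \<in> cimage ?M i" and "length vs = 2"
    then obtain v w where vs: "vs = [v, w]"
      by (auto simp: numeral_2_eq_2 length_Suc_conv)
    show "of_real_form (fundamental_form ?g ?J) i x vs =
        of_real_form (\<omega> A) i x vs + \<i> / 2 * wedge 1 \<alpha> (cnj_form \<alpha>) i x vs"
      unfolding vs wedge_1_2
      by (simp add: of_real_form_def fundamental_form_def cnj_form_def \<alpha>_eq[OF ix] \<omega>_eq
          product_metric_def product_endo_def rot[OF ix] complex_eq_iff field_simps)
  qed
  have zero: "form_eq ?M 4 (of_real_form (wedge 2 (\<omega> A) (\<omega> A)))
      (scale_form (1 / 2) (wedge 2 ?\<Omega> (cnj_form ?\<Omega>)))"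
    "form_eq ?M 4 (wedge 2 (of_real_form (\<omega> A)) ?\<Omega>) zero_form"
    "form_eq ?M 4 (wedge 2 ?\<Omega> ?\<Omega>) zero_form"
    by (rule form_eqI, simp add: \<Omega>2 \<omega>2 scale_form_def zero_form_def complex_eq_iff
        of_real_form_def[of "wedge _ _ _"] del: prod_mfd_sel)+
  have contr: "form_eq ?M 1 (contract ?g \<alpha> ?\<Omega>) zero_form"
    "form_eq ?M 1 (contract ?g \<alpha> (of_real_form (\<omega> A))) zero_form"
    by (rule form_eqI, simp add: contract_def sharp contract zero_form_def del: prod_mfd_sel)+
  show ?thesis
    unfolding su2_structure_def
    by (intro conjI ballI M acs metric herm \<alpha> type\<alpha> norm \<omega>(1) type\<Omega> zero contr F nondeg
        diff_form_complex_form[OF M \<omega>(2,3)]) simp_all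
qed


text \<open>The projections undo the rotation: with \<open>\<omega> = cos \<phi> \<omega>\<^sub>A - sin \<phi> \<omega>\<^sub>B\<close> and
  \<open>Re \<Omega> = sin \<phi> \<omega>\<^sub>A + cos \<phi> \<omega>\<^sub>B\<close> they are
  \<open>sin \<phi> (sin \<phi> Re \<Omega> + cos \<phi> \<omega>) = sin \<phi> \<omega>\<^sub>A\<close> and \<open>cos \<phi> (cos \<phi> Re \<Omega> - sin \<phi> \<omega>) = cos \<phi> \<omega>\<^sub>B\<close>.\<close>

lemma arises_from_su2_product:
  fixes N :: "('a, 'i, real ^ 4) mfd" and S :: "('b, 'j, real \<times> real) mfd"
  assumes T: "hyperkaehler_triple N h A B C" and co: "coframe2 S a b"
  defines "M \<equiv> prod_mfd N S"
  shows "arises_from_su2 M \<phi> (complex_form (pullback M S snd a) (pullback M S snd b))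
    (scale_form (sin \<phi>) (pullback M N fst (fundamental_form h A)))
    (scale_form (cos \<phi>) (pullback M N fst (fundamental_form h B)))
    (pullback M N fst (fundamental_form h C))"
proof -
  note D = hyperkaehler_tripleD[OF T] and S = coframe2D[OF co]
  note M = smooth_manifold_prod_mfd[OF D(1) S(1), folded M_def]
  note fst = linear_in_charts_fst[OF D(1) S(1), folded M_def]
    and snd = linear_in_charts_snd[OF D(1) S(1), folded M_def]
  note BCA = hyperkaehler_triple_cyclic[OF T]
  note CAB = hyperkaehler_triple_cyclic[OF BCA]
  let ?\<alpha> = "complex_form (pullback M S snd a) (pullback M S snd b)"
  have \<alpha>: "diff_form M 1 ?\<alpha>"
    by (rule diff_form_complex_form[OF M diff_form_pullback[OF snd S(2)] diff_form_pullback[OF snd S(3)]])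
  have \<alpha>_eq: "?\<alpha> i x [v] = Complex (a (snd i) (snd x) [snd v]) (b (snd i) (snd x) [snd v])"
    if "i \<in> charts M" "x \<in> cimage M i" for i x v
    using form_eqD[OF pullback_eq_chart_pullback[OF snd S(2)] that, of "[v]"]
      form_eqD[OF pullback_eq_chart_pullback[OF snd S(3)] that, of "[v]"]
    by (simp add: complex_form_def chart_pullback_def)
  define A' where "A' = (\<lambda>i x v. cos \<phi> *\<^sub>R A i x v + (- sin \<phi>) *\<^sub>R B i x v)"
  define B' where "B' = (\<lambda>i x v. (- (- sin \<phi>)) *\<^sub>R A i x v + cos \<phi> *\<^sub>R B i x v)"
  have T': "hyperkaehler_triple N h A' B' C"
    unfolding A'_def B'_def by (rule hyperkaehler_triple_rotate[OF T]) simp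
  let ?\<omega> = "\<lambda>X. chart_pullback fst fst (fundamental_form h X)"
  have su2: "su2_structure M (product_endo A' (coframe_rotation a b)) (product_metric h a b) ?\<alpha>
      (?\<omega> A') (complex_form (?\<omega> B') (?\<omega> C))"
    unfolding M_def by (rule su2_structure_product[OF T' co \<alpha>[unfolded M_def] \<alpha>_eq[unfolded M_def]])
  have \<omega>: "pullback M N fst (fundamental_form h A) i x vs = ?\<omega> A i x vs"
    "pullback M N fst (fundamental_form h B) i x vs = ?\<omega> B i x vs"
    "pullback M N fst (fundamental_form h C) i x vs = ?\<omega> C i x vs"
    "?\<omega> A' i x vs = cos \<phi> * ?\<omega> A i x vs - sin \<phi> * ?\<omega> B i x vs"
    "?\<omega> B' i x vs = sin \<phi> * ?\<omega> A i x vs + cos \<phi> * ?\<omega> B i x vs"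
    if ix: "i \<in> charts M" "x \<in> cimage M i" "length vs = 2" for i x vs
  proof -
    have "bilinear (h (fst i) (fst x))"
      using riemannian_metricD(1)[OF D(2)] linear_in_chartsD(4,5)[OF fst] ix by blast
    note h = bilinear_ladd[OF this] bilinear_lmul[OF this] bilinear_lsub[OF this] bilinear_lneg[OF this]
    show "?\<omega> A' i x vs = cos \<phi> * ?\<omega> A i x vs - sin \<phi> * ?\<omega> B i x vs"
      "?\<omega> B' i x vs = sin \<phi> * ?\<omega> A i x vs + cos \<phi> * ?\<omega> B i x vs"
      by (simp_all add: chart_pullback_def fundamental_form_def A'_def B'_def h)
  qed (rule form_eqD[OF pullback_eq_chart_pullback[OF fst diff_form_triple[OF T]] that]
      form_eqD[OF pullback_eq_chart_pullback[OF fst diff_form_triple[OF BCA]] that]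
      form_eqD[OF pullback_eq_chart_pullback[OF fst diff_form_triple[OF CAB]] that])+
  have trig: "(1 - cos (2 * \<phi>)) / 2 = (sin \<phi>)\<^sup>2" "(1 + cos (2 * \<phi>)) / 2 = (cos \<phi>)\<^sup>2"
    "sin (2 * \<phi>) / 2 = sin \<phi> * cos \<phi>"
    by (simp_all add: cos_double sin_double cos_squared_eq)
  have proj: "1 / 2 * ((1 - cos (2 * \<phi>)) * (sin \<phi> * p + cos \<phi> * q) + sin (2 * \<phi>) * (cos \<phi> * p - sin \<phi> * q))
      = sin \<phi> * p" (is ?par)
    "1 / 2 * ((1 + cos (2 * \<phi>)) * (sin \<phi> * p + cos \<phi> * q) - sin (2 * \<phi>) * (cos \<phi> * p - sin \<phi> * q))
      = cos \<phi> * q" (is ?perp) for p q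
  proof -
    have "1 / 2 * ((1 - cos (2 * \<phi>)) * (sin \<phi> * p + cos \<phi> * q) + sin (2 * \<phi>) * (cos \<phi> * p - sin \<phi> * q))
        = (1 - cos (2 * \<phi>)) / 2 * (sin \<phi> * p + cos \<phi> * q) + sin (2 * \<phi>) / 2 * (cos \<phi> * p - sin \<phi> * q)"
      by (simp add: field_simps)
    also have "\<dots> = sin \<phi> * p * ((sin \<phi>)\<^sup>2 + (cos \<phi>)\<^sup>2)"
      unfolding trig by (simp only: power2_eq_square) algebra
    finally show ?par by simp
    have "1 / 2 * ((1 + cos (2 * \<phi>)) * (sin \<phi> * p + cos \<phi> * q) - sin (2 * \<phi>) * (cos \<phi> * p - sin \<phi> * q))
        = (1 + cos (2 * \<phi>)) / 2 * (sin \<phi> * p + cos \<phi> * q) - sin (2 * \<phi>) / 2 * (cos \<phi> * p - sin \<phi> * q)"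
      by (simp add: field_simps)
    also have "\<dots> = cos \<phi> * q * ((sin \<phi>)\<^sup>2 + (cos \<phi>)\<^sup>2)"
      unfolding trig by (simp only: power2_eq_square) algebra
    finally show ?perp by simp
  qed
  show ?thesis
    unfolding arises_from_su2_def
  proof (intro exI conjI)
    show "form_eq M 2 (scale_form (sin \<phi>) (pullback M N fst (fundamental_form h A)))
        (re_par \<phi> (?\<omega> A') (complex_form (?\<omega> B') (?\<omega> C)))"
      by (rule form_eqI) (simp only: \<omega> re_par_def re_form_def complex_form_def complex.sel proj
          scale_form_def real_scaleR_def)
    show "form_eq M 2 (scale_form (cos \<phi>) (pullback M N fst (fundamental_form h B)))
        (re_perp \<phi> (?\<omega> A') (complex_form (?\<omega> B') (?\<omega> C)))"
      by (rule form_eqI) (simp only: \<omega> re_perp_def re_form_def complex_form_def complex.sel proj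
          scale_form_def real_scaleR_def)
    show "form_eq M 2 (pullback M N fst (fundamental_form h C))
        (im_form (complex_form (?\<omega> B') (?\<omega> C)))"
      by (rule form_eqI) (simp only: \<omega> im_form_def complex_form_def complex.sel)
  qed (rule su2)
qed


section \<open>The SUSY equations\<close>

lemma re_complex_form [simp]: "re_form (complex_form a b) = a"
  by (simp add: re_form_def complex_form_def)

lemma im_complex_form [simp]: "im_form (complex_form a b) = b"
  by (simp add: im_form_def complex_form_def)

lemma scale_form_pullback: "scale_form c (pullback M N f \<omega>) = pullback M N f (scale_form c \<omega>)"
  by (simp add: scale_form_def pullback_def Let_def)

lemma diff_form_zero: "diff_form M k zero_form"
  by (simp add: diff_form_def multilinear_alternating_def zero_form_def linear_zero)

lemma form_eq_zero_zero:
  "form_eq M k a zero_form \<Longrightarrow> form_eq M k b zero_form \<Longrightarrow> form_eq M k a b"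
  using form_eq_trans form_eq_sym by metis

lemma closed_scale_form:
  fixes a :: "('i, 'e::euclidean_space, 'v::real_normed_vector) form"
  assumes "diff_form M k a" "form_eq M (Suc k) (ext_deriv a) zero_form"
  shows "form_eq M (Suc k) (ext_deriv (scale_form c a)) zero_form"
  using form_eq_trans[OF ext_deriv_scale_form[OF assms(1)] form_eq_zero_scale[OF assms(2)]] .

lemma arcsin_on_unit_circle:
  assumes "0 < p" "0 < q" "p\<^sup>2 + q\<^sup>2 = 1"
  shows "0 < arcsin p" "arcsin p < pi / 2" "sin (arcsin p) = p" "cos (arcsin p) = q"
proof -
  have p: "p < 1"
  proof (rule power2_less_imp_less)
    have "0 < q\<^sup>2" using assms(2) by simp
    with assms(3) have "p\<^sup>2 < 1" by linarith
    then show "p\<^sup>2 < 1\<^sup>2" by simp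
  qed simp
  show "0 < arcsin p"
    using arcsin_less_mono[of 0 p] assms(1) p by simp
  show "arcsin p < pi / 2"
    using arcsin_less_mono[of p 1] assms(1) p by simp
  show "sin (arcsin p) = p"
    using assms(1) p by simp
  have "1 - p\<^sup>2 = q\<^sup>2"
    using assms(3) by simp
  then show "cos (arcsin p) = q"
    using assms(1,2) p by (simp add: cos_arcsin)
qed

text \<open>Every form that is differentiated in the equations is closed, so they hold with \<open>H = 0\<close>. The two types differ in the cyclic order of
  the triple and in the angle.\<close>

lemma susy_product:
  fixes N :: "('a, 'i, real ^ 4) mfd" and S :: "('b, 'j, real \<times> real) mfd"
  assumes N: "hyperkaehler N h I J K" and co: "coframe2 S a b"
    and closed: "form_eq S 2 (ext_deriv a) zero_form" "form_eq S 2 (ext_deriv b) zero_form"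
    and k: "0 < k_par" "0 < k_perp" "k_par\<^sup>2 + k_perp\<^sup>2 = 1"
  defines "M \<equiv> prod_mfd N S"
  defines "\<alpha> \<equiv> complex_form (pullback M S snd a) (pullback M S snd b)"
    and "\<omega> \<equiv> \<lambda>X. pullback M N fst (fundamental_form h X)"
  shows "susy_IIA M k_par k_perp \<alpha> (scale_form (- k_par) (\<omega> J)) (scale_form k_perp (\<omega> K)) (\<omega> I)"
    and "susy_IIB M k_par k_perp \<alpha> (scale_form k_perp (\<omega> K)) (scale_form k_par (\<omega> I)) (\<omega> J)"
proof -
  note IJK = hyperkaehler_imp_triple[OF N]
  note JKI = hyperkaehler_triple_cyclic[OF IJK]
  note KIJ = hyperkaehler_triple_cyclic[OF JKI]
  note S = coframe2D[OF co]
  note fst = linear_in_charts_fst[OF hyperkaehler_tripleD(1)[OF IJK] S(1), folded M_def]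
    and snd = linear_in_charts_snd[OF hyperkaehler_tripleD(1)[OF IJK] S(1), folded M_def]
  note M = linear_in_chartsD(1)[OF fst]
  have S3: "Suc 2 = 3" by simp
  have \<omega>: "\<omega> X = pullback M N fst (fundamental_form h X)" for X
    by (simp add: \<omega>_def)
  note form = diff_form_pullback[OF fst diff_form_triple[OF IJK], folded \<omega>]
    diff_form_pullback[OF fst diff_form_triple[OF JKI], folded \<omega>]
    diff_form_pullback[OF fst diff_form_triple[OF KIJ], folded \<omega>]
  have d\<omega>: "form_eq M 3 (ext_deriv (\<omega> I)) zero_form" "form_eq M 3 (ext_deriv (\<omega> J)) zero_form"
    "form_eq M 3 (ext_deriv (\<omega> K)) zero_form"
    using closed_pullback[OF fst diff_form_triple[OF IJK]] closed_pullback[OF fst diff_form_triple[OF JKI]]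
      closed_pullback[OF fst diff_form_triple[OF KIJ]] hyperkaehler_closed[OF N]
    unfolding \<omega> S3 by blast+
  have d\<omega>_scale: "form_eq M 3 (ext_deriv (scale_form c (\<omega> I))) zero_form"
    "form_eq M 3 (ext_deriv (scale_form c (\<omega> J))) zero_form"
    "form_eq M 3 (ext_deriv (scale_form c (\<omega> K))) zero_form" for c
    using closed_scale_form[OF form(1)] closed_scale_form[OF form(2)] closed_scale_form[OF form(3)] d\<omega>
    unfolding S3 by blast+
  have d\<alpha>: "form_eq M 2 (ext_deriv (re_form \<alpha>)) zero_form" "form_eq M 2 (ext_deriv (im_form \<alpha>)) zero_form"
    using closed_pullback[OF snd S(2)] closed_pullback[OF snd S(3)] closed
    unfolding \<alpha>_def re_complex_form im_complex_form Suc_1 by blast+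
  have wedge13: "form_eq M 4 (wedge 1 p q) zero_form" if "form_eq M 3 q zero_form"
    for p q :: "('i \<times> 'j, (real ^ 4) \<times> real \<times> real, real) form"
    using wedge_zero_right[OF that, of 1 p] by simp
  have wedge12: "form_eq M 3 (wedge 1 p q) zero_form" if "form_eq M 2 q zero_form"
    for p q :: "('i \<times> 'j, (real ^ 4) \<times> real \<times> real, real) form"
    using wedge_zero_right[OF that, of 1 p] by (simp add: numeral_3_eq_3)
  have wedge23: "form_eq M 5 (wedge 2 p q) zero_form" if "form_eq M 3 q zero_form"
    for p q :: "('i \<times> 'j, (real ^ 4) \<times> real \<times> real, real) form"
    using wedge_zero_right[OF that, of 2 p] by simp
  have H: "form_eq M n zero_form zero_form" for n
    by (simp add: form_eq_def)
  have im: "diff_form M 1 (im_form \<alpha>)"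
    unfolding \<alpha>_def im_complex_form by (rule diff_form_pullback[OF snd S(3)])
  note par = arcsin_on_unit_circle[OF k]
    and perp = arcsin_on_unit_circle[OF k(2,1), unfolded add.commute[of "k_perp\<^sup>2"], OF k(3)]
  show "susy_IIA M k_par k_perp \<alpha> (scale_form (- k_par) (\<omega> J)) (scale_form k_perp (\<omega> K)) (\<omega> I)"
    unfolding susy_IIA_def
  proof (intro conjI exI[of _ "- arcsin k_par"] exI[of _ zero_form])
    show "- pi / 2 < - arcsin k_par"
      using par(2) by simp
    show "arises_from_su2 M (- arcsin k_par) \<alpha> (scale_form (- k_par) (\<omega> J)) (scale_form k_perp (\<omega> K)) (\<omega> I)"
      using arises_from_su2_product[OF JKI co, of "- arcsin k_par", folded M_def, folded \<alpha>_def]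
      by (simp add: \<omega> par)
    show "form_eq M 3 (scale_form k_par zero_form) (scale_form k_perp (ext_deriv (\<omega> I)))"
      by (intro form_eq_zero_zero[OF form_eq_zero_scale form_eq_zero_scale] H d\<omega>)
    show "form_eq M 3 (ext_deriv (scale_form k_perp (\<omega> K)))
        (scale_form (k_par * k_perp) (wedge 1 (re_form \<alpha>) (ext_deriv (im_form \<alpha>))))"
      by (intro form_eq_zero_zero[OF d\<omega>_scale(3) form_eq_zero_scale] wedge12 d\<alpha>)
    show "form_eq M 4 (wedge 3 zero_form (re_form \<alpha>))
        (scale_form (- (k_perp / k_par)) (ext_deriv (wedge 1 (im_form \<alpha>) (scale_form (- k_par) (\<omega> J)))))"
      by (intro form_eq_zero_zero[OF wedge_zero_left[OF H] form_eq_zero_scale] closed_wedge_1_2 im d\<alpha>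
          d\<omega>_scale diff_form_scale_form M form)
  qed (simp_all add: par diff_form_zero d\<alpha>)
  show "susy_IIB M k_par k_perp \<alpha> (scale_form k_perp (\<omega> K)) (scale_form k_par (\<omega> I)) (\<omega> J)"
    unfolding susy_IIB_def
  proof (intro conjI exI[of _ "arcsin k_perp"] exI[of _ zero_form])
    show "arcsin k_perp < pi / 2"
      by (rule perp(2))
    show "arises_from_su2 M (arcsin k_perp) \<alpha> (scale_form k_perp (\<omega> K)) (scale_form k_par (\<omega> I)) (\<omega> J)"
      using arises_from_su2_product[OF KIJ co, of "arcsin k_perp", folded M_def, folded \<alpha>_def]
      by (simp add: \<omega> perp)
    show "form_eq M 3 (scale_form k_par zero_form) (scale_form k_perp (ext_deriv (\<omega> J)))"
      by (intro form_eq_zero_zero[OF form_eq_zero_scale form_eq_zero_scale] H d\<omega>)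
    show "form_eq M 4 (wedge 1 (re_form \<alpha>) zero_form)
        (scale_form (- (k_perp / k_par)) (wedge 1 (im_form \<alpha>) (ext_deriv (scale_form k_par (\<omega> I)))))"
      and "form_eq M 4 (wedge 1 (im_form \<alpha>) zero_form)
        (scale_form (k_perp / k_par) (wedge 1 (re_form \<alpha>) (ext_deriv (scale_form k_par (\<omega> I)))))"
      by (intro form_eq_zero_zero[OF wedge13[OF H] form_eq_zero_scale] wedge13 d\<omega>_scale)+
    show "form_eq M 5 (wedge 2 (wedge 1 (re_form \<alpha>) (im_form \<alpha>)) (ext_deriv (scale_form k_perp (\<omega> K))))
        (scale_form (- 1) (wedge 3 zero_form (\<omega> J)))"
      by (rule form_eq_zero_zero[OF wedge23[OF d\<omega>_scale(3)] form_eq_zero_scale[OF wedge_zero_left[OF H]]])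
  qed (simp_all add: perp diff_form_zero d\<alpha>)
qed

theorem proposition3p8:
  fixes N :: "('a, 'i, real ^ 4) mfd"
    and h :: "('i, real ^ 4) metric_field"
    and I J K :: "('i, real ^ 4) endo_field"
    and k_par k_perp :: real
  assumes "hyperkaehler N h I J K"
    and "compact_space (mtop N)"
    and "0 < k_par" "k_par < 1" "0 < k_perp" "k_perp < 1"
    and "k_par\<^sup>2 + k_perp\<^sup>2 = 1"
  shows
    "let M = prod_mfd N torus;
         \<omega>\<^sub>I = pullback M N fst (fundamental_form h I);
         \<omega>\<^sub>J = pullback M N fst (fundamental_form h J);
         \<omega>\<^sub>K = pullback M N fst (fundamental_form h K)
     in (\<exists>\<alpha> R_par R_perp Im_Omega. susy_IIA M k_par k_perp \<alpha> R_par R_perp Im_Omega) \<and>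
        (\<exists>\<alpha> R_par R_perp Im_Omega. susy_IIB M k_par k_perp \<alpha> R_par R_perp Im_Omega) \<and>
        (\<forall>b\<^sub>1 b\<^sub>2. closed_coframe2 torus b\<^sub>1 b\<^sub>2 \<longrightarrow>
           (let \<beta>\<^sub>1 = pullback M torus snd b\<^sub>1;
                \<beta>\<^sub>2 = pullback M torus snd b\<^sub>2
            in susy_IIA M k_par k_perp
                 (complex_form \<beta>\<^sub>1 (scale_form (1 / k_par) \<beta>\<^sub>2))
                 (scale_form (- k_par) \<omega>\<^sub>J) (scale_form k_perp \<omega>\<^sub>K) \<omega>\<^sub>I \<and>
               susy_IIB M k_par k_perp
                 (complex_form (scale_form (1 / k_par) \<beta>\<^sub>1) \<beta>\<^sub>2)
                 (scale_form k_perp \<omega>\<^sub>K) (scale_form k_par \<omega>\<^sub>I) \<omega>\<^sub>J))"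
proof -
  let ?M = "prod_mfd N torus" and ?\<omega> = "\<lambda>X. pullback (prod_mfd N torus) N fst (fundamental_form h X)"
  let ?\<beta> = "\<lambda>b. pullback (prod_mfd N torus) torus snd b"
  have scale: "coframe2 torus (scale_form c b\<^sub>1) (scale_form d b\<^sub>2)"
    "form_eq torus 2 (ext_deriv (scale_form c b\<^sub>1)) zero_form"
    "form_eq torus 2 (ext_deriv (scale_form d b\<^sub>2)) zero_form"
    if "closed_coframe2 torus b\<^sub>1 b\<^sub>2" "c \<noteq> 0" "d \<noteq> 0" for b\<^sub>1 b\<^sub>2 and c d :: real
  proof -
    note cl = closed_coframe2D[OF that(1) smooth_manifold_torus]
    show "coframe2 torus (scale_form c b\<^sub>1) (scale_form d b\<^sub>2)"
      by (rule coframe2_scale[OF cl(1) that(2,3)])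
    show "form_eq torus 2 (ext_deriv (scale_form c b\<^sub>1)) zero_form"
      "form_eq torus 2 (ext_deriv (scale_form d b\<^sub>2)) zero_form"
      using closed_scale_form[OF coframe2D(2)[OF cl(1)], unfolded Suc_1, OF cl(2)]
        closed_scale_form[OF coframe2D(3)[OF cl(1)], unfolded Suc_1, OF cl(3)] by blast+
  qed
  have one: "scale_form 1 b = b" for b :: "(real \<times> real, real \<times> real, real) form"
    by (simp add: scale_form_def)
  have susy: "susy_IIA ?M k_par k_perp (complex_form (?\<beta> b\<^sub>1) (scale_form (1 / k_par) (?\<beta> b\<^sub>2)))
      (scale_form (- k_par) (?\<omega> J)) (scale_form k_perp (?\<omega> K)) (?\<omega> I)"
    "susy_IIB ?M k_par k_perp (complex_form (scale_form (1 / k_par) (?\<beta> b\<^sub>1)) (?\<beta> b\<^sub>2))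
      (scale_form k_perp (?\<omega> K)) (scale_form k_par (?\<omega> I)) (?\<omega> J)"
    if "closed_coframe2 torus b\<^sub>1 b\<^sub>2" for b\<^sub>1 b\<^sub>2
    using susy_product(1)[OF assms(1) scale[OF that, of 1 "1 / k_par"] assms(3,5,7)]
      susy_product(2)[OF assms(1) scale[OF that, of "1 / k_par" 1] assms(3,5,7)] assms(3)
    by (simp_all add: one scale_form_pullback)
  \<comment> \<open>The first two claims are witnessed by the angle forms.\<close>
  show ?thesis
    unfolding Let_def using susy susy[OF closed_coframe2_torus] by blast
qed

end
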